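(* Fix a positive integer $k$. Let $q$ be a positive integer that is divisible by the cube of every prime that divides it, and let $m,n$ be positive integers. Then $$\Delta^*(m,n;q) = \sum_{\substack{d\mid\gcd(m,n,q)\\ e\mid q}}\mu(d)\mu(e)\,\Delta\!\left(\tfrac{m}{d},\tfrac{n}{d};\tfrac{q}{de}\right).$$
   Context: For a positive integer $\ell$, $\mathcal{A}(\ell)$ is the (finite-dimensional) space of weight $k$ holomorphic cusp forms on $\Gamma_0(\ell)$, with Petersson inner product $\langle f, g\rangle = \int_{\Gamma_0(\ell)\backslash\mathbb{H}} f(z)\overline{g(z)}\, y^k \, d\mu_\ell(z)$, where $d\mu_\ell$ is a multiple of $\frac{dx\,dy}{y^2}$ normalized so that the total volume of $\Gamma_0(\ell)\backslash\mathbb{H}$ is a constant independent of $\ell$ (for instance $d\mu_\ell = \operatorname{vol}(\Gamma_0(\ell)\backslash\mathbb{H})^{-1}\frac{dx\,dy}{y^2}$). For $\varphi \in \mathcal{A}(\ell)$ and a positive integer $d$, $\varphi|_d(z) := d^{k/2}\varphi(dz)$. The oldspace of $\mathcal{A}(\ell)$ is the span of the forms $\varphi|_d$ over all divisors $\ell' \neq \ell$ of $\ell$, all divisors $d$ of $\ell/\ell'$, and all $\varphi\in\mathcal{A}(\ell')$. The newspace $\mathcal{A}^*(\ell)$ is the orthogonal complement of the oldspace in $\mathcal{A}(\ell)$. $\mathcal{B}(\ell)$ and $\mathcal{B}^*(\ell)$ denote arbitrary orthonormal bases of $\mathcal{A}(\ell)$ and $\mathcal{A}^*(\ell)$. The Fourier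 expansion of $\varphi\in\mathcal{A}(\ell)$ is written $\varphi(z) = \sum_{n\geq1} n^{k/2}\rho(n;\varphi)e^{2\pi i n z}$. Set $$\Delta(m,n;\ell) := \sum_{\varphi\in\mathcal{B}(\ell)}\rho(m;\varphi)\overline{\rho(n;\varphi)},\qquad \Delta^*(m,n;\ell) := \sum_{\varphi\in\mathcal{B}^*(\ell)}\rho(m;\varphi)\overline{\rho(n;\varphi)}.$$ $\mu$ is the Möbius function. Terms with $\mu(d)\mu(e)=0$ are understood to be zero; when $d,e$ are squarefree divisors of $q$, the hypothesis on $q$ ensures $de\mid q$. *)

theory Defs
  imports
    "HOL-Complex_Analysis.Complex_Analysis"
    "HOL-Computational_Algebra.Squarefree"
    "HOL-Library.Function_Algebras"
begin

definition moebius_mu :: "nat \<Rightarrow> int" where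
  "moebius_mu n = (if squarefree n then (- 1) ^ card (prime_factors n) else 0)"

global_interpretation cfun: vector_space "\<lambda>(c::complex) (f::complex \<Rightarrow> complex) z. c * f z"
  defines cfun_span = cfun.span
  by standard (auto simp: fun_eq_iff algebra_simps)

definition upper_half_plane :: "complex set" where
  "upper_half_plane = {z. Im z > 0}"

definition SL2Z :: "(int^2^2) set" where
  "SL2Z = {A. det A = 1}"

definition Gamma0 :: "nat \<Rightarrow> (int^2^2) set" where
  "Gamma0 l = {A \<in> SL2Z. int l dvd A$2$1}"

definition aut_factor :: "int^2^2 \<Rightarrow> complex \<Rightarrow> complex" where
  "aut_factor A z = of_int (A$2$1) * z + of_int (A$2$2)"

definition moebius :: "int^2^2 \<Rightarrow> complex \<Rightarrow> complex" where
  "moebius A z = (of_int (A$1$1) * z + of_int (A$1$2)) / aut_factor A z"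

text \<open>Forms are total functions on the complex numbers, set to zero off the upper half plane, so
  that equality of functions is equality of forms. A form vanishes at a cusp if its translate by
  the corresponding element of the full modular group tends to zero as the imaginary part
  tends to infinity, uniformly in the real part; for a holomorphic periodic function this says that
  only positive exponents occur in its Fourier expansion at that cusp.\<close>

definition cusp_forms :: "nat \<Rightarrow> nat \<Rightarrow> (complex \<Rightarrow> complex) set" where
  "cusp_forms k l = {f.
     f holomorphic_on upper_half_plane \<and>
     (\<forall>A\<in>Gamma0 l. \<forall>z\<in>upper_half_plane. f (moebius A z) = aut_factor A z ^ k * f z) \<and>
     (\<forall>A\<in>SL2Z. ((\<lambda>z. f (moebius A z) / aut_factor A z ^ k) \<longlongrightarrow> 0) (filtercomap Im at_top)) \<and>
     (\<forall>z. z \<notin> upper_half_plane \<longrightarrow> f z = 0)}"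

definition hyperbolic_measure :: "complex measure" where
  "hyperbolic_measure = density lborel (\<lambda>z. ennreal (1 / (Im z)\<^sup>2))"

text \<open>Only the identity and its negative act trivially on the upper half plane.\<close>

definition is_fundamental_domain :: "(int^2^2) set \<Rightarrow> complex set \<Rightarrow> bool" where
  "is_fundamental_domain G D \<longleftrightarrow>
     D \<in> sets borel \<and> D \<subseteq> upper_half_plane \<and>
     (\<forall>z\<in>upper_half_plane. \<exists>A\<in>G. moebius A z \<in> D) \<and>
     (\<forall>A\<in>G. A \<noteq> mat 1 \<and> A \<noteq> - mat 1 \<longrightarrow> D \<inter> moebius A ` D \<in> null_sets lborel)"

text \<open>The integral of an invariant function, and the volume, do not depend on the choice of
  the fundamental domain.\<close>

definition fund_domain :: "nat \<Rightarrow> complex set" where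
  "fund_domain l = (SOME D. is_fundamental_domain (Gamma0 l) D)"

text \<open>The real number \<open>V\<close> is the total volume of the normalised measure, the same at every level.\<close>

definition petersson ::
  "real \<Rightarrow> nat \<Rightarrow> nat \<Rightarrow> (complex \<Rightarrow> complex) \<Rightarrow> (complex \<Rightarrow> complex) \<Rightarrow> complex" where
  "petersson V k l f g =
     complex_of_real (V / measure hyperbolic_measure (fund_domain l)) *
     (LINT z : fund_domain l | hyperbolic_measure. f z * cnj (g z) * complex_of_real (Im z ^ k))"

definition raise_level :: "nat \<Rightarrow> nat \<Rightarrow> (complex \<Rightarrow> complex) \<Rightarrow> complex \<Rightarrow> complex" where
  "raise_level k d f z = complex_of_real (real d powr (real k / 2)) * f (of_nat d * z)"

definition oldspace :: "nat \<Rightarrow> nat \<Rightarrow> (complex \<Rightarrow> complex) set" where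
  "oldspace k l = cfun_span
     {raise_level k d f | l' d f. l' dvd l \<and> l' \<noteq> l \<and> d dvd l div l' \<and> f \<in> cusp_forms k l'}"

definition newspace :: "real \<Rightarrow> nat \<Rightarrow> nat \<Rightarrow> (complex \<Rightarrow> complex) set" where
  "newspace V k l = {f \<in> cusp_forms k l. \<forall>g\<in>oldspace k l. petersson V k l f g = 0}"

definition is_orthonormal_basis ::
  "real \<Rightarrow> nat \<Rightarrow> nat \<Rightarrow> (complex \<Rightarrow> complex) set \<Rightarrow> (complex \<Rightarrow> complex) set \<Rightarrow> bool" where
  "is_orthonormal_basis V k l S B \<longleftrightarrow>
     finite B \<and> cfun_span B = S \<and>
     (\<forall>f\<in>B. \<forall>g\<in>B. petersson V k l f g = (if f = g then 1 else 0))"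

text \<open>The value of the chosen sequence at 0 is irrelevant; the other values are unique.\<close>

definition fourier_coeff :: "nat \<Rightarrow> (complex \<Rightarrow> complex) \<Rightarrow> nat \<Rightarrow> complex" where
  "fourier_coeff k f = (SOME r. \<forall>z\<in>upper_half_plane.
     ((\<lambda>n. complex_of_real (real n powr (real k / 2)) * r n * exp (2 * of_real pi * \<i> * of_nat n * z))
        has_sum f z) {1..})"

definition Delta :: "nat \<Rightarrow> (complex \<Rightarrow> complex) set \<Rightarrow> nat \<Rightarrow> nat \<Rightarrow> complex" where
  "Delta k B m n = (\<Sum>f\<in>B. fourier_coeff k f m * cnj (fourier_coeff k f n))"

end

theory Submission
  imports Defs
begin

text \<open>For squarefree divisors \<open>d\<close> and \<open>e\<close> of \<open>q\<close>, averaging a form of level \<open>q\<close> over the translations by \<open>b / d\<close>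
  gives the orthogonal projection \<open>R\<^sub>d\<close> onto the dilates by \<open>d\<close> of forms of level \<open>q / d\<close>, and averaging it over
  the cosets of \<open>Gamma0 q\<close> in \<open>Gamma0 (q / e)\<close> gives the projection \<open>P\<^sub>e\<close> onto the forms of level \<open>q / e\<close>. Because \<open>q\<close> is divisible
  by the cube of each of its primes, all these projections commute, and \<open>R\<^sub>d P\<^sub>e\<close> projects onto the
  dilates by \<open>d\<close> of forms of level \<open>q / (d e)\<close>. Hence the projection onto the newspace is the product of all
  \<open>(1 - R\<^sub>p) (1 - P\<^sub>p)\<close>, that is the sum of \<open>\<mu>(d) \<mu>(e) R\<^sub>d P\<^sub>e\<close>; comparing Fourier coefficients of the
  reproducing kernels gives the formula.

  The factorization \<open>R\<^sub>d P\<^sub>e = W U\<close>, where \<open>W\<close> is dilation by \<open>d\<close> from level \<open>q / (d e)\<close> and \<open>U\<close> is its adjoint, comes from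
  unfolding the Petersson integral. Square integrability of cusp forms needs no proof: a basis
  vector of norm 1 has an integrable square, as the integral would otherwise be 0.\<close>

section \<open>Integer matrices acting on the upper half plane\<close>

\<comment> \<open>With two meanings of \<open>$\<close> the number of parses is exponential in the number of matrix entries.\<close>
no_notation fps_nth (infixl "$" 75)

text \<open>The Moebius sum enters through two properties. For a prime \<open>p\<close> dividing
  \<open>q\<close>, \<open>P\<^sub>p P\<^sub>e\<close> is the projection at \<open>lcm p e\<close>,
  and likewise for \<open>R\<close>; so the terms \<open>e\<close> and \<open>p e\<close> with
  \<open>p\<close> not dividing \<open>e\<close> cancel, and the sum is annihilated by every
  \<open>P\<^sub>p\<close> and \<open>R\<^sub>p\<close>. Each generator of the oldspace is, for some
  prime \<open>p\<close>, a form of level \<open>q / p\<close> or the dilate by \<open>p\<close> of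
  one; annihilation therefore means orthogonality to all oldforms. Conversely, every term except
  \<open>d = e = 1\<close> is old, so pairing with a newform sees only the identity. Together these
  make the sum adjoint to the inclusion of the newspace, which is the form in which Fourier
  coefficients are compared.

  Petersson products at different levels are integrals over fundamental domains chosen independently
  of each other. Unfolding is therefore proved for arbitrary fundamental domains of a group and a
  subgroup, by counting group elements rather than by cutting one domain into translates of the
  other.\<close>

abbreviation (input) "\<H> \<equiv> upper_half_plane"

definition mat2 :: "'a \<Rightarrow> 'a \<Rightarrow> 'a \<Rightarrow> 'a \<Rightarrow> ('a::zero)^2^2" where
  "mat2 a b c d = vector [vector [a, b], vector [c, d]]"

lemma mat2_nth [simp]:
  "mat2 a b c d $ 1 $ 1 = a" "mat2 a b c d $ 1 $ 2 = b"
  "mat2 a b c d $ 2 $ 1 = c" "mat2 a b c d $ 2 $ 2 = d"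
  by (simp_all add: mat2_def)

lemma mat2_eq_iff: "A = B \<longleftrightarrow> A$1$1 = B$1$1 \<and> A$1$2 = B$1$2 \<and> A$2$1 = B$2$1 \<and> A$2$2 = (B::'a^2^2)$2$2"
  unfolding vec_eq_iff forall_2 by blast

lemma mat2_mult_nth:
  fixes A B :: "'a::semiring_1^2^2"
  shows "(A ** B) $ i $ j = A$i$1 * B$1$j + A$i$2 * B$2$j"
  by (simp add: matrix_matrix_mult_def sum_2)

lemma det_mat2 [simp]: "det (mat2 a b c d) = a * d - b * (c::'a::comm_ring_1)"
  by (simp add: det_2)

lemma mat_1_nth [simp]: "(mat 1 :: int^2^2) $ 1 $ 1 = 1" "(mat 1 :: int^2^2) $ 1 $ 2 = 0"
  "(mat 1 :: int^2^2) $ 2 $ 1 = 0" "(mat 1 :: int^2^2) $ 2 $ 2 = 1"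
  by (simp_all add: mat_def)

text \<open>The inverse on \<open>SL2Z\<close>, written by entries so that subgroups and cosets can
  be handled with integer matrices alone.\<close>

definition adjugate2 :: "int^2^2 \<Rightarrow> int^2^2" where
  "adjugate2 A = mat2 (A$2$2) (- A$1$2) (- A$2$1) (A$1$1)"

lemma adjugate2_nth [simp]: "adjugate2 A $ 1 $ 1 = A$2$2" "adjugate2 A $ 1 $ 2 = - A$1$2"
  "adjugate2 A $ 2 $ 1 = - A$2$1" "adjugate2 A $ 2 $ 2 = A$1$1"
  by (simp_all add: adjugate2_def)

lemma adjugate2_invol [simp]: "adjugate2 (adjugate2 A) = A"
  by (simp add: mat2_eq_iff)

lemma det_adjugate2 [simp]: "det (adjugate2 A) = det A"
  by (simp add: det_2)

lemma adjugate2_mult: "adjugate2 (A ** B) = adjugate2 B ** adjugate2 A"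
  by (simp add: mat2_eq_iff mat2_mult_nth algebra_simps)

lemma mult_adjugate2: "A ** adjugate2 A = mat (det A)" "adjugate2 A ** A = mat (det A)"
  by (simp_all add: mat2_eq_iff mat2_mult_nth det_2 mat_def)

lemma SL2Z_D: "A \<in> SL2Z \<Longrightarrow> det A = 1"
  by (simp add: SL2Z_def)

lemma SL2Z_det: "A \<in> SL2Z \<Longrightarrow> A$1$1 * A$2$2 - A$1$2 * A$2$1 = 1"
  by (simp add: SL2Z_def det_2)

lemma SL2Z_mult: "A \<in> SL2Z \<Longrightarrow> B \<in> SL2Z \<Longrightarrow> A ** B \<in> SL2Z"
  by (simp add: SL2Z_def det_mul)

lemma SL2Z_adjugate2: "A \<in> SL2Z \<Longrightarrow> adjugate2 A \<in> SL2Z"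
  by (simp add: SL2Z_def)

lemma SL2Z_cancel:
  assumes "A \<in> SL2Z"
  shows "A ** adjugate2 A = mat 1" "adjugate2 A ** A = mat 1"
    "B ** A ** adjugate2 A = B" "B ** adjugate2 A ** A = B"
    "A ** (adjugate2 A ** B) = B" "adjugate2 A ** (A ** B) = B"
proof -
  show *: "A ** adjugate2 A = mat 1" "adjugate2 A ** A = mat 1"
    using assms by (simp_all add: mult_adjugate2 SL2Z_D)
  show "B ** A ** adjugate2 A = B" "B ** adjugate2 A ** A = B"
    by (simp_all add: matrix_mul_assoc[symmetric] *)
  show "A ** (adjugate2 A ** B) = B" "adjugate2 A ** (A ** B) = B"
    by (simp_all add: matrix_mul_assoc *)
qed

lemma Gamma0_subset_SL2Z: "Gamma0 l \<subseteq> SL2Z"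
  by (auto simp: Gamma0_def)

text \<open>Containing \<open>- mat 1\<close> ensures that the elements moving a point into a
  fundamental domain come in pairs \<open>A\<close>, \<open>- A\<close>.\<close>

definition modular_subgroup :: "(int^2^2) set \<Rightarrow> bool" where
  "modular_subgroup G \<longleftrightarrow> G \<subseteq> SL2Z \<and> mat 1 \<in> G \<and> - mat 1 \<in> G \<and>
     (\<forall>A\<in>G. \<forall>B\<in>G. A ** B \<in> G) \<and> (\<forall>A\<in>G. adjugate2 A \<in> G)"

lemma modular_subgroupD:
  assumes "modular_subgroup G"
  shows "A \<in> G \<Longrightarrow> A \<in> SL2Z" "mat 1 \<in> G" "- mat 1 \<in> G"
    "A \<in> G \<Longrightarrow> B \<in> G \<Longrightarrow> A ** B \<in> G" "A \<in> G \<Longrightarrow> adjugate2 A \<in> G"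
  using assms by (auto simp: modular_subgroup_def)

lemma modular_subgroup_Gamma0: "modular_subgroup (Gamma0 l)"
  by (auto simp: modular_subgroup_def Gamma0_def SL2Z_mult SL2Z_adjugate2 mat2_mult_nth)
     (auto simp: SL2Z_def det_2)

section \<open>The action on the upper half plane\<close>

lemma uhp_iff: "z \<in> \<H> \<longleftrightarrow> Im z > 0"
  by (simp add: upper_half_plane_def)

lemma open_uhp: "open \<H>"
  by (simp add: upper_half_plane_def open_halfspace_Im_gt)

lemma sets_uhp [measurable, simp]: "\<H> \<in> sets borel"
  using open_uhp by auto

lemma aut_factor_nonzero:
  assumes "z \<in> \<H>" "det A > 0"
  shows "aut_factor A z \<noteq> 0"
proof
  assume *: "aut_factor A z = 0"
  then have "of_int (A$2$1) * Im z = 0" 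
    by (simp add: aut_factor_def complex_eq_iff)
  then have "A$2$1 = 0" using assms by (simp add: uhp_iff)
  moreover from this have "A$2$2 = 0" using * by (simp add: aut_factor_def)
  ultimately show False using assms by (simp add: det_2)
qed

lemma Im_moebius:
  "Im (moebius A z) = of_int (det A) * Im z / (cmod (aut_factor A z))^2"
  by (simp add: moebius_def aut_factor_def Im_divide cmod_power2 det_2 algebra_simps)

lemma moebius_uhp:
  assumes "z \<in> \<H>" "det A > 0"
  shows "moebius A z \<in> \<H>"
  using aut_factor_nonzero[OF assms] assms by (simp add: uhp_iff Im_moebius)

lemma aut_factor_mult:
  assumes "aut_factor N z \<noteq> 0"
  shows "aut_factor (M ** N) z = aut_factor M (moebius N z) * aut_factor N z"
proof -
  have "aut_factor M (moebius N z) * aut_factor N z =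
    of_int (M$2$1) * (of_int (N$1$1) * z + of_int (N$1$2)) + of_int (M$2$2) * aut_factor N z"
    using assms by (simp add: aut_factor_def[of M] moebius_def field_simps)
  also have "\<dots> = aut_factor (M ** N) z"
    by (simp add: aut_factor_def mat2_mult_nth algebra_simps)
  finally show ?thesis ..
qed

lemma moebius_mult:
  assumes "aut_factor N z \<noteq> 0"
  shows "moebius (M ** N) z = moebius M (moebius N z)"
proof -
  have "(of_int (M$1$1) * moebius N z + of_int (M$1$2)) * aut_factor N z =
     of_int (M$1$1) * (of_int (N$1$1) * z + of_int (N$1$2)) + of_int (M$1$2) * aut_factor N z"
    using assms by (simp add: moebius_def field_simps)
  also have "\<dots> = of_int ((M**N)$1$1) * z + of_int ((M**N)$1$2)"
    by (simp add: aut_factor_def mat2_mult_nth algebra_simps)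
  finally have "of_int (M$1$1) * moebius N z + of_int (M$1$2) = 
      (of_int ((M**N)$1$1) * z + of_int ((M**N)$1$2)) / aut_factor N z"
    using assms by (simp add: field_simps)
  then show ?thesis 
    unfolding moebius_def[of "M**N"] aut_factor_mult[OF assms] moebius_def[of M "moebius N z"]
    by (simp add: field_simps)
qed

lemma moebius_one [simp]: "moebius (mat 1) z = z"
  by (simp add: moebius_def aut_factor_def)

lemma moebius_uminus [simp]: "moebius (- A) z = moebius A z"
proof -
  have "of_int ((- A)$1$1) * z + of_int ((- A)$1$2) = - (of_int (A$1$1) * z + of_int (A$1$2))"
    and "aut_factor (- A) z = - aut_factor A z" 
    by (simp_all add: aut_factor_def)
  then show ?thesis
    by (simp only: moebius_def minus_divide_divide)
qed

lemma SL2Z_moebius: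
  assumes "z \<in> \<H>" "A \<in> SL2Z"
  shows "moebius A z \<in> \<H>" "aut_factor A z \<noteq> 0"
  using assms moebius_uhp aut_factor_nonzero by (simp_all add: SL2Z_def)

lemma moebius_mult_SL2Z:
  assumes "z \<in> \<H>" "B \<in> SL2Z"
  shows "moebius (A ** B) z = moebius A (moebius B z)"
  using assms by (simp add: moebius_mult SL2Z_moebius)

text \<open>No power of the determinant is included. For matrices of determinant other than 1 the
  usual weight \<open>k\<close> action differs by a constant, which \<open>raise_level\<close> and
  \<open>upper_trace\<close> carry explicitly.\<close>

definition slash :: "nat \<Rightarrow> int^2^2 \<Rightarrow> (complex \<Rightarrow> complex) \<Rightarrow> complex \<Rightarrow> complex" where
  "slash k A f z = f (moebius A z) / aut_factor A z ^ k"

lemma slash_mult: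
  assumes "aut_factor N z \<noteq> 0"
  shows "slash k (M ** N) f z = slash k N (slash k M f) z"
  using assms by (simp add: slash_def moebius_mult aut_factor_mult power_mult_distrib)

section \<open>Invariance of the hyperbolic measure\<close>

text \<open>Lebesgue measure is determined by its values on boxes, and a box in the complex plane is
  a product of two intervals. This makes Fubini applicable to real and imaginary parts.\<close>

lemma lborel_complex: "(lborel :: complex measure) = distr (lborel \<Otimes>\<^sub>M lborel) borel (\<lambda>(x, y). Complex x y)"
proof (rule lborel_eqI)
  have meas: "(\<lambda>(x, y). Complex x y) \<in> borel_measurable (lborel \<Otimes>\<^sub>M (lborel :: real measure))"
    unfolding Complex_eq by (simp add: split_beta')
  fix l u :: complex
  assume *: "\<And>b. b \<in> Basis \<Longrightarrow> l \<bullet> b \<le> u \<bullet> b"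
  have le: "Re l \<le> Re u" "Im l \<le> Im u"
    using *[of 1] *[of \<i>] by (auto simp: Basis_complex_def)
  have "emeasure (distr (lborel \<Otimes>\<^sub>M lborel) borel (\<lambda>(x, y). Complex x y)) (box l u) =
      emeasure (lborel \<Otimes>\<^sub>M lborel) ((\<lambda>(x, y). Complex x y) -` box l u \<inter> space (lborel \<Otimes>\<^sub>M lborel))"
    by (intro emeasure_distr meas) auto
  also have "(\<lambda>(x, y). Complex x y) -` box l u \<inter> space (lborel \<Otimes>\<^sub>M lborel) = {Re l<..<Re u} \<times> {Im l<..<Im u}"
    by (auto simp: box_def Basis_complex_def space_pair_measure inner_complex_def)
  also have "emeasure (lborel \<Otimes>\<^sub>M lborel) \<dots> = ennreal (Re u - Re l) * ennreal (Im u - Im l)"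
    using le by (simp add: lborel.emeasure_pair_measure_Times)
  also have "\<dots> = ennreal (\<Prod>b\<in>Basis. (u - l) \<bullet> b)"
    using le by (simp add: Basis_complex_def ennreal_mult inner_complex_def)
  finally show "emeasure (distr (lborel \<Otimes>\<^sub>M lborel) borel (\<lambda>(x, y). Complex x y)) (box l u) =
      ennreal (\<Prod>b\<in>Basis. (u - l) \<bullet> b)" .
qed auto

lemma Complex_measurable [measurable]:
  assumes "f \<in> borel_measurable M" "g \<in> borel_measurable M"
  shows "(\<lambda>x. Complex (f x) (g x)) \<in> borel_measurable M"
  unfolding Complex_eq using assms by measurable

lemma nn_integral_complex:
  assumes [measurable]: "f \<in> borel_measurable borel"
  shows "(\<integral>\<^sup>+z. f z \<partial>(lborel :: complex measure)) = (\<integral>\<^sup>+y. \<integral>\<^sup>+x. f (Complex x y) \<partial>lborel \<partial>lborel)"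
proof -
  have "(\<integral>\<^sup>+z. f z \<partial>(lborel :: complex measure)) =
      (\<integral>\<^sup>+p. f (Complex (fst p) (snd p)) \<partial>(lborel \<Otimes>\<^sub>M lborel))"
    by (subst lborel_complex, subst nn_integral_distr) (simp_all add: split_beta')
  also have "\<dots> = (\<integral>\<^sup>+x. \<integral>\<^sup>+y. f (Complex x y) \<partial>lborel \<partial>lborel)"
    by (subst lborel.nn_integral_fst[symmetric]) simp_all
  also have "\<dots> = (\<integral>\<^sup>+y. \<integral>\<^sup>+x. f (Complex x y) \<partial>lborel \<partial>lborel)"
    by (rule lborel_pair.Fubini'[symmetric]) simp
  finally show ?thesis .
qed

lemma sets_hyperbolic_measure [simp, measurable_cong]: "sets hyperbolic_measure = sets borel"
  by (simp add: hyperbolic_measure_def)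

lemma space_hyperbolic_measure [simp]: "space hyperbolic_measure = UNIV"
  by (simp add: hyperbolic_measure_def)

lemma null_sets_hyperbolic: "N \<in> null_sets lborel \<Longrightarrow> N \<in> null_sets hyperbolic_measure"
  using absolutely_continuousI_density[of "\<lambda>z. ennreal (1 / (Im z)\<^sup>2)" "lborel :: complex measure"]
  by (auto simp: hyperbolic_measure_def absolutely_continuous_def)

lemma nn_integral_hyperbolic:
  assumes [measurable]: "F \<in> borel_measurable borel"
  shows "(\<integral>\<^sup>+z. F z \<partial>hyperbolic_measure) = (\<integral>\<^sup>+z. ennreal (1 / (Im z)\<^sup>2) * F z \<partial>lborel)"
  unfolding hyperbolic_measure_def by (subst nn_integral_density) simp_all

text \<open>Stating invariance through integrals of all nonnegative measurable \<open>F\<close>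
  makes it closed under composition, with no reference to inverse maps or Jacobians.\<close>

definition hyp_preserving :: "(complex \<Rightarrow> complex) \<Rightarrow> bool" where
  "hyp_preserving g \<longleftrightarrow> g \<in> borel_measurable borel \<and> (\<forall>z\<in>\<H>. g z \<in> \<H>) \<and>
     (\<forall>F::complex \<Rightarrow> ennreal. F \<in> borel_measurable borel \<longrightarrow>
       (\<integral>\<^sup>+z\<in>\<H>. F (g z) \<partial>hyperbolic_measure) = (\<integral>\<^sup>+z\<in>\<H>. F z \<partial>hyperbolic_measure))"

lemma hyp_preserving_comp:
  assumes f: "hyp_preserving f" and g: "hyp_preserving g"
  shows "hyp_preserving (\<lambda>z. f (g z))"
  unfolding hyp_preserving_def
proof (intro conjI allI impI ballI)
  show meas: "(\<lambda>z. f (g z)) \<in> borel_measurable borel"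
    using assms by (auto simp: hyp_preserving_def)
  show "f (g z) \<in> \<H>" if "z \<in> \<H>" for z
    using that assms by (auto simp: hyp_preserving_def)
  fix F :: "complex \<Rightarrow> ennreal" assume F: "F \<in> borel_measurable borel"
  then have "(\<lambda>z. F (f z)) \<in> borel_measurable borel"
    using f by (auto simp: hyp_preserving_def)
  then have "(\<integral>\<^sup>+z\<in>\<H>. F (f (g z)) \<partial>hyperbolic_measure) =
      (\<integral>\<^sup>+z\<in>\<H>. F (f z) \<partial>hyperbolic_measure)"
    using g by (auto simp: hyp_preserving_def)
  also have "\<dots> = (\<integral>\<^sup>+z\<in>\<H>. F z \<partial>hyperbolic_measure)"
    using f F by (auto simp: hyp_preserving_def)
  finally show "(\<integral>\<^sup>+z\<in>\<H>. F (f (g z)) \<partial>hyperbolic_measure) = \<dots>" .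
qed

lemma hyp_preserving_cong:
  assumes "hyp_preserving f" "g \<in> borel_measurable borel" "\<And>z. z \<in> \<H> \<Longrightarrow> f z = g z"
  shows "hyp_preserving g"
proof -
  have "(\<integral>\<^sup>+z\<in>\<H>. F (f z) \<partial>hyperbolic_measure) =
      (\<integral>\<^sup>+z\<in>\<H>. F (g z) \<partial>hyperbolic_measure)" for F :: "complex \<Rightarrow> ennreal"
    by (intro nn_integral_cong) (auto simp: assms(3) indicator_def)
  then show ?thesis
    using assms by (simp add: hyp_preserving_def)
qed

text \<open>Area grows by the factor \<open>r\<^sup>2\<close> and the density
  \<open>1 / (Im z)\<^sup>2\<close> shrinks by the same factor.\<close>

lemma hyp_preserving_affine:
  fixes r s :: real
  assumes "r > 0"
  shows "hyp_preserving (\<lambda>z. of_real r * z + of_real s)"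
  unfolding hyp_preserving_def
proof (intro conjI allI impI ballI)
  show "(\<lambda>z::complex. of_real r * z + of_real s) \<in> borel_measurable borel"
    by measurable
  show "of_real r * z + of_real s \<in> \<H>" if "z \<in> \<H>" for z :: complex
    using that assms by (simp add: uhp_iff)
  fix F :: "complex \<Rightarrow> ennreal" assume F [measurable]: "F \<in> borel_measurable borel"
  define \<phi> where "\<phi> = (\<lambda>z. ennreal (1 / (Im z)\<^sup>2) * (F z * indicator \<H> z))"
  have \<phi> [measurable]: "\<phi> \<in> borel_measurable borel"
    by (simp add: \<phi>_def)
  have "(\<integral>\<^sup>+z\<in>\<H>. F z \<partial>hyperbolic_measure) = (\<integral>\<^sup>+z. \<phi> z \<partial>lborel)"
    by (simp add: nn_integral_hyperbolic \<phi>_def)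
  also have "\<dots> = (\<integral>\<^sup>+z. ennreal (r\<^sup>2) * \<phi> (of_real s + r *\<^sub>R z) \<partial>lborel)"
    using assms by (subst lborel_affine[of r "of_real s"])
      (simp_all add: nn_integral_density nn_integral_distr)
  also have "\<dots> = (\<integral>\<^sup>+z. ennreal (1 / (Im z)\<^sup>2) * (F (of_real r * z + of_real s) * indicator \<H> z) \<partial>lborel)"
  proof (rule nn_integral_cong)
    fix z :: complex
    define w where "w = of_real r * z + of_real s"
    have w: "of_real s + r *\<^sub>R z = w"
      by (simp add: w_def scaleR_conv_of_real add.commute)
    have "ennreal (r\<^sup>2) * (ennreal (1 / (Im w)\<^sup>2) * X) = ennreal (1 / (Im z)\<^sup>2) * X" for X
      using assms by (simp add: w_def mult.assoc[symmetric] ennreal_mult[symmetric] power_mult_distrib)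
    moreover have "w \<in> \<H> \<longleftrightarrow> z \<in> \<H>"
      using assms by (simp add: w_def uhp_iff zero_less_mult_iff)
    ultimately show "ennreal (r\<^sup>2) * \<phi> (of_real s + r *\<^sub>R z) =
        ennreal (1 / (Im z)\<^sup>2) * (F (of_real r * z + of_real s) * indicator \<H> z)"
      unfolding w w_def[symmetric] \<phi>_def by (simp add: indicator_def)
  qed
  also have "\<dots> = (\<integral>\<^sup>+z\<in>\<H>. F (of_real r * z + of_real s) \<partial>hyperbolic_measure)"
    by (simp add: nn_integral_hyperbolic)
  finally show "(\<integral>\<^sup>+z\<in>\<H>. F (of_real r * z + of_real s) \<partial>hyperbolic_measure) =
    (\<integral>\<^sup>+z\<in>\<H>. F z \<partial>hyperbolic_measure)" ..
qed

section \<open>The measure \<open>dy / y\<close> and the substitution of \<open>c / y\<close> for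
  \<open>y\<close>\<close>

lemma absolutely_integrable_iff_nn_integral:
  fixes w :: "real \<Rightarrow> real"
  assumes [measurable]: "w \<in> borel_measurable borel" "S \<in> sets borel"
    and nonneg: "\<And>x. x \<in> S \<Longrightarrow> 0 \<le> w x" and "b \<ge> 0"
  shows "w absolutely_integrable_on S \<and> integral S w = b \<longleftrightarrow>
    (\<integral>\<^sup>+x. ennreal (indicator S x * w x) \<partial>lborel) = ennreal b"
proof -
  have "(\<integral>\<^sup>+x. ennreal (indicator S x * w x) \<partial>lborel) = ennreal b \<longleftrightarrow>
     integrable lborel (\<lambda>x. indicator S x * w x) \<and> (LINT x|lborel. indicator S x * w x) = b"
    using nonneg \<open>b \<ge> 0\<close> by (intro nn_integral_eq_integrable) (auto simp: indicator_def)
  also have "\<dots> \<longleftrightarrow> set_integrable lborel S w \<and> (LINT x:S|lborel. w x) = b"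
    by (simp add: set_integrable_def set_lebesgue_integral_def)
  also have "\<dots> \<longleftrightarrow> set_integrable lborel S w \<and> integral S w = b"
    using set_borel_integral_eq_integral(2)[of S w] by auto
  also have "set_integrable lborel S w \<longleftrightarrow> w absolutely_integrable_on S"
    unfolding set_integrable_def by (rule integrable_completion[symmetric]) simp
  finally show ?thesis ..
qed

text \<open>The absolute derivative \<open>c / y\<^sup>2\<close> turns \<open>1 / (c / y)\<close>
  into \<open>1 / y\<close>. The change of variables speaks of absolutely integrable functions with
  a prescribed real integral \<open>b\<close>, hence the detour through the values
  \<open>b\<close>.\<close>

lemma nn_integral_inversion_emeasure:
  fixes c :: real
  assumes "c > 0" and [measurable]: "E \<in> sets borel"
  shows "(\<integral>\<^sup>+y. ennreal (indicator {0<..} y * (indicator E (c / y) / y)) \<partial>lborel) =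
         (\<integral>\<^sup>+y. ennreal (indicator {0<..} y * (indicator E y / y)) \<partial>lborel)" (is "?L = ?R")
proof -
  define u v where "u = (\<lambda>y::real. indicator E y / y :: real)" and "v = (\<lambda>y. indicator E (c / y) / y :: real)"
  have [measurable]: "u \<in> borel_measurable borel" "v \<in> borel_measurable borel"
    by (simp_all add: u_def v_def)
  have image: "(\<lambda>y. c / y) ` {0<..} = {0<..}"
  proof (intro equalityI subsetI)
    fix y :: real assume "y \<in> {0<..}"
    then show "y \<in> (\<lambda>y. c / y) ` {0<..}"
      using \<open>c > 0\<close> by (intro image_eqI[of _ _ "c / y"]) auto
  qed (use \<open>c > 0\<close> in auto)
  have cv: "(\<lambda>x. \<bar>- (c / x^2)\<bar> * u (c / x)) absolutely_integrable_on {0<..} \<and>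
      integral {0<..} (\<lambda>x. \<bar>- (c / x^2)\<bar> * u (c / x)) = b \<longleftrightarrow>
      u absolutely_integrable_on {0<..} \<and> integral {0<..} u = b" for b
  proof -
    have "((\<lambda>y. c / y) has_field_derivative - (c / x^2)) (at x within {0<..})" if "x \<in> {0<..}" for x
      using that by (auto intro!: derivative_eq_intros simp: power2_eq_square)
    moreover have "inj_on (\<lambda>y. c / y) {0<..}"
      using \<open>c > 0\<close> by (auto simp: inj_on_def)
    ultimately show ?thesis
      using has_absolute_integral_change_of_variables_1'[where S = "{0<..}" and g = "\<lambda>y. c / y"
          and g' = "\<lambda>x. - (c / x^2)" and f = u and b = b] 
      unfolding image by simp
  qed
  have uv: "\<bar>- (c / x^2)\<bar> * u (c / x) = v x" if "x \<in> {0<..}" for x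
    using that \<open>c > 0\<close> by (simp add: u_def v_def power2_eq_square)
  have cv: "v absolutely_integrable_on {0<..} \<and> integral {0<..} v = b \<longleftrightarrow>
      u absolutely_integrable_on {0<..} \<and> integral {0<..} u = b" for b
  proof -
    have "(\<lambda>x. \<bar>- (c / x^2)\<bar> * u (c / x)) absolutely_integrable_on {0<..} \<longleftrightarrow> v absolutely_integrable_on {0<..}"
      by (rule set_integrable_cong[OF refl refl uv])
    moreover have "integral {0<..} (\<lambda>x. \<bar>- (c / x^2)\<bar> * u (c / x)) = integral {0<..} v"
      by (rule Henstock_Kurzweil_Integration.integral_cong[OF uv])
    ultimately show ?thesis
      using cv[of b] by (simp only:)
  qed
  have eq: "?L = ennreal b \<longleftrightarrow> ?R = ennreal b" if "b \<ge> 0" for b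
    using absolutely_integrable_iff_nn_integral[of v "{0<..}" b] absolutely_integrable_iff_nn_integral[of u "{0<..}" b] cv[of b] that
    by (simp add: u_def v_def)
  \<comment> \<open>Both sides equal the same finite values; if one of them equals no finite value,
    neither does the other, and both are infinite.\<close>
  show ?thesis
  proof (cases ?R)
    case (real b)
    then show ?thesis using eq[of b] by simp
  next
    case top
    then show ?thesis using eq by (cases ?L) auto
  qed
qed

text \<open>Invariance on sets says that the measure \<open>dy / y\<close> equals its image under
  the substitution; integrating against the image measure extends this to every
  \<open>G\<close>.\<close>

lemma nn_integral_inversion:
  fixes c :: real and G :: "real \<Rightarrow> ennreal"
  assumes "c > 0" and G [measurable]: "G \<in> borel_measurable borel"
  shows "(\<integral>\<^sup>+y\<in>{0<..}. ennreal (1 / y) * G (c / y) \<partial>lborel) = (\<integral>\<^sup>+y\<in>{0<..}. ennreal (1 / y) * G y \<partial>lborel)"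
proof -
  define \<nu> :: "real measure" where "\<nu> = density lborel (\<lambda>y. ennreal (1 / y) * indicator {0<..} y)"
  have nu: "(\<integral>\<^sup>+y. H y \<partial>\<nu>) = (\<integral>\<^sup>+y\<in>{0<..}. ennreal (1 / y) * H y \<partial>lborel)" 
    if [measurable]: "H \<in> borel_measurable borel" for H
    unfolding \<nu>_def by (subst nn_integral_density) (simp_all add: mult_ac)
  have "distr \<nu> borel (\<lambda>y. c / y) = \<nu>"
  proof (rule measure_eqI)
    fix E assume "E \<in> sets (distr \<nu> borel (\<lambda>y. c / y))"
    then have E [measurable]: "E \<in> sets borel" by simp
    have "emeasure (distr \<nu> borel (\<lambda>y. c / y)) E = (\<integral>\<^sup>+y. indicator E (c / y) \<partial>\<nu>)"
      using nn_integral_distr[of "\<lambda>y. c / y" \<nu> borel "indicator E"] by (simp add: \<nu>_def)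
    also have "\<dots> = (\<integral>\<^sup>+y. ennreal (indicator {0<..} y * (indicator E (c / y) / y)) \<partial>lborel)"
      by (subst nu) (auto intro!: nn_integral_cong simp: indicator_def)
    also have "\<dots> = (\<integral>\<^sup>+y. ennreal (indicator {0<..} y * (indicator E y / y)) \<partial>lborel)"
      by (rule nn_integral_inversion_emeasure) (use assms in auto)
    also have "\<dots> = (\<integral>\<^sup>+y. indicator E y \<partial>\<nu>)"
      by (subst nu) (auto intro!: nn_integral_cong simp: indicator_def)
    also have "\<dots> = emeasure \<nu> E"
      by (simp add: \<nu>_def)
    finally show "emeasure (distr \<nu> borel (\<lambda>y. c / y)) E = emeasure \<nu> E" .
  qed (simp add: \<nu>_def)
  then have "(\<integral>\<^sup>+y. G y \<partial>\<nu>) = (\<integral>\<^sup>+y. G y \<partial>distr \<nu> borel (\<lambda>y. c / y))"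
    by simp
  also have "\<dots> = (\<integral>\<^sup>+y. G (c / y) \<partial>\<nu>)"
    by (subst nn_integral_distr) (simp_all add: \<nu>_def)
  finally show ?thesis
    by (simp add: nu)
qed

text \<open>In the coordinates \<open>z = y (t + \<i>)\<close> the hyperbolic measure becomes \<open>dt dy / y\<close>, and \<open>z \<mapsto> - 1 / z\<close>
  becomes \<open>(t, y) \<mapsto> (- t, 1 / (y (t\<^sup>2 + 1)))\<close>, so that Fubini reduces invariance to one variable.\<close>

lemma nn_integral_hyperbolic_polar:
  assumes [measurable]: "F \<in> borel_measurable borel"
  shows "(\<integral>\<^sup>+z\<in>\<H>. F z \<partial>hyperbolic_measure) =
    (\<integral>\<^sup>+t. (\<integral>\<^sup>+y\<in>{0<..}. ennreal (1 / y) * F (Complex (y * t) y) \<partial>lborel) \<partial>lborel)"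
proof -
  have "(\<integral>\<^sup>+z\<in>\<H>. F z \<partial>hyperbolic_measure) =
      (\<integral>\<^sup>+z. ennreal (1 / (Im z)\<^sup>2) * (F z * indicator \<H> z) \<partial>lborel)"
    by (simp add: nn_integral_hyperbolic)
  also have "\<dots> = (\<integral>\<^sup>+y. \<integral>\<^sup>+x. ennreal (1 / y\<^sup>2) * (F (Complex x y) * indicator \<H> (Complex x y)) \<partial>lborel \<partial>lborel)"
    by (subst nn_integral_complex) simp_all
  also have "\<dots> = (\<integral>\<^sup>+y. \<integral>\<^sup>+t. ennreal (1 / y) * F (Complex (y * t) y) * indicator {0<..} y \<partial>lborel \<partial>lborel)"
  proof (rule nn_integral_cong)
    fix y :: real
    show "(\<integral>\<^sup>+x. ennreal (1 / y\<^sup>2) * (F (Complex x y) * indicator \<H> (Complex x y)) \<partial>lborel) =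
      (\<integral>\<^sup>+t. ennreal (1 / y) * F (Complex (y * t) y) * indicator {0<..} y \<partial>lborel)"
    proof (cases "y > 0")
      case True
      then have y: "ennreal y * (ennreal (1 / y\<^sup>2) * X) = ennreal (1 / y) * X" for X
        by (simp add: mult.assoc[symmetric] ennreal_mult[symmetric] power2_eq_square)
      have "(\<integral>\<^sup>+x. ennreal (1 / y\<^sup>2) * (F (Complex x y) * indicator \<H> (Complex x y)) \<partial>lborel) =
          (\<integral>\<^sup>+x. ennreal (1 / y\<^sup>2) * F (Complex x y) \<partial>lborel)"
        using True by (simp add: uhp_iff)
      also have "\<dots> = ennreal y * (\<integral>\<^sup>+t. ennreal (1 / y\<^sup>2) * F (Complex (y * t) y) \<partial>lborel)"
        using True by (subst nn_integral_real_affine[of _ y 0]) simp_all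
      also have "\<dots> = (\<integral>\<^sup>+t. ennreal (1 / y) * F (Complex (y * t) y) \<partial>lborel)"
        by (subst nn_integral_cmult[symmetric]) (simp_all add: y)
      finally show ?thesis using True by simp
    qed (simp add: uhp_iff)
  qed
  also have "\<dots> = (\<integral>\<^sup>+t. \<integral>\<^sup>+y. ennreal (1 / y) * F (Complex (y * t) y) * indicator {0<..} y \<partial>lborel \<partial>lborel)"
    by (rule lborel_pair.Fubini') simp
  finally show ?thesis .
qed

lemma hyp_preserving_inversion: "hyp_preserving (\<lambda>z. - 1 / z)"
  unfolding hyp_preserving_def
proof (intro conjI allI impI ballI)
  show "(\<lambda>z::complex. - 1 / z) \<in> borel_measurable borel"
    by measurable
  show "- 1 / z \<in> \<H>" if "z \<in> \<H>" for z
    using that by (auto simp: uhp_iff Im_divide sum_power2_gt_zero_iff intro!: divide_pos_pos)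
  fix F :: "complex \<Rightarrow> ennreal" assume F [measurable]: "F \<in> borel_measurable borel"
  have inv: "- 1 / Complex (y * t) y = Complex (1 / (t\<^sup>2 + 1) / y * (- t)) (1 / (t\<^sup>2 + 1) / y)" if "y > 0" for y t
  proof -
    define s where "s = t\<^sup>2 + 1"
    have "s > 0" by (simp add: s_def add_nonneg_pos)
    have "1 / s / y * (- t) * (y * t) = - t\<^sup>2 / s" "1 / s / y * y = 1 / s"
      using that by (simp_all add: power2_eq_square)
    then have "1 / s / y * (- t) * (y * t) - 1 / s / y * y = - (t\<^sup>2 + 1) / s"
      by (simp only: diff_divide_distrib[symmetric]) simp
    also have "\<dots> = - 1" using \<open>s > 0\<close> unfolding s_def[symmetric] by simp
    finally have "Complex (1 / s / y * (- t)) (1 / s / y) * Complex (y * t) y = - 1"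
      using that by (simp add: complex_eq_iff)
    moreover have "Complex (y * t) y \<noteq> 0"
      using that by (simp add: complex_eq_iff)
    ultimately show ?thesis
      unfolding s_def[symmetric] by (metis nonzero_mult_div_cancel_right)
  qed
  have "(\<integral>\<^sup>+z\<in>\<H>. F (- 1 / z) \<partial>hyperbolic_measure) =
    (\<integral>\<^sup>+t. (\<integral>\<^sup>+y\<in>{0<..}. ennreal (1 / y) * F (- 1 / Complex (y * t) y) \<partial>lborel) \<partial>lborel)"
    by (subst nn_integral_hyperbolic_polar) simp_all
  also have "\<dots> = (\<integral>\<^sup>+t. (\<integral>\<^sup>+y\<in>{0<..}. ennreal (1 / y) * F (Complex (1 / (t\<^sup>2 + 1) / y * (- t)) (1 / (t\<^sup>2 + 1) / y)) \<partial>lborel) \<partial>lborel)"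
  proof (intro nn_integral_cong)
    fix t y :: real
    show "ennreal (1 / y) * F (- 1 / Complex (y * t) y) * indicator {0<..} y =
      ennreal (1 / y) * F (Complex (1 / (t\<^sup>2 + 1) / y * (- t)) (1 / (t\<^sup>2 + 1) / y)) * indicator {0<..} y"
    proof (cases "y > 0")
      case True
      show ?thesis by (subst inv[OF True]) (rule refl)
    qed simp
  qed
  also have "\<dots> = (\<integral>\<^sup>+t. (\<integral>\<^sup>+y\<in>{0<..}. ennreal (1 / y) * F (Complex (y * (- t)) y) \<partial>lborel) \<partial>lborel)"
  proof (rule nn_integral_cong)
    fix t :: real
    show "(\<integral>\<^sup>+y\<in>{0<..}. ennreal (1 / y) * F (Complex (1 / (t\<^sup>2 + 1) / y * (- t)) (1 / (t\<^sup>2 + 1) / y)) \<partial>lborel) =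
      (\<integral>\<^sup>+y\<in>{0<..}. ennreal (1 / y) * F (Complex (y * (- t)) y) \<partial>lborel)"
      by (rule nn_integral_inversion[of "1 / (t\<^sup>2 + 1)" "\<lambda>y. F (Complex (y * (- t)) y)"])
         (auto simp: add_nonneg_pos)
  qed
  also have "\<dots> = (\<integral>\<^sup>+t. (\<integral>\<^sup>+y\<in>{0<..}. ennreal (1 / y) * F (Complex (y * t) y) \<partial>lborel) \<partial>lborel)"
    by (subst (2) nn_integral_real_affine[of _ "-1" 0]) simp_all
  also have "\<dots> = (\<integral>\<^sup>+z\<in>\<H>. F z \<partial>hyperbolic_measure)"
    by (rule nn_integral_hyperbolic_polar[symmetric]) simp
  finally show "(\<integral>\<^sup>+z\<in>\<H>. F (- 1 / z) \<partial>hyperbolic_measure) = \<dots>" .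
qed

lemma moebius_measurable [measurable]: "moebius A \<in> borel_measurable borel"
  unfolding moebius_def aut_factor_def by measurable

text \<open>If the lower left entry vanishes, the map is an integer translation. Otherwise it is
  \<open>a / c - 1 / (c\<^sup>2 z + c d)\<close>, a composition of two affine maps with the
  inversion between them; the scaling \<open>c\<^sup>2\<close> is positive whatever the sign of
  \<open>c\<close>.\<close>

lemma hyp_preserving_moebius:
  assumes "A \<in> SL2Z"
  shows "hyp_preserving (moebius A)"
proof (cases "A$2$1 = 0")
  case True
  define a b d where "a = A$1$1" and "b = A$1$2" and "d = A$2$2"
  have ad: "a * d = 1" using SL2Z_det[OF assms] True by (simp add: a_def d_def)
  then have "(a = 1 \<and> d = 1) \<or> (a = -1 \<and> d = -1)"
    by (auto simp: zmult_eq_1_iff)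
  then have "moebius A z = of_real 1 * z + of_real (of_int (b * d))" for z
    using True by (auto simp: moebius_def aut_factor_def a_def b_def d_def)
  then show ?thesis
    using hyp_preserving_affine[of 1 "of_int (b * d)"] by (auto intro: hyp_preserving_cong)
next
  case False
  define a b c d :: complex where "a = of_int (A$1$1)" and "b = of_int (A$1$2)" and
    "c = of_int (A$2$1)" and "d = of_int (A$2$2)"
  have "c \<noteq> 0" using False by (simp add: c_def)
  have "a * d - b * c = of_int (A$1$1 * A$2$2 - A$1$2 * A$2$1)"
    by (simp add: a_def b_def c_def d_def)
  then have det: "a * d = 1 + b * c" using SL2Z_det[OF assms] by (simp add: algebra_simps)
  define f g where "f = (\<lambda>z. of_real 1 * z + complex_of_real (of_int (A$1$1) / of_int (A$2$1)))"
    and "g = (\<lambda>z. of_real ((of_int (A$2$1))\<^sup>2) * z + complex_of_real (of_int (A$2$1 * A$2$2)))"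
  have "hyp_preserving (\<lambda>z. f (- 1 / g z))"
    unfolding f_def g_def
    by (rule hyp_preserving_comp[OF hyp_preserving_affine
          hyp_preserving_comp[OF hyp_preserving_inversion hyp_preserving_affine]]) (use False in simp_all)
  then show ?thesis
  proof (rule hyp_preserving_cong)
    fix z assume "z \<in> \<H>"
    then have nz: "c * z + d \<noteq> 0"
      using SL2Z_moebius(2)[OF _ assms] by (simp add: aut_factor_def c_def d_def)
    have "g z = c * (c * z + d)" "f w = w + a / c" for w
      by (simp_all add: f_def g_def a_def c_def d_def power2_eq_square algebra_simps)
    moreover have "- 1 / (c * (c * z + d)) + a / c = (a * z + b) / (c * z + d)"
    proof -
      define w where "w = c * z + d"
      have "a * w - 1 = c * (a * z + b)"
        using det by (simp add: w_def algebra_simps)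
      moreover have "- 1 / (c * w) + a / c = (a * w - 1) / (c * w)"
        using nz \<open>c \<noteq> 0\<close> unfolding w_def[symmetric] by (simp add: field_simps)
      ultimately show ?thesis
        using \<open>c \<noteq> 0\<close> by (simp add: w_def[symmetric])
    qed
    ultimately show "f (- 1 / g z) = moebius A z"
      by (simp add: moebius_def aut_factor_def a_def b_def c_def d_def)
  qed simp
qed

section \<open>Fundamental domains and unfolding\<close>

lemma modular_subgroup_uminus:
  assumes "modular_subgroup G" "A \<in> G"
  shows "- A \<in> G"
proof -
  have "- A = (- mat 1) ** A"
    by (simp add: mat2_eq_iff mat2_mult_nth)
  then show ?thesis
    using modular_subgroupD(3,4)[OF assms(1)] assms(2) by metis
qed

lemma countable_int_matrices [simp]: "countable (G :: (int^2^2) set)"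
  by (rule countableI_type)

lemma SL2Z_neq_uminus:
  assumes "A \<in> SL2Z"
  shows "A \<noteq> - A"
proof
  assume "A = - A"
  then have "A$i$j = - A$i$j" for i j
    by (metis vector_uminus_component)
  then have "A$i$j = 0" for i j
    by (simp add: eq_neg_iff_add_eq_0)
  then show False using SL2Z_det[OF assms] by simp
qed

lemma moebius_cancel:
  assumes "z \<in> \<H>" "A \<in> SL2Z"
  shows "moebius (adjugate2 A) (moebius A z) = z" "moebius A (moebius (adjugate2 A) z) = z"
  using assms by (simp_all add: moebius_mult_SL2Z[symmetric] SL2Z_adjugate2 SL2Z_cancel)

lemma hyp_preserving_null_sets:
  assumes g: "hyp_preserving g" and N: "N \<in> null_sets lborel"
  shows "{z \<in> \<H>. g z \<in> N} \<in> null_sets hyperbolic_measure"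
proof
  have [measurable]: "g \<in> borel_measurable borel" "N \<in> sets borel"
    using g N by (auto simp: hyp_preserving_def)
  have "{z \<in> \<H>. g z \<in> N} = \<H> \<inter> (g -` N \<inter> space borel)" by auto
  then show *: "{z \<in> \<H>. g z \<in> N} \<in> sets hyperbolic_measure"
    by (simp add: measurable_sets[of g borel borel])
  have "emeasure hyperbolic_measure {z \<in> \<H>. g z \<in> N} =
      (\<integral>\<^sup>+z. indicator {z \<in> \<H>. g z \<in> N} z \<partial>hyperbolic_measure)"
    using * by simp
  also have "\<dots> = (\<integral>\<^sup>+z\<in>\<H>. indicator N (g z) \<partial>hyperbolic_measure)"
    by (intro nn_integral_cong) (auto simp: indicator_def)
  also have "\<dots> = (\<integral>\<^sup>+z\<in>\<H>. indicator N z \<partial>hyperbolic_measure)"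
    using g by (auto simp: hyp_preserving_def)
  also have "\<dots> \<le> (\<integral>\<^sup>+z. indicator N z \<partial>hyperbolic_measure)"
    by (intro nn_integral_mono) (auto simp: indicator_def)
  also have "\<dots> = 0"
    using null_sets_hyperbolic[OF N] by (simp add: null_sets_def)
  finally show "emeasure hyperbolic_measure {z \<in> \<H>. g z \<in> N} = 0" by simp
qed

lemma is_fundamental_domainD:
  assumes "is_fundamental_domain G D"
  shows "D \<in> sets borel" "D \<subseteq> \<H>"
    "z \<in> \<H> \<Longrightarrow> \<exists>A\<in>G. moebius A z \<in> D"
    "A \<in> G \<Longrightarrow> A \<noteq> mat 1 \<Longrightarrow> A \<noteq> - mat 1 \<Longrightarrow> D \<inter> moebius A ` D \<in> null_sets lborel"
  using assms by (auto simp: is_fundamental_domain_def)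

text \<open>The count is 2 because both \<open>A\<close> and \<open>- A\<close> move \<open>z\<close> into \<open>D\<close>.\<close>

lemma AE_count_fundamental_domain:
  assumes G: "modular_subgroup G" and D: "is_fundamental_domain G D"
  shows "AE z in hyperbolic_measure. z \<in> \<H> \<longrightarrow>
    (\<integral>\<^sup>+A. indicator D (moebius A z) \<partial>count_space G) = 2"
proof -
  \<comment> \<open>If \<open>A\<close> and \<open>B\<close> both move \<open>z\<close> into
    \<open>D\<close>, then \<open>moebius A z\<close> lies in the overlap of \<open>D\<close> with
    its translate by \<open>A ** adjugate2 B\<close>, which is null unless \<open>A\<close> and
    \<open>B\<close> agree up to sign. There are only countably many such pairs.\<close>
  define N where "N = (\<Union>A\<in>G. \<Union>B\<in>{B\<in>G. B \<noteq> A \<and> B \<noteq> - A}.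
    {z\<in>\<H>. moebius A z \<in> D \<inter> moebius (A ** adjugate2 B) ` D})"
  have "N \<in> null_sets hyperbolic_measure"
    unfolding N_def
  proof (intro null_sets_UN' hyp_preserving_null_sets hyp_preserving_moebius is_fundamental_domainD(4)[OF D])
    fix A B assume AB: "A \<in> G" "B \<in> {B\<in>G. B \<noteq> A \<and> B \<noteq> - A}"
    then have SL: "A \<in> SL2Z" "B \<in> SL2Z" using modular_subgroupD(1)[OF G] by auto
    then show "A \<in> SL2Z" by simp
    show "A ** adjugate2 B \<in> G"
      using AB modular_subgroupD[OF G] by auto
    have eq: "A ** adjugate2 B ** B = A"
      using SL by (simp add: SL2Z_cancel)
    show "A ** adjugate2 B \<noteq> mat 1"
      using eq AB by auto
    have "(- mat 1) ** B = - B"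
      by (simp add: mat2_eq_iff mat2_mult_nth)
    show "A ** adjugate2 B \<noteq> - mat 1"
    proof
      assume "A ** adjugate2 B = - mat 1"
      then have "A = - B" using eq \<open>(- mat 1) ** B = - B\<close> by metis
      then show False using AB by simp
    qed
  qed simp_all
  moreover have "(\<integral>\<^sup>+A. indicator D (moebius A z) \<partial>count_space G) = 2"
    if z: "z \<in> \<H>" "z \<notin> N" for z
  proof -
    obtain A where A: "A \<in> G" "moebius A z \<in> D"
      using is_fundamental_domainD(3)[OF D z(1)] by blast
    have "B = A \<or> B = - A" if B: "B \<in> G" "moebius B z \<in> D" for B
    proof (rule ccontr)
      assume "\<not> (B = A \<or> B = - A)"
      have SL: "A \<in> SL2Z" "B \<in> SL2Z" using A B modular_subgroupD(1)[OF G] by auto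
      have "moebius A z = moebius (A ** adjugate2 B ** B) z"
        using SL by (simp add: SL2Z_cancel)
      also have "\<dots> = moebius (A ** adjugate2 B) (moebius B z)"
        by (rule moebius_mult_SL2Z) (use z SL in auto)
      finally have "moebius A z = moebius (A ** adjugate2 B) (moebius B z)" .
      then have "z \<in> N"
        using A B z \<open>\<not> (B = A \<or> B = - A)\<close> unfolding N_def by blast
      then show False using z by simp
    qed
    then have S: "{B\<in>G. moebius B z \<in> D} = {A, - A}"
      using A modular_subgroup_uminus[OF G] by auto
    have "(\<integral>\<^sup>+A. indicator D (moebius A z) \<partial>count_space G) =
        (\<integral>\<^sup>+A. indicator {B\<in>G. moebius B z \<in> D} A \<partial>count_space G)"
      by (intro nn_integral_cong) (auto simp: indicator_def)
    also have "\<dots> = emeasure (count_space G) {A, - A}"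
      unfolding S using A modular_subgroup_uminus[OF G] by (intro nn_integral_indicator) auto
    also have "\<dots> = of_nat (card {A, - A})"
      using A modular_subgroup_uminus[OF G] by (intro emeasure_count_space_finite) auto
    also have "card {A, - A} = 2"
      using SL2Z_neq_uminus[of A] A modular_subgroupD(1)[OF G] by auto
    finally show ?thesis by simp
  qed
  ultimately show ?thesis
    by (intro AE_I'[of N]) auto
qed

section \<open>Coset representatives and unfolding\<close>

definition right_transversal :: "(int^2^2) set \<Rightarrow> (int^2^2) set \<Rightarrow> (int^2^2) set \<Rightarrow> bool" where
  "right_transversal K G R \<longleftrightarrow> K \<subseteq> G \<and> finite R \<and> R \<subseteq> G \<and> (\<forall>A\<in>G. \<exists>!r. r \<in> R \<and> A ** adjugate2 r \<in> K)"

lemma right_transversalD: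
  assumes "right_transversal K G R"
  shows "finite R" "R \<subseteq> G" "K \<subseteq> G" "A \<in> G \<Longrightarrow> \<exists>!r. r \<in> R \<and> A ** adjugate2 r \<in> K"
  using assms unfolding right_transversal_def by blast+

text \<open>The condition \<open>A ** adjugate2 r \<in> K\<close> places \<open>A\<close> in the
  coset \<open>K r\<close>. Each element of \<open>G\<close> lies in exactly one such coset, and
  right multiplication by \<open>r\<close> maps \<open>K\<close> onto it bijectively.\<close>

lemma nn_integral_count_space_transversal:
  fixes h :: "int^2^2 \<Rightarrow> ennreal"
  assumes K: "modular_subgroup K" and G: "modular_subgroup G" and R: "right_transversal K G R"
  shows "(\<integral>\<^sup>+A. h A \<partial>count_space G) = (\<Sum>r\<in>R. \<integral>\<^sup>+B. h (B ** r) \<partial>count_space K)"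
proof -
  define C where "C r = {A\<in>G. A ** adjugate2 r \<in> K}" for r
  note R' = right_transversalD[OF R]
  have one: "(\<Sum>r\<in>R. indicator (C r) A) = (1::ennreal)" if A: "A \<in> G" for A
  proof -
    obtain r where r: "r \<in> R" "A ** adjugate2 r \<in> K" "\<And>s. s \<in> R \<Longrightarrow> A ** adjugate2 s \<in> K \<Longrightarrow> s = r"
      using R'(4)[OF A] by blast
    have "(\<Sum>s\<in>R. indicator (C s) A) = (\<Sum>s\<in>R. if s = r then 1 else (0::ennreal))"
    proof (rule sum.cong)
      fix s assume "s \<in> R"
      then have "A \<in> C s \<longleftrightarrow> s = r"
        using r(1,2) r(3)[of s] A unfolding C_def by blast
      then show "indicator (C s) A = (if s = r then 1 else (0::ennreal))"
        by (simp add: indicator_def)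
    qed simp
    also have "\<dots> = 1" using r(1) R'(1) by simp
    finally show ?thesis .
  qed
  have bij: "bij_betw (\<lambda>B. B ** r) K (C r)" if "r \<in> R" for r
  proof -
    have r: "r \<in> G" "r \<in> SL2Z" using that R' modular_subgroupD(1)[OF G] by auto
    show ?thesis
      by (rule bij_betw_byWitness[where f' = "\<lambda>A. A ** adjugate2 r"])
         (use r R' modular_subgroupD(4)[OF G] in \<open>auto simp: C_def SL2Z_cancel\<close>)
  qed
  have "(\<integral>\<^sup>+A. h A \<partial>count_space G) = (\<integral>\<^sup>+A. (\<Sum>r\<in>R. h A * indicator (C r) A) \<partial>count_space G)"
    by (intro nn_integral_cong) (simp add: sum_distrib_left[symmetric] one)
  also have "\<dots> = (\<Sum>r\<in>R. \<integral>\<^sup>+A. h A * indicator (C r) A \<partial>count_space G)"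
    by (rule nn_integral_sum) simp
  also have "\<dots> = (\<Sum>r\<in>R. \<integral>\<^sup>+B. h (B ** r) \<partial>count_space K)"
  proof (rule sum.cong)
    fix r assume "r \<in> R"
    have "(\<integral>\<^sup>+A. h A * indicator (C r) A \<partial>count_space G) = (\<integral>\<^sup>+A. h A \<partial>restrict_space (count_space G) (C r))"
      by (rule nn_integral_restrict_space[symmetric]) auto
    also have "restrict_space (count_space G) (C r) = count_space (C r)"
      by (subst restrict_count_space) (auto simp: C_def intro!: arg_cong[of _ _ count_space])
    also have "(\<integral>\<^sup>+A. h A \<partial>count_space (C r)) = (\<integral>\<^sup>+B. h (B ** r) \<partial>count_space K)"
      by (rule nn_integral_bij_count_space[OF bij[OF \<open>r \<in> R\<close>], symmetric])
    finally show "(\<integral>\<^sup>+A. h A * indicator (C r) A \<partial>count_space G) = \<dots>" .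
  qed simp
  finally show ?thesis .
qed

text \<open>Double counting: \<open>F\<close> is integrated over the overlaps of \<open>DK\<close>
  with all \<open>G\<close>-translates of \<open>DG\<close>, and the integrals are summed over
  \<open>G\<close>. Counting in \<open>DG\<close> gives twice the integral over \<open>DK\<close>.
  Splitting \<open>G\<close> into cosets \<open>K r\<close>, using the invariance of
  \<open>F\<close> under \<open>K\<close> and counting in \<open>DK\<close> gives twice the sum over
  \<open>R\<close>.\<close>

lemma nn_integral_fundamental_domain_unfold:
  fixes F :: "complex \<Rightarrow> ennreal"
  assumes K: "modular_subgroup K" and G: "modular_subgroup G" and R: "right_transversal K G R"
    and DK: "is_fundamental_domain K DK" and DG: "is_fundamental_domain G DG"
    and F [measurable]: "F \<in> borel_measurable borel"
    and inv: "\<And>A z. A \<in> K \<Longrightarrow> z \<in> \<H> \<Longrightarrow> F (moebius A z) = F z"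
  shows "(\<integral>\<^sup>+z\<in>DK. F z \<partial>hyperbolic_measure) = (\<Sum>r\<in>R. \<integral>\<^sup>+z\<in>DG. F (moebius r z) \<partial>hyperbolic_measure)"
proof -
  note [measurable] = is_fundamental_domainD(1)[OF DK] is_fundamental_domainD(1)[OF DG]
  have to_uhp: "(\<integral>\<^sup>+z\<in>D. H z \<partial>hyperbolic_measure) = (\<integral>\<^sup>+z\<in>\<H>. H z * indicator D z \<partial>hyperbolic_measure)"
    if "D \<subseteq> \<H>" for H D
    using that by (intro nn_integral_cong) (auto simp: indicator_def)
  have change: "(\<integral>\<^sup>+z\<in>\<H>. H (moebius A z) \<partial>hyperbolic_measure) =
      (\<integral>\<^sup>+z\<in>\<H>. H z \<partial>hyperbolic_measure)"
    if "A \<in> G" "H \<in> borel_measurable borel" for A and H :: "complex \<Rightarrow> ennreal"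
    using hyp_preserving_moebius[OF modular_subgroupD(1)[OF G that(1)]] that(2) by (simp add: hyp_preserving_def)
  note KG = right_transversalD(3,2)[OF R]
  \<comment> \<open>Summing the indicator of \<open>D\<close> along an orbit gives the constant 2
    almost everywhere, so the sum over the group removes the domain from the integral.\<close>
  have swap: "(\<integral>\<^sup>+A. (\<integral>\<^sup>+z\<in>\<H>. H z * indicator D (moebius A z) \<partial>hyperbolic_measure) \<partial>count_space L) =
      2 * (\<integral>\<^sup>+z\<in>\<H>. H z \<partial>hyperbolic_measure)"
    if L: "modular_subgroup L" and D: "is_fundamental_domain L D" and H [measurable]: "H \<in> borel_measurable borel" for L D H
  proof -
    note [measurable] = is_fundamental_domainD(1)[OF D]
    have "(\<integral>\<^sup>+A. (\<integral>\<^sup>+z\<in>\<H>. H z * indicator D (moebius A z) \<partial>hyperbolic_measure) \<partial>count_space L) =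
      (\<integral>\<^sup>+z. (\<integral>\<^sup>+A. (H z * indicator \<H> z) * indicator D (moebius A z) \<partial>count_space L) \<partial>hyperbolic_measure)"
      by (subst nn_integral_count_space_nn_integral) (simp_all add: mult_ac)
    also have "\<dots> = (\<integral>\<^sup>+z. (H z * indicator \<H> z) * (\<integral>\<^sup>+A. indicator D (moebius A z) \<partial>count_space L) \<partial>hyperbolic_measure)"
      by (intro nn_integral_cong nn_integral_cmult) simp
    also have "\<dots> = (\<integral>\<^sup>+z. 2 * (H z * indicator \<H> z) \<partial>hyperbolic_measure)"
    proof (rule nn_integral_cong_AE)
      show "AE z in hyperbolic_measure. (H z * indicator \<H> z) *
          (\<integral>\<^sup>+A. indicator D (moebius A z) \<partial>count_space L) = 2 * (H z * indicator \<H> z)"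
        using AE_count_fundamental_domain[OF L D]
        by (rule eventually_mono) (auto simp: indicator_def mult.commute)
    qed
    also have "\<dots> = 2 * (\<integral>\<^sup>+z\<in>\<H>. H z \<partial>hyperbolic_measure)"
      by (rule nn_integral_cmult) simp
    finally show ?thesis .
  qed
  define k where "k B = (\<integral>\<^sup>+z\<in>\<H>. F (moebius B z) * indicator DK (moebius B z) * indicator DG z \<partial>hyperbolic_measure)" for B
  have "2 * (\<integral>\<^sup>+z\<in>DK. F z \<partial>hyperbolic_measure) =
      (\<integral>\<^sup>+A. (\<integral>\<^sup>+z\<in>\<H>. F z * indicator DK z * indicator DG (moebius A z) \<partial>hyperbolic_measure) \<partial>count_space G)"
    by (subst swap[OF G DG]) (simp_all add: to_uhp[OF is_fundamental_domainD(2)[OF DK]])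
  also have "\<dots> = (\<integral>\<^sup>+A. k (adjugate2 A) \<partial>count_space G)"
  proof (rule nn_integral_cong)
    fix A assume "A \<in> space (count_space G)"
    then have A: "A \<in> G" "adjugate2 A \<in> G" "A \<in> SL2Z" using modular_subgroupD[OF G] by auto
    have "(\<integral>\<^sup>+z\<in>\<H>. F z * indicator DK z * indicator DG (moebius A z) \<partial>hyperbolic_measure) =
      (\<integral>\<^sup>+z\<in>\<H>. F (moebius (adjugate2 A) z) * indicator DK (moebius (adjugate2 A) z) *
         indicator DG (moebius A (moebius (adjugate2 A) z)) \<partial>hyperbolic_measure)"
      by (rule change[OF A(2), symmetric]) simp
    also have "\<dots> = k (adjugate2 A)"
      unfolding k_def by (intro nn_integral_cong) (simp add: indicator_def moebius_cancel A)
    finally show "(\<integral>\<^sup>+z\<in>\<H>. F z * indicator DK z * indicator DG (moebius A z) \<partial>hyperbolic_measure) = k (adjugate2 A)" .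
  qed
  also have "\<dots> = (\<integral>\<^sup>+A. k A \<partial>count_space G)"
    by (rule nn_integral_bij_count_space, rule bij_betw_byWitness[where f' = adjugate2])
       (use modular_subgroupD(5)[OF G] in auto)
  also have "\<dots> = (\<Sum>r\<in>R. \<integral>\<^sup>+B. k (B ** r) \<partial>count_space K)"
    by (rule nn_integral_count_space_transversal[OF K G R])
  also have "\<dots> = (\<Sum>r\<in>R. 2 * (\<integral>\<^sup>+z\<in>DG. F (moebius r z) \<partial>hyperbolic_measure))"
  proof (rule sum.cong)
    fix r assume "r \<in> R"
    then have r: "r \<in> G" "r \<in> SL2Z" using KG modular_subgroupD(1)[OF G] by auto
    have k: "k (B ** r) = (\<integral>\<^sup>+z\<in>\<H>. F z * indicator DG (moebius (adjugate2 r) z) * indicator DK (moebius B z) \<partial>hyperbolic_measure)"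
      if "B \<in> K" for B
    proof -
      have "k (B ** r) = (\<integral>\<^sup>+z\<in>\<H>. F (moebius r z) * indicator DG (moebius (adjugate2 r) (moebius r z)) *
          indicator DK (moebius B (moebius r z)) \<partial>hyperbolic_measure)"
        unfolding k_def by (intro nn_integral_cong)
          (auto simp: indicator_def moebius_cancel r moebius_mult_SL2Z inv[OF that] SL2Z_moebius)
      also have "\<dots> = (\<integral>\<^sup>+z\<in>\<H>. F z * indicator DG (moebius (adjugate2 r) z) * indicator DK (moebius B z) \<partial>hyperbolic_measure)"
        by (rule change[OF r(1)]) simp
      finally show ?thesis .
    qed
    have "(\<integral>\<^sup>+B. k (B ** r) \<partial>count_space K) =
        (\<integral>\<^sup>+B. (\<integral>\<^sup>+z\<in>\<H>. F z * indicator DG (moebius (adjugate2 r) z) * indicator DK (moebius B z) \<partial>hyperbolic_measure) \<partial>count_space K)"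
      by (intro nn_integral_cong) (simp add: k)
    also have "\<dots> = 2 * (\<integral>\<^sup>+z\<in>\<H>. F z * indicator DG (moebius (adjugate2 r) z) \<partial>hyperbolic_measure)"
      by (rule swap[OF K DK]) simp
    also have "(\<integral>\<^sup>+z\<in>\<H>. F z * indicator DG (moebius (adjugate2 r) z) \<partial>hyperbolic_measure) =
        (\<integral>\<^sup>+z\<in>\<H>. F (moebius r z) * indicator DG (moebius (adjugate2 r) (moebius r z)) \<partial>hyperbolic_measure)"
      by (rule change[OF r(1), symmetric]) simp
    also have "\<dots> = (\<integral>\<^sup>+z\<in>\<H>. F (moebius r z) * indicator DG z \<partial>hyperbolic_measure)"
      by (intro nn_integral_cong) (auto simp: indicator_def moebius_cancel r)
    also have "\<dots> = (\<integral>\<^sup>+z\<in>DG. F (moebius r z) \<partial>hyperbolic_measure)"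
      by (rule to_uhp[OF is_fundamental_domainD(2)[OF DG], symmetric])
    finally show "(\<integral>\<^sup>+B. k (B ** r) \<partial>count_space K) = 2 * (\<integral>\<^sup>+z\<in>DG. F (moebius r z) \<partial>hyperbolic_measure)" .
  qed simp
  also have "\<dots> = 2 * (\<Sum>r\<in>R. \<integral>\<^sup>+z\<in>DG. F (moebius r z) \<partial>hyperbolic_measure)"
    by (simp add: sum_distrib_left)
  finally show ?thesis
    by (simp add: ennreal_mult_cancel_left)
qed

lemma set_integrable_fundamental_domain_unfold:
  fixes F :: "complex \<Rightarrow> 'b :: {banach, second_countable_topology}"
  assumes K: "modular_subgroup K" and G: "modular_subgroup G" and R: "right_transversal K G R"
    and DK: "is_fundamental_domain K DK" and DG: "is_fundamental_domain G DG"
    and F [measurable]: "F \<in> borel_measurable borel"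
    and inv: "\<And>A z. A \<in> K \<Longrightarrow> z \<in> \<H> \<Longrightarrow> F (moebius A z) = F z"
    and int: "set_integrable hyperbolic_measure DK F" and "r \<in> R"
  shows "set_integrable hyperbolic_measure DG (\<lambda>z. F (moebius r z))"
proof -
  note [measurable] = is_fundamental_domainD(1)[OF DK] is_fundamental_domainD(1)[OF DG]
  note fin = right_transversalD(1)[OF R]
  have "(\<integral>\<^sup>+z\<in>DG. ennreal (norm (F (moebius r z))) \<partial>hyperbolic_measure) \<le>
      (\<Sum>r\<in>R. \<integral>\<^sup>+z\<in>DG. ennreal (norm (F (moebius r z))) \<partial>hyperbolic_measure)"
    by (rule member_le_sum[of r R "\<lambda>r. \<integral>\<^sup>+z\<in>DG. ennreal (norm (F (moebius r z))) \<partial>hyperbolic_measure"])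
       (use fin \<open>r \<in> R\<close> in simp_all)
  also have "\<dots> = (\<integral>\<^sup>+z\<in>DK. ennreal (norm (F z)) \<partial>hyperbolic_measure)"
    by (rule nn_integral_fundamental_domain_unfold[OF K G R DK DG, symmetric]) (simp_all add: inv)
  also have "\<dots> = (\<integral>\<^sup>+z. ennreal (norm (indicator DK z *\<^sub>R F z)) \<partial>hyperbolic_measure)"
    by (intro nn_integral_cong) (auto simp: indicator_def)
  also have "\<dots> < \<infinity>"
    using int by (simp add: set_integrable_def integrable_iff_bounded)
  finally have *: "(\<integral>\<^sup>+z\<in>DG. ennreal (norm (F (moebius r z))) \<partial>hyperbolic_measure) < \<infinity>" .
  have "(\<integral>\<^sup>+z. ennreal (norm (indicator DG z *\<^sub>R F (moebius r z))) \<partial>hyperbolic_measure) =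
      (\<integral>\<^sup>+z\<in>DG. ennreal (norm (F (moebius r z))) \<partial>hyperbolic_measure)"
    by (intro nn_integral_cong) (auto simp: indicator_def)
  with * show ?thesis
    by (simp add: set_integrable_def integrable_iff_bounded)
qed

text \<open>Positive and negative parts are unfolded separately; integrability keeps both finite,
  which lets the conversion to real numbers pass through the sum over \<open>R\<close>.\<close>

lemma set_integral_real_fundamental_domain_unfold:
  fixes F :: "complex \<Rightarrow> real"
  assumes K: "modular_subgroup K" and G: "modular_subgroup G" and R: "right_transversal K G R"
    and DK: "is_fundamental_domain K DK" and DG: "is_fundamental_domain G DG"
    and F [measurable]: "F \<in> borel_measurable borel"
    and inv: "\<And>A z. A \<in> K \<Longrightarrow> z \<in> \<H> \<Longrightarrow> F (moebius A z) = F z"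
    and int: "set_integrable hyperbolic_measure DK F"
  shows "(LINT z:DK|hyperbolic_measure. F z) = (\<Sum>r\<in>R. LINT z:DG|hyperbolic_measure. F (moebius r z))"
proof -
  have int': "set_integrable hyperbolic_measure DG (\<lambda>z. F (moebius r z))" if "r \<in> R" for r
    by (rule set_integrable_fundamental_domain_unfold[OF K G R DK DG F]) (use that inv int in auto)
  have as_nn: "(LINT z:D|hyperbolic_measure. H z) = enn2real (\<integral>\<^sup>+z\<in>D. ennreal (H z) \<partial>hyperbolic_measure) -
      enn2real (\<integral>\<^sup>+z\<in>D. ennreal (- H z) \<partial>hyperbolic_measure)"
    if "set_integrable hyperbolic_measure D H" for H :: "complex \<Rightarrow> real" and D
  proof -
    have "(\<integral>\<^sup>+z\<in>D. ennreal (H z) \<partial>hyperbolic_measure) = (\<integral>\<^sup>+z. ennreal (indicator D z *\<^sub>R H z) \<partial>hyperbolic_measure)"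
      "(\<integral>\<^sup>+z\<in>D. ennreal (- H z) \<partial>hyperbolic_measure) = (\<integral>\<^sup>+z. ennreal (- (indicator D z *\<^sub>R H z)) \<partial>hyperbolic_measure)"
      by (auto intro!: nn_integral_cong simp: indicator_def)
    then show ?thesis
      unfolding set_lebesgue_integral_def using real_lebesgue_integral_def[OF that[unfolded set_integrable_def]] by simp
  qed
  have fin: "(\<integral>\<^sup>+z\<in>D. ennreal (H z) \<partial>hyperbolic_measure) < top"
    if "set_integrable hyperbolic_measure D H" for H :: "complex \<Rightarrow> real" and D
  proof -
    have "(\<integral>\<^sup>+z\<in>D. ennreal (H z) \<partial>hyperbolic_measure) = (\<integral>\<^sup>+z. ennreal (indicator D z *\<^sub>R H z) \<partial>hyperbolic_measure)"
      by (auto intro!: nn_integral_cong simp: indicator_def)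
    also have "\<dots> \<noteq> \<infinity>"
      using that unfolding set_integrable_def real_integrable_def by blast
    finally show ?thesis by (simp add: less_top)
  qed
  have neg: "set_integrable hyperbolic_measure D (\<lambda>z. - H z)"
    if "set_integrable hyperbolic_measure D H" for H :: "complex \<Rightarrow> real" and D
    using integrable_minus[OF that[unfolded set_integrable_def]] unfolding set_integrable_def by simp
  have "enn2real (\<integral>\<^sup>+z\<in>DK. ennreal (F z) \<partial>hyperbolic_measure) =
      enn2real (\<Sum>r\<in>R. \<integral>\<^sup>+z\<in>DG. ennreal (F (moebius r z)) \<partial>hyperbolic_measure)"
    by (subst nn_integral_fundamental_domain_unfold[OF K G R DK DG]) (simp_all add: inv)
  also have "\<dots> = (\<Sum>r\<in>R. enn2real (\<integral>\<^sup>+z\<in>DG. ennreal (F (moebius r z)) \<partial>hyperbolic_measure))"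
    by (subst enn2real_sum) (use fin[OF int'] in \<open>simp_all add: o_def\<close>)
  finally have 1: "enn2real (\<integral>\<^sup>+z\<in>DK. ennreal (F z) \<partial>hyperbolic_measure) = \<dots>" .
  have "enn2real (\<integral>\<^sup>+z\<in>DK. ennreal (- F z) \<partial>hyperbolic_measure) =
      enn2real (\<Sum>r\<in>R. \<integral>\<^sup>+z\<in>DG. ennreal (- F (moebius r z)) \<partial>hyperbolic_measure)"
    by (subst nn_integral_fundamental_domain_unfold[OF K G R DK DG]) (simp_all add: inv)
  also have "\<dots> = (\<Sum>r\<in>R. enn2real (\<integral>\<^sup>+z\<in>DG. ennreal (- F (moebius r z)) \<partial>hyperbolic_measure))"
    by (subst enn2real_sum) (use fin[OF neg[OF int']] in \<open>simp_all add: o_def\<close>)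
  finally have 2: "enn2real (\<integral>\<^sup>+z\<in>DK. ennreal (- F z) \<partial>hyperbolic_measure) = \<dots>" .
  show ?thesis
    unfolding as_nn[OF int] 1 2 sum_subtractf[symmetric]
    by (rule sum.cong[OF refl]) (rule as_nn[OF int', symmetric])
qed

lemma set_integral_fundamental_domain_unfold:
  fixes F :: "complex \<Rightarrow> complex"
  assumes K: "modular_subgroup K" and G: "modular_subgroup G" and R: "right_transversal K G R"
    and DK: "is_fundamental_domain K DK" and DG: "is_fundamental_domain G DG"
    and F [measurable]: "F \<in> borel_measurable borel"
    and inv: "\<And>A z. A \<in> K \<Longrightarrow> z \<in> \<H> \<Longrightarrow> F (moebius A z) = F z"
    and int: "set_integrable hyperbolic_measure DK F"
  shows "(LINT z:DK|hyperbolic_measure. F z) = (\<Sum>r\<in>R. LINT z:DG|hyperbolic_measure. F (moebius r z))"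
proof -
  have int': "set_integrable hyperbolic_measure DG (\<lambda>z. F (moebius r z))" if "r \<in> R" for r
    by (rule set_integrable_fundamental_domain_unfold[OF K G R DK DG F]) (use that inv int in auto)
  have Re: "Re (LINT z:D|hyperbolic_measure. H z) = (LINT z:D|hyperbolic_measure. Re (H z))"
    and Im: "Im (LINT z:D|hyperbolic_measure. H z) = (LINT z:D|hyperbolic_measure. Im (H z))"
    and iRe: "set_integrable hyperbolic_measure D (\<lambda>z. Re (H z))"
    and iIm: "set_integrable hyperbolic_measure D (\<lambda>z. Im (H z))"
    if "set_integrable hyperbolic_measure D H" for H :: "complex \<Rightarrow> complex" and D
    using that integral_bounded_linear[OF bounded_linear_Re, of hyperbolic_measure "\<lambda>z. indicator D z *\<^sub>R H z"]
      integral_bounded_linear[OF bounded_linear_Im, of hyperbolic_measure "\<lambda>z. indicator D z *\<^sub>R H z"]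
      integrable_bounded_linear[OF bounded_linear_Re, of hyperbolic_measure "\<lambda>z. indicator D z *\<^sub>R H z"]
      integrable_bounded_linear[OF bounded_linear_Im, of hyperbolic_measure "\<lambda>z. indicator D z *\<^sub>R H z"]
    by (simp_all add: set_integrable_def set_lebesgue_integral_def)
  have "(LINT z:DK|hyperbolic_measure. Re (F z)) = (\<Sum>r\<in>R. LINT z:DG|hyperbolic_measure. Re (F (moebius r z)))"
    by (rule set_integral_real_fundamental_domain_unfold[OF K G R DK DG]) (simp_all add: inv iRe int)
  moreover have "(LINT z:DK|hyperbolic_measure. Im (F z)) = (\<Sum>r\<in>R. LINT z:DG|hyperbolic_measure. Im (F (moebius r z)))"
    by (rule set_integral_real_fundamental_domain_unfold[OF K G R DK DG]) (simp_all add: inv iIm int)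
  ultimately show ?thesis
    by (simp add: complex_eq_iff Re Im int int')
qed

section \<open>Existence of a fundamental domain\<close>

lemma finite_aut_factor_bounded:
  assumes "z \<in> \<H>"
  shows "finite {(c::int, d::int). cmod (of_int c * z + of_int d) \<le> 1}"
proof -
  have y: "Im z > 0" using assms by (simp add: uhp_iff)
  define M where "M = \<lceil>1 / Im z\<rceil>"
  define N where "N = \<lceil>1 + of_int M * cmod z\<rceil>"
  have "c \<in> {- M..M} \<and> d \<in> {- N..N}" if "cmod (of_int c * z + of_int d) \<le> 1" for c d :: int
  proof -
    \<comment> \<open>The imaginary part bounds \<open>c\<close> first; the triangle inequality then
      bounds \<open>d\<close> in terms of the bound on \<open>c\<close>.\<close>
    have "\<bar>Im (of_int c * z + of_int d)\<bar> \<le> 1"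
      using that abs_Im_le_cmod order_trans by blast
    then have "of_int \<bar>c\<bar> * Im z \<le> 1"
      using y by (simp add: abs_mult)
    then have "of_int \<bar>c\<bar> \<le> 1 / Im z"
      using y by (simp add: field_simps)
    then have c: "\<bar>c\<bar> \<le> M"
      unfolding M_def by (meson le_of_int_ceiling of_int_le_iff order_trans)
    have "cmod (of_int d) \<le> cmod (of_int c * z + of_int d) + cmod (of_int c * z)"
      using norm_triangle_ineq4[of "of_int c * z + of_int d" "of_int c * z"] by simp
    also have "\<dots> \<le> 1 + of_int M * cmod z"
      using that c by (intro add_mono) (simp_all add: norm_mult mult_right_mono)
    finally have "of_int \<bar>d\<bar> \<le> 1 + of_int M * cmod z" by simp
    then have "\<bar>d\<bar> \<le> N"
      unfolding N_def by (meson le_of_int_ceiling of_int_le_iff order_trans)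
    with c show ?thesis by auto
  qed
  then have "{(c::int, d::int). cmod (of_int c * z + of_int d) \<le> 1} \<subseteq> {- M..M} \<times> {- N..N}"
    by auto
  then show ?thesis
    by (rule finite_subset) auto
qed

lemma exists_max_Im_moebius:
  assumes G: "modular_subgroup G" and z: "z \<in> \<H>"
  shows "\<exists>A\<in>G. \<forall>B\<in>G. Im (moebius B z) \<le> Im (moebius A z)"
proof -
  define P where "P = {(c::int, d::int). cmod (of_int c * z + of_int d) \<le> 1}"
  define f where "f = (\<lambda>(c::int, d::int). cmod (of_int c * z + of_int d))"
  define S where "S = (\<lambda>A. (A$2$1, A$2$2)) ` G \<inter> P"
  have f: "f (A$2$1, A$2$2) = cmod (aut_factor A z)" for A
    by (simp add: f_def aut_factor_def)
  have "finite S"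
    using finite_aut_factor_bounded[OF z] by (simp add: S_def P_def)
  \<comment> \<open>The bottom row of the identity. It makes \<open>S\<close> nonempty and the
    minimum at most 1, so that rows outside \<open>P\<close> cannot compete.\<close>
  moreover have "(0, 1) \<in> S"
    using modular_subgroupD(2)[OF G] by (force simp: S_def P_def)
  ultimately obtain p where p: "p \<in> S" "\<forall>x\<in>S. f p \<le> f x"
    using finite_has_minimal[of "f ` S"] by (smt (verit, best) empty_iff arg_min_if_finite not_le)
  then obtain A where A: "A \<in> G" "p = (A$2$1, A$2$2)" by (auto simp: S_def)
  have "cmod (aut_factor A z) \<le> cmod (aut_factor B z)" if "B \<in> G" for B
  proof (cases "(B$2$1, B$2$2) \<in> P")
    case True
    then have "(B$2$1, B$2$2) \<in> S" using that by (auto simp: S_def)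
    then show ?thesis using p(2) unfolding A(2) by (metis f)
  next
    case False
    then have "f (B$2$1, B$2$2) > 1" by (auto simp: P_def f_def)
    moreover have "f p \<le> 1" using p(1) by (auto simp: S_def P_def f_def)
    ultimately show ?thesis using f A by simp
  qed
  moreover have SL: "B \<in> SL2Z" "aut_factor B z \<noteq> 0" if "B \<in> G" for B
    using SL2Z_moebius(2)[OF z] modular_subgroupD(1)[OF G] that by auto
  moreover have "Im z > 0" using z by (simp add: uhp_iff)
  ultimately have "Im (moebius B z) \<le> Im (moebius A z)" if "B \<in> G" for B
    using that A(1)
    by (auto simp: Im_moebius SL2Z_D intro!: divide_left_mono power_mono mult_pos_pos zero_less_power)
  then show ?thesis using A(1) by blast
qed

lemma null_sets_lborel_closed:
  fixes N :: "'a::euclidean_space set"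
  assumes "negligible N" "closed N"
  shows "N \<in> null_sets lborel"
proof -
  have "N \<in> null_sets lebesgue" using assms by (simp add: negligible_iff_null_sets)
  then show ?thesis using assms by (simp add: null_sets_completion_iff)
qed

text \<open>The Ford domain: the points of largest imaginary part in their orbit, in a strip of width 1. If \<open>A\<close> moves
  one such point to another, then both have the same imaginary part, so \<open>aut_factor\<close> has modulus 1
  there.\<close>

lemma exists_fundamental_domain: "\<exists>D. is_fundamental_domain (Gamma0 l) D"
proof -
  define G where "G = Gamma0 l"
  have G: "modular_subgroup G" unfolding G_def by (rule modular_subgroup_Gamma0)
  define D where "D = {z \<in> \<H>. (\<forall>A\<in>G. Im (moebius A z) \<le> Im z) \<and> \<bar>Re z\<bar> \<le> 1 / 2}"
  have D_sets [measurable]: "D \<in> sets borel"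
  proof -
    have "D = \<H> \<inter> (\<Inter>A\<in>G. {z. Im (moebius A z) \<le> Im z}) \<inter> {z. \<bar>Re z\<bar> \<le> 1 / 2}"
      by (auto simp: D_def)
    moreover have "(\<Inter>A\<in>G. {z. Im (moebius A z) \<le> Im z}) \<in> sets borel"
      by (intro sets.countable_INT') (use modular_subgroupD(2)[OF G] in auto)
    moreover have "{z. \<bar>Re z\<bar> \<le> 1 / 2} \<in> sets borel" by simp
    ultimately show ?thesis by auto
  qed
  have "is_fundamental_domain G D"
    unfolding is_fundamental_domain_def
  proof (intro conjI ballI impI)
    show "D \<in> sets borel" by simp
    show "D \<subseteq> \<H>" by (auto simp: D_def)
    fix z assume z: "z \<in> \<H>"
    obtain A where A: "A \<in> G" "\<And>B. B \<in> G \<Longrightarrow> Im (moebius B z) \<le> Im (moebius A z)"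
      using exists_max_Im_moebius[OF G z] by blast
    have SL: "A \<in> SL2Z" using A G by (simp add: modular_subgroupD)
    \<comment> \<open>Integer translations belong to \<open>Gamma0 l\<close> for every
      \<open>l\<close> and preserve imaginary parts, so the highest point of the orbit can be moved
      into the strip.\<close>
    define n where "n = round (Re (moebius A z))"
    define T where "T = (mat2 1 (- n) 0 1 :: int^2^2)"
    have T: "T \<in> G" by (simp add: T_def G_def Gamma0_def SL2Z_def)
    have "moebius T w = w - of_int n" for w
      by (simp add: moebius_def aut_factor_def T_def)
    then have TA: "moebius (T ** A) z = moebius A z - of_int n"
      using z SL by (simp add: moebius_mult_SL2Z)
    have TA_G: "T ** A \<in> G" using T A modular_subgroupD(4)[OF G] by simp
    then have SL': "T ** A \<in> SL2Z" using modular_subgroupD(1)[OF G] by simp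
    have "moebius (T ** A) z \<in> D"
    proof -
      have "Im (moebius B (moebius (T ** A) z)) \<le> Im (moebius (T ** A) z)" if "B \<in> G" for B
      proof -
        have "B ** (T ** A) \<in> G" using that TA_G modular_subgroupD(4)[OF G] by simp
        then show ?thesis
          using A(2)[of "B ** (T ** A)"] z SL' by (simp add: moebius_mult_SL2Z TA[symmetric]) (simp add: TA)
      qed
      moreover have "\<bar>Re (moebius (T ** A) z)\<bar> \<le> 1 / 2"
        using of_int_round_abs_le[of "Re (moebius A z)"] by (simp add: TA n_def abs_minus_commute)
      ultimately show ?thesis
        using SL2Z_moebius(1)[OF z SL'] by (simp add: D_def)
    qed
    then show "\<exists>A\<in>G. moebius A z \<in> D" using TA_G by blast
  next
    fix A assume A: "A \<in> G" "A \<noteq> mat 1 \<and> A \<noteq> - mat 1"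
    then have SL: "A \<in> SL2Z" "adjugate2 A \<in> SL2Z" "adjugate2 A \<in> G" using modular_subgroupD[OF G] by auto
    have "moebius A ` D = \<H> \<inter> (moebius (adjugate2 A) -` D \<inter> space borel)"
    proof (intro equalityI subsetI)
      fix w assume "w \<in> \<H> \<inter> (moebius (adjugate2 A) -` D \<inter> space borel)"
      then show "w \<in> moebius A ` D"
        by (intro image_eqI[of _ _ "moebius (adjugate2 A) w"]) (auto simp: moebius_cancel SL)
    qed (use SL in \<open>auto simp: D_def moebius_cancel SL2Z_moebius\<close>)
    then have meas: "D \<inter> moebius A ` D \<in> sets borel"
      by (simp add: measurable_sets[of _ borel borel])
    have abs1: "cmod (aut_factor (adjugate2 A) z) = 1" and Re: "\<bar>Re z\<bar> \<le> 1 / 2" "\<bar>Re (moebius (adjugate2 A) z)\<bar> \<le> 1 / 2"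
      if zD: "z \<in> D \<inter> moebius A ` D" for z
    proof -
      obtain w where w: "w \<in> D" "z = moebius A w" using zD by blast
      have wz: "w = moebius (adjugate2 A) z" using w SL by (simp add: moebius_cancel D_def)
      have z: "z \<in> D" using zD by simp
      show "\<bar>Re z\<bar> \<le> 1 / 2" "\<bar>Re (moebius (adjugate2 A) z)\<bar> \<le> 1 / 2"
        using z w(1) unfolding wz[symmetric] by (auto simp: D_def)
      have "Im z \<le> Im w" using w A(1) by (auto simp: D_def)
      moreover have "Im w \<le> Im z" using wz z SL by (auto simp: D_def)
      ultimately have "Im (moebius (adjugate2 A) z) = Im z" using wz by simp
      moreover have "Im z > 0" "aut_factor (adjugate2 A) z \<noteq> 0" 
        using z SL by (auto simp: D_def uhp_iff[symmetric] SL2Z_moebius)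
      ultimately have "(cmod (aut_factor (adjugate2 A) z))\<^sup>2 = 1"
        using SL by (simp add: Im_moebius SL2Z_D field_simps)
      then show "cmod (aut_factor (adjugate2 A) z) = 1"
        by (simp add: power2_eq_1_iff) (metis norm_ge_zero neg_0_le_iff_le not_one_le_zero)
    qed
    show "D \<inter> moebius A ` D \<in> null_sets lborel"
    proof (cases "A$2$1 = 0")
      case False
      define c a where "c = A$2$1" and "a = A$1$1"
      \<comment> \<open>An \<open>aut_factor\<close> of modulus 1 for the inverse of
        \<open>A\<close> reads \<open>cmod (a - c z) = 1\<close>, which is a circle since
        \<open>c\<close> is nonzero.\<close>
      have "D \<inter> moebius A ` D \<subseteq> sphere (of_int a / of_int c) (1 / \<bar>of_int c\<bar>)"
      proof
        fix z assume "z \<in> D \<inter> moebius A ` D"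
        from abs1[OF this] have "cmod (of_int a - of_int c * z) = 1"
          by (simp add: aut_factor_def a_def c_def)
        moreover have "of_int a - of_int c * z = of_int c * (of_int a / of_int c - z)"
          using False by (simp add: c_def field_simps)
        ultimately have "\<bar>of_int c\<bar> * dist (of_int a / of_int c) z = 1"
          by (simp add: norm_mult dist_norm)
        then show "z \<in> sphere (of_int a / of_int c) (1 / \<bar>of_int c\<bar>)"
          using False by (simp add: c_def field_simps)
      qed
      moreover have "sphere (of_int a / of_int c) (1 / \<bar>of_int c\<bar>) \<in> null_sets (lborel :: complex measure)"
        by (intro null_sets_lborel_closed negligible_sphere) simp
      ultimately show ?thesis
        using meas by (auto intro: null_sets_subset)
    next
      case True
      define a b d where "a = A$1$1" and "b = A$1$2" and "d = A$2$2"
      have "a * d = 1" using SL2Z_det[OF SL(1)] True by (simp add: a_def d_def)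
      then have ad: "(a = 1 \<and> d = 1) \<or> (a = -1 \<and> d = -1)" by (auto simp: zmult_eq_1_iff)
      have "b \<noteq> 0"
        using A(2) True ad by (auto simp: mat2_eq_iff a_def b_def d_def)
      \<comment> \<open>Up to sign, \<open>A\<close> is now the translation by a nonzero integer,
        and two points of a closed strip of width 1 that differ by one lie on its edges.\<close>
      have "D \<inter> moebius A ` D \<subseteq> {z. 1 \<bullet> z = 1/2} \<union> {z. 1 \<bullet> z = - 1/2}"
      proof
        fix z assume z: "z \<in> D \<inter> moebius A ` D"
        have "moebius (adjugate2 A) z = z - of_int (a * b)"
          using ad True by (auto simp: moebius_def aut_factor_def a_def[symmetric] b_def[symmetric] d_def[symmetric])
        with Re[OF z] have "\<bar>Re z\<bar> \<le> 1 / 2" "\<bar>Re z - of_int (a * b)\<bar> \<le> 1 / 2" by auto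
        moreover have "a * b \<ge> 1 \<or> a * b \<le> -1" using ad \<open>b \<noteq> 0\<close> by auto
        then have "real_of_int (a * b) \<ge> 1 \<or> real_of_int (a * b) \<le> - 1"
          by (metis of_int_1 of_int_le_iff of_int_minus)
        ultimately have "Re z = 1/2 \<or> Re z = - 1/2" by linarith
        then show "z \<in> {z. 1 \<bullet> z = 1/2} \<union> {z. 1 \<bullet> z = - 1/2}" by (auto simp: inner_complex_def)
      qed
      moreover have "{z. 1 \<bullet> z = 1/2} \<union> {z. 1 \<bullet> z = - 1/2} \<in> null_sets (lborel :: complex measure)"
        by (intro null_sets.Un null_sets_lborel_closed negligible_hyperplane closed_hyperplane) auto
      ultimately show ?thesis
        using meas by (auto intro: null_sets_subset)
    qed
  qed
  then show ?thesis unfolding G_def by blast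
qed

lemma is_fundamental_domain_fund_domain: "is_fundamental_domain (Gamma0 l) (fund_domain l)"
  unfolding fund_domain_def by (rule someI_ex[OF exists_fundamental_domain])

section \<open>Cusp forms and traces\<close>

lemma cusp_formsD:
  assumes "f \<in> cusp_forms k l"
  shows "f holomorphic_on \<H>"
    "A \<in> Gamma0 l \<Longrightarrow> z \<in> \<H> \<Longrightarrow> f (moebius A z) = aut_factor A z ^ k * f z"
    "A \<in> SL2Z \<Longrightarrow> (slash k A f \<longlongrightarrow> 0) (filtercomap Im at_top)"
    "z \<notin> \<H> \<Longrightarrow> f z = 0"
  using assms by (auto simp: cusp_forms_def slash_def[abs_def])

lemma cusp_formsI:
  assumes "f holomorphic_on \<H>"
    "\<And>A z. A \<in> Gamma0 l \<Longrightarrow> z \<in> \<H> \<Longrightarrow> f (moebius A z) = aut_factor A z ^ k * f z"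
    "\<And>A. A \<in> SL2Z \<Longrightarrow> (slash k A f \<longlongrightarrow> 0) (filtercomap Im at_top)"
    "\<And>z. z \<notin> \<H> \<Longrightarrow> f z = 0"
  shows "f \<in> cusp_forms k l"
  using assms by (auto simp: cusp_forms_def slash_def[abs_def])

lemma slash_cusp_form:
  assumes "f \<in> cusp_forms k l" "A \<in> Gamma0 l" "z \<in> \<H>"
  shows "slash k A f z = f z"
  using cusp_formsD(2)[OF assms] SL2Z_moebius(2)[OF assms(3)] assms(2) Gamma0_subset_SL2Z[of l]
  by (auto simp: slash_def)

text \<open>The condition at the cusps ranges over all of \<open>SL2Z\<close> whatever the level, so
  only the invariance group changes, and it shrinks.\<close>

lemma cusp_forms_mono:
  assumes "l dvd l'"
  shows "cusp_forms k l \<subseteq> cusp_forms k l'"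
proof -
  have "int l dvd int l'" using assms by simp
  then have "Gamma0 l' \<subseteq> Gamma0 l" by (auto simp: Gamma0_def intro: dvd_trans)
  then show ?thesis by (auto simp: cusp_forms_def)
qed

lemma cusp_forms_zero: "(\<lambda>z. 0) \<in> cusp_forms k l"
  by (rule cusp_formsI) (auto simp: slash_def[abs_def])

lemma cusp_forms_add:
  assumes "f \<in> cusp_forms k l" "g \<in> cusp_forms k l"
  shows "(\<lambda>z. f z + g z) \<in> cusp_forms k l"
proof (rule cusp_formsI)
  fix A assume "A \<in> SL2Z"
  then have "((\<lambda>z. slash k A f z + slash k A g z) \<longlongrightarrow> 0 + 0) (filtercomap Im at_top)"
    by (intro tendsto_add cusp_formsD(3)[OF assms(1)] cusp_formsD(3)[OF assms(2)])
  then show "(slash k A (\<lambda>z. f z + g z) \<longlongrightarrow> 0) (filtercomap Im at_top)"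
    by (simp add: slash_def[abs_def] add_divide_distrib)
qed (use cusp_formsD[OF assms(1)] cusp_formsD[OF assms(2)] in \<open>auto intro!: holomorphic_intros simp: algebra_simps\<close>)

lemma cusp_forms_scale:
  assumes "f \<in> cusp_forms k l"
  shows "(\<lambda>z. c * f z) \<in> cusp_forms k l"
proof (rule cusp_formsI)
  fix A assume "A \<in> SL2Z"
  then have "((\<lambda>z. c * slash k A f z) \<longlongrightarrow> c * 0) (filtercomap Im at_top)"
    by (intro tendsto_mult_left cusp_formsD(3)[OF assms(1)])
  then show "(slash k A (\<lambda>z. c * f z) \<longlongrightarrow> 0) (filtercomap Im at_top)"
    by (simp add: slash_def[abs_def])
qed (use cusp_formsD[OF assms(1)] in \<open>auto intro!: holomorphic_intros simp: algebra_simps\<close>)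

lemma subspace_cusp_forms: "cfun.subspace (cusp_forms k l)"
  using cusp_forms_zero[of k l] cusp_forms_add cusp_forms_scale
  by (auto simp: cfun.subspace_def zero_fun_def plus_fun_def)

lemma cusp_forms_sum:
  assumes "\<And>i. i \<in> I \<Longrightarrow> f i \<in> cusp_forms k l"
  shows "(\<lambda>z. \<Sum>i\<in>I. f i z) \<in> cusp_forms k l"
proof -
  have "(\<Sum>i\<in>I. f i) \<in> cusp_forms k l"
    by (intro cfun.subspace_sum subspace_cusp_forms assms)
  moreover have "(\<Sum>i\<in>I. f i) = (\<lambda>z. \<Sum>i\<in>I. f i z)"
    by (induction I rule: infinite_finite_induct) (auto simp: fun_eq_iff)
  ultimately show ?thesis by simp
qed

lemma eventually_uhp: "eventually (\<lambda>z. z \<in> \<H>) (filtercomap Im at_top)"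
  unfolding eventually_filtercomap by (intro exI[of _ "\<lambda>y. y > 0"]) (auto simp: uhp_iff eventually_gt_at_top)

section \<open>Behaviour at the cusps under integer matrices of positive determinant\<close>

lemma upper_triangular_decomposition:
  fixes M :: "int^2^2"
  assumes "det M > 0"
  obtains S U where "S \<in> SL2Z" "U$2$1 = 0" "det U = det M" "M = S ** U"
proof -
  define a c g where "a = M$1$1" and "c = M$2$1" and "g = gcd a c"
  have "g \<noteq> 0" using assms by (auto simp: a_def c_def g_def det_2)
  obtain x y where xy: "x * a + y * c = g"
    using bezout_int[of a c] by (auto simp: g_def)
  obtain a' c' where a': "a = g * a'" and c': "c = g * c'"
    unfolding g_def by (meson gcd_dvd1 gcd_dvd2 dvdE)
  have "g * (x * a' + y * c') = g * 1" using xy a' c' by (simp add: algebra_simps)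
  then have 1: "x * a' + y * c' = 1" using \<open>g \<noteq> 0\<close> by simp
  define T where "T = mat2 x y (- c') a'"
  have T: "T \<in> SL2Z" using 1 by (simp add: T_def SL2Z_def algebra_simps)
  show ?thesis
  proof (rule that[of "adjugate2 T" "T ** M"])
    show "adjugate2 T \<in> SL2Z" using T by (rule SL2Z_adjugate2)
    show "(T ** M)$2$1 = 0"
      using a' c' by (simp add: mat2_mult_nth T_def a_def[symmetric] c_def[symmetric])
    show "det (T ** M) = det M" using T by (simp add: det_mul SL2Z_D)
    show "M = adjugate2 T ** (T ** M)" using T by (simp add: SL2Z_cancel)
  qed
qed

text \<open>Vanishing at the cusps is demanded for \<open>SL2Z\<close> only, while dilations and
  traces involve other determinants. An upper triangular \<open>U\<close> fixes the cusp at infinity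
  and multiplies imaginary parts by a positive constant, so splitting off
  \<open>S \<in> SL2Z\<close> reduces the claim to the definition.\<close>

lemma cusp_form_slash_tendsto:
  assumes f: "f \<in> cusp_forms k l" and M: "det M > 0"
  shows "(slash k M f \<longlongrightarrow> 0) (filtercomap Im at_top)"
proof -
  obtain S U where SU: "S \<in> SL2Z" "U$2$1 = 0" "det U = det M" "M = S ** U"
    using upper_triangular_decomposition[OF M] by blast
  define u where "u = U$2$2"
  have u: "u \<noteq> 0" using SU M by (auto simp: u_def det_2)
  have aut: "aut_factor U z = of_int u" for z
    using SU by (simp add: aut_factor_def u_def)
  have slash: "slash k M f z = slash k S f (moebius U z) / of_int u ^ k" for z
    using slash_mult[of U z k S f] u aut SU by (simp add: slash_def)
  have pos: "real_of_int (det M) / (of_int u)\<^sup>2 > 0" using M u by simp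
  have "filterlim (\<lambda>z. real_of_int (det M) / (of_int u)\<^sup>2 * Im z) at_top (filtercomap Im at_top)"
    by (rule filterlim_tendsto_pos_mult_at_top[OF tendsto_const pos filterlim_filtercomap])
  then have "filterlim (\<lambda>z. Im (moebius U z)) at_top (filtercomap Im at_top)"
    by (simp add: Im_moebius aut SU)
  then have "filterlim (moebius U) (filtercomap Im at_top) (filtercomap Im at_top)"
    by (simp add: filterlim_filtercomap_iff o_def)
  then have "((\<lambda>z. slash k S f (moebius U z)) \<longlongrightarrow> 0) (filtercomap Im at_top)"
    using cusp_formsD(3)[OF f SU(1)] by (rule filterlim_compose[rotated])
  then have "((\<lambda>z. slash k S f (moebius U z) / of_int u ^ k) \<longlongrightarrow> 0 / of_int u ^ k) (filtercomap Im at_top)"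
    using u by (intro tendsto_divide tendsto_const) auto
  then show ?thesis by (simp add: slash[abs_def])
qed

lemma holomorphic_slash:
  assumes "f holomorphic_on \<H>" "det M > 0"
  shows "slash k M f holomorphic_on \<H>"
proof -
  have nz: "aut_factor M z \<noteq> 0" if "z \<in> \<H>" for z
    using that assms aut_factor_nonzero by blast
  have aut: "aut_factor M holomorphic_on \<H>"
    unfolding aut_factor_def[abs_def] by (intro holomorphic_intros)
  have "moebius M holomorphic_on \<H>"
    unfolding moebius_def[abs_def] by (intro holomorphic_intros aut) (use nz in auto)
  then have "(f \<circ> moebius M) holomorphic_on \<H>"
    by (rule holomorphic_on_compose_gen[OF _ assms(1)]) (use moebius_uhp assms in auto)
  then have "(\<lambda>z. f (moebius M z)) holomorphic_on \<H>"
    by (simp add: o_def)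
  then show ?thesis
    unfolding slash_def[abs_def] by (intro holomorphic_intros aut) (use nz in auto)
qed

section \<open>Traces as sums over cosets\<close>

definition slash_sum :: "nat \<Rightarrow> (int^2^2) set \<Rightarrow> (complex \<Rightarrow> complex) \<Rightarrow> complex \<Rightarrow> complex" where
  "slash_sum k R h z = (if z \<in> \<H> then \<Sum>r\<in>R. slash k r h z else 0)"

text \<open>Right multiplication by \<open>A\<close> permutes the cosets \<open>K r\<close>, and the
  slash of \<open>h\<close> by an element depends only on its coset.\<close>

lemma slash_sum_invariant:
  assumes K: "modular_subgroup K" and G: "modular_subgroup G" and R: "right_transversal K G R"
    and inv: "\<And>A z. A \<in> K \<Longrightarrow> z \<in> \<H> \<Longrightarrow> slash k A h z = h z"
    and A: "A \<in> G" and z: "z \<in> \<H>"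
  shows "(\<Sum>r\<in>R. slash k (r ** A) h z) = (\<Sum>r\<in>R. slash k r h z)"
proof -
  note R' = right_transversalD[OF R]
  have SL: "B \<in> SL2Z" if "B \<in> G" for B using modular_subgroupD(1)[OF G that] .
  have "\<forall>r\<in>R. \<exists>s. s \<in> R \<and> (r ** A) ** adjugate2 s \<in> K"
  proof
    fix r assume "r \<in> R"
    then have "r ** A \<in> G" using A R'(2) modular_subgroupD(4)[OF G] by blast
    from R'(4)[OF this] show "\<exists>s. s \<in> R \<and> (r ** A) ** adjugate2 s \<in> K" by blast
  qed
  then obtain \<sigma> where \<sigma>: "\<And>r. r \<in> R \<Longrightarrow> \<sigma> r \<in> R" "\<And>r. r \<in> R \<Longrightarrow> (r ** A) ** adjugate2 (\<sigma> r) \<in> K"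
    by metis
  have inj: "inj_on \<sigma> R"
  proof
    fix r s assume rs: "r \<in> R" "s \<in> R" "\<sigma> r = \<sigma> s"
    have G': "r \<in> G" "s \<in> G" "\<sigma> s \<in> G" using rs R'(2) \<sigma>(1) by auto
    have "((r ** A) ** adjugate2 (\<sigma> s)) ** adjugate2 ((s ** A) ** adjugate2 (\<sigma> s)) \<in> K"
      using \<sigma>(2)[OF rs(1)] \<sigma>(2)[OF rs(2)] rs(3) modular_subgroupD(4,5)[OF K] by simp
    also have "((r ** A) ** adjugate2 (\<sigma> s)) ** adjugate2 ((s ** A) ** adjugate2 (\<sigma> s)) =
        r ** (A ** (adjugate2 (\<sigma> s) ** (\<sigma> s ** (adjugate2 A ** adjugate2 s))))"
      by (simp add: adjugate2_mult matrix_mul_assoc)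
    also have "\<dots> = r ** adjugate2 s"
      using SL G' A by (simp add: SL2Z_cancel)
    finally have "r ** adjugate2 s \<in> K" .
    moreover have "r ** adjugate2 r \<in> K"
      using SL[OF G'(1)] modular_subgroupD(2)[OF K] by (simp add: SL2Z_cancel)
    ultimately show "r = s" using R'(4)[OF G'(1)] rs by blast
  qed
  have bij: "bij_betw \<sigma> R R"
    using inj \<sigma>(1) R'(1) by (simp add: bij_betw_def endo_inj_surj image_subsetI)
  have "(\<Sum>r\<in>R. slash k (r ** A) h z) = (\<Sum>r\<in>R. slash k (\<sigma> r) h z)"
  proof (rule sum.cong)
    fix r assume r: "r \<in> R"
    then have s: "\<sigma> r \<in> SL2Z" using SL \<sigma>(1) R'(2) by blast
    define B where "B = (r ** A) ** adjugate2 (\<sigma> r)"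
    have "slash k (r ** A) h z = slash k (B ** \<sigma> r) h z"
      using s by (simp add: B_def SL2Z_cancel)
    also have "\<dots> = slash k (\<sigma> r) (slash k B h) z"
      using SL2Z_moebius(2)[OF z s] by (rule slash_mult)
    also have "\<dots> = slash k (\<sigma> r) h z"
      unfolding slash_def[of k "\<sigma> r"] using inv[OF \<sigma>(2)[OF r]] SL2Z_moebius(1)[OF z s] by (simp add: B_def)
    finally show "slash k (r ** A) h z = slash k (\<sigma> r) h z" .
  qed simp
  also have "\<dots> = (\<Sum>r\<in>R. slash k r h z)"
    by (rule sum.reindex_bij_betw[OF bij])
  finally show ?thesis .
qed

text \<open>Allowing \<open>M\<close> covers both traces in use: the identity for forms of higher
  level, and the diagonal matrix that undoes a dilation. At a cusp each summand is \<open>f\<close>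
  slashed by \<open>M ** (r ** A)\<close>, again of positive determinant.\<close>

lemma slash_sum_cusp_form:
  assumes K: "modular_subgroup K" and R: "right_transversal K (Gamma0 l) R"
    and inv: "\<And>A z. A \<in> K \<Longrightarrow> z \<in> \<H> \<Longrightarrow> slash k A (slash k M f) z = slash k M f z"
    and f: "f \<in> cusp_forms k l'" and M: "det M > 0"
  shows "slash_sum k R (slash k M f) \<in> cusp_forms k l"
proof -
  define h where "h = slash k M f"
  note R' = right_transversalD[OF R]
  have SL: "r \<in> SL2Z" if "r \<in> R" for r using that R'(2) Gamma0_subset_SL2Z by blast
  have hA: "slash k A h z = slash k (M ** A) f z" if "A \<in> SL2Z" "z \<in> \<H>" for A z
    using slash_mult[OF SL2Z_moebius(2)[OF that(2,1)], of k M f] by (simp add: h_def)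
  have eq: "slash k A (slash_sum k R h) z = (\<Sum>r\<in>R. slash k (r ** A) h z)"
    if "A \<in> SL2Z" "z \<in> \<H>" for A z
    using slash_mult[OF SL2Z_moebius(2)[OF that(2,1)], of k _ h] SL2Z_moebius(1)[OF that(2,1)]
    by (simp add: slash_def[of k A "slash_sum k R h"] slash_sum_def sum_divide_distrib) (simp add: slash_def)
  have "slash_sum k R h \<in> cusp_forms k l"
  proof (rule cusp_formsI)
    have "(\<lambda>z. \<Sum>r\<in>R. slash k r h z) holomorphic_on \<H>"
      unfolding h_def by (intro holomorphic_on_sum holomorphic_slash cusp_formsD(1)[OF f] M) (simp add: SL2Z_D SL)
    then show "slash_sum k R h holomorphic_on \<H>"
      by (rule holomorphic_transform) (simp add: slash_sum_def)
  next
    fix A z assume A: "A \<in> Gamma0 l" and z: "z \<in> \<H>"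
    then have SLA: "A \<in> SL2Z" using Gamma0_subset_SL2Z by blast
    have "slash k A (slash_sum k R h) z = slash_sum k R h z"
      using slash_sum_invariant[OF K modular_subgroup_Gamma0 R inv A z, folded h_def] z
      by (simp add: eq[OF SLA z] slash_sum_def)
    then show "slash_sum k R h (moebius A z) = aut_factor A z ^ k * slash_sum k R h z"
      using SL2Z_moebius(2)[OF z SLA] by (simp add: slash_def field_simps)
  next
    fix A assume A: "A \<in> SL2Z"
    have "((\<lambda>z. \<Sum>r\<in>R. slash k (M ** (r ** A)) f z) \<longlongrightarrow> (\<Sum>r\<in>R. 0)) (filtercomap Im at_top)"
      by (intro tendsto_sum cusp_form_slash_tendsto[OF f]) (use M A SL in \<open>simp add: det_mul SL2Z_D\<close>)
    moreover have "eventually (\<lambda>z. (\<Sum>r\<in>R. slash k (M ** (r ** A)) f z) = slash k A (slash_sum k R h) z) (filtercomap Im at_top)"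
      using eventually_uhp by eventually_elim (simp add: eq A hA SL2Z_mult SL)
    ultimately show "(slash k A (slash_sum k R h) \<longlongrightarrow> 0) (filtercomap Im at_top)"
      by (simp cong: filterlim_cong add: tendsto_cong)
  qed (simp add: slash_sum_def)
  then show ?thesis by (simp add: h_def)
qed

lemma slash_mat_1 [simp]: "slash k (mat 1) f = f"
  by (simp add: fun_eq_iff slash_def) (simp add: aut_factor_def)

section \<open>Unitriangular coset representatives\<close>

definition lower_reps :: "nat \<Rightarrow> nat \<Rightarrow> (int^2^2) set" where
  "lower_reps l e = (\<lambda>j. mat2 1 0 (int j * int l) 1) ` {..<e}"

definition upper_reps :: "nat \<Rightarrow> (int^2^2) set" where
  "upper_reps d = (\<lambda>b. mat2 1 (int b) 0 1) ` {..<d}"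

text \<open>The conjugate of \<open>Gamma0 (l * d)\<close> by dilation by \<open>d\<close>: the
  group under which \<open>f (z / d)\<close> transforms when \<open>f\<close> has level
  \<open>l * d\<close>.\<close>

definition Gamma0_upper :: "nat \<Rightarrow> nat \<Rightarrow> (int^2^2) set" where
  "Gamma0_upper l d = {A \<in> Gamma0 l. int d dvd A$1$2}"

lemma modular_subgroup_Gamma0_upper: "modular_subgroup (Gamma0_upper l d)"
  using modular_subgroup_Gamma0[of l]
  by (auto simp: modular_subgroup_def Gamma0_upper_def mat2_mult_nth)

lemma exists_unique_residue:
  fixes a c :: int
  assumes "coprime a (int e)" "e > 0"
  shows "\<exists>!j. j < e \<and> int e dvd c - a * int j"
proof -
  obtain x y where xy: "x * a + y * int e = 1"
    using assms(1) bezout_int[of a "int e"] by auto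
  have iff: "int e dvd c - a * j \<longleftrightarrow> (x * c) mod int e = j mod int e" for j
  proof -
    have "x * (c - a * j) = (x * c - j) + int e * (y * j)" "a * (x * c - j) = (c - a * j) - int e * (y * c)"
      using arg_cong[OF xy, of "\<lambda>t. t * j"] arg_cong[OF xy, of "\<lambda>t. t * c"] by (simp_all add: algebra_simps)
    then have "int e dvd c - a * j \<longleftrightarrow> int e dvd x * c - j"
      by (metis dvd_add_left_iff dvd_diff_left_iff dvd_mult dvd_triv_left)
    then show ?thesis by (simp add: mod_eq_dvd_iff)
  qed
  show ?thesis
  proof (rule ex1I[of _ "nat ((x * c) mod int e)"])
    show "nat ((x * c) mod int e) < e \<and> int e dvd c - a * int (nat ((x * c) mod int e))"
      using assms(2) by (simp add: iff nat_less_iff)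
    fix j assume j: "j < e \<and> int e dvd c - a * int j"
    then have "int j mod int e = (x * c) mod int e" by (simp add: iff)
    then show "j = nat ((x * c) mod int e)" using j by simp
  qed
qed

text \<open>Because \<open>e\<close> divides \<open>l\<close>, the entry \<open>A$2$2\<close> is a
  unit modulo \<open>e\<close>, so the representative \<open>j\<close> is the unique solution of a
  linear congruence. For a prime \<open>e\<close> not dividing \<open>l\<close> the index would be
  \<open>e + 1\<close> instead of \<open>e\<close>.\<close>

lemma right_transversal_lower:
  assumes "e dvd l" "l > 0" "e > 0"
  shows "right_transversal (Gamma0 (l * e)) (Gamma0 l) (lower_reps l e)"
  unfolding right_transversal_def
proof (intro conjI ballI)
  show "Gamma0 (l * e) \<subseteq> Gamma0 l" by (auto simp: Gamma0_def intro: dvd_mult_left)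
  show "finite (lower_reps l e)" by (simp add: lower_reps_def)
  show "lower_reps l e \<subseteq> Gamma0 l" by (auto simp: lower_reps_def Gamma0_def SL2Z_def)
  fix A assume A: "A \<in> Gamma0 l"
  then have SL: "A \<in> SL2Z" using Gamma0_subset_SL2Z by blast
  obtain c where c: "A$2$1 = int l * c" using A by (auto simp: Gamma0_def)
  obtain l' where l': "l = e * l'" using assms(1) by blast
  have "A$1$1 * A$2$2 - (A$1$2 * int l' * c) * int e = 1" using SL2Z_det[OF SL] c l' by (simp add: algebra_simps)
  then have cop: "coprime (A$2$2) (int e)"
    by (intro coprimeI) (metis dvd_diff dvd_mult)
  have iff: "A ** adjugate2 (mat2 1 0 (int j * int l) 1) \<in> Gamma0 (l * e) \<longleftrightarrow> int e dvd c - A$2$2 * int j" for j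
  proof -
    have "A ** adjugate2 (mat2 1 0 (int j * int l) 1) \<in> SL2Z"
      using SL by (intro SL2Z_mult SL2Z_adjugate2) (auto simp: SL2Z_def)
    moreover have "(A ** adjugate2 (mat2 1 0 (int j * int l) 1))$2$1 = int l * (c - A$2$2 * int j)"
      by (simp add: mat2_mult_nth c algebra_simps)
    ultimately show ?thesis using assms by (simp add: Gamma0_def)
  qed
  obtain j where j: "j < e" "int e dvd c - A$2$2 * int j"
      and uniq: "\<And>i. i < e \<Longrightarrow> int e dvd c - A$2$2 * int i \<Longrightarrow> i = j"
    using exists_unique_residue[OF cop assms(3), of c] by blast
  show "\<exists>!r. r \<in> lower_reps l e \<and> A ** adjugate2 r \<in> Gamma0 (l * e)"
  proof (rule ex1I[of _ "mat2 1 0 (int j * int l) 1"])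
    show "mat2 1 0 (int j * int l) 1 \<in> lower_reps l e \<and> A ** adjugate2 (mat2 1 0 (int j * int l) 1) \<in> Gamma0 (l * e)"
      using j unfolding iff by (auto simp: lower_reps_def)
    fix r assume "r \<in> lower_reps l e \<and> A ** adjugate2 r \<in> Gamma0 (l * e)"
    then obtain i where i: "i < e" "r = mat2 1 0 (int i * int l) 1" "A ** adjugate2 r \<in> Gamma0 (l * e)"
      by (auto simp: lower_reps_def)
    then show "r = mat2 1 0 (int j * int l) 1" using uniq[of i] iff[of i] by simp
  qed
qed

text \<open>As \<open>d\<close> divides the lower left entry, \<open>A$1$1\<close> is a unit modulo
  \<open>d\<close>, and the congruence now clears the upper right entry.\<close>

lemma right_transversal_upper:
  assumes "d dvd l" "d > 0"
  shows "right_transversal (Gamma0_upper l d) (Gamma0 l) (upper_reps d)"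
  unfolding right_transversal_def
proof (intro conjI ballI)
  show "Gamma0_upper l d \<subseteq> Gamma0 l" by (auto simp: Gamma0_upper_def)
  show "finite (upper_reps d)" by (simp add: upper_reps_def)
  show sub: "upper_reps d \<subseteq> Gamma0 l" by (auto simp: upper_reps_def Gamma0_def SL2Z_def)
  fix A assume A: "A \<in> Gamma0 l"
  then have SL: "A \<in> SL2Z" using Gamma0_subset_SL2Z by blast
  have "int d dvd int l" using assms by simp
  then have "int d dvd A$2$1" using A by (auto simp: Gamma0_def intro: dvd_trans)
  then obtain c where c: "A$2$1 = int d * c" by blast
  have "A$1$1 * A$2$2 - (A$1$2 * c) * int d = 1" using SL2Z_det[OF SL] c by (simp add: algebra_simps)
  then have cop: "coprime (A$1$1) (int d)"
    by (intro coprimeI) (metis dvd_diff dvd_mult dvd_mult2)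
  have iff: "A ** adjugate2 (mat2 1 (int j) 0 1) \<in> Gamma0_upper l d \<longleftrightarrow> int d dvd A$1$2 - A$1$1 * int j" for j
  proof -
    have "mat2 1 (int j) 0 1 \<in> Gamma0 l" by (simp add: Gamma0_def SL2Z_def)
    then have "A ** adjugate2 (mat2 1 (int j) 0 1) \<in> Gamma0 l"
      using A modular_subgroupD(4,5)[OF modular_subgroup_Gamma0] by blast
    moreover have "(A ** adjugate2 (mat2 1 (int j) 0 1))$1$2 = A$1$2 - A$1$1 * int j"
      by (simp add: mat2_mult_nth)
    ultimately show ?thesis by (simp add: Gamma0_upper_def)
  qed
  obtain j where j: "j < d" "int d dvd A$1$2 - A$1$1 * int j"
      and uniq: "\<And>i. i < d \<Longrightarrow> int d dvd A$1$2 - A$1$1 * int i \<Longrightarrow> i = j"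
    using exists_unique_residue[OF cop assms(2), of "A$1$2"] by blast
  show "\<exists>!r. r \<in> upper_reps d \<and> A ** adjugate2 r \<in> Gamma0_upper l d"
  proof (rule ex1I[of _ "mat2 1 (int j) 0 1"])
    show "mat2 1 (int j) 0 1 \<in> upper_reps d \<and> A ** adjugate2 (mat2 1 (int j) 0 1) \<in> Gamma0_upper l d"
      using j unfolding iff by (auto simp: upper_reps_def)
    fix r assume "r \<in> upper_reps d \<and> A ** adjugate2 r \<in> Gamma0_upper l d"
    then obtain i where i: "i < d" "r = mat2 1 (int i) 0 1" "A ** adjugate2 r \<in> Gamma0_upper l d"
      by (auto simp: upper_reps_def)
    then show "r = mat2 1 (int j) 0 1" using uniq[of i] iff[of i] by simp
  qed
qed

lemma card_lower_reps: "l > 0 \<Longrightarrow> card (lower_reps l e) = e"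
  unfolding lower_reps_def by (subst card_image) (auto simp: inj_on_def mat2_eq_iff)

lemma card_upper_reps: "card (upper_reps d) = d"
  unfolding upper_reps_def by (subst card_image) (auto simp: inj_on_def mat2_eq_iff)

lemma sum_lower_reps: "l > 0 \<Longrightarrow> (\<Sum>r\<in>lower_reps l e. g r) = (\<Sum>j<e. g (mat2 1 0 (int j * int l) 1))"
  unfolding lower_reps_def by (subst sum.reindex) (auto simp: inj_on_def mat2_eq_iff)

lemma sum_upper_reps: "(\<Sum>r\<in>upper_reps d. g r) = (\<Sum>j<d. g (mat2 1 (int j) 0 1))"
  unfolding upper_reps_def by (subst sum.reindex) (auto simp: inj_on_def mat2_eq_iff)

section \<open>Dilation between levels\<close>

definition dilate_conj :: "nat \<Rightarrow> int^2^2 \<Rightarrow> int^2^2" where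
  "dilate_conj d A = mat2 (A$1$1) (int d * A$1$2) (A$2$1 div int d) (A$2$2)"

text \<open>The matrix is \<open>A\<close> conjugated by the diagonal matrix with entries
  \<open>d\<close> and \<open>1\<close>; the division in \<open>dilate_conj\<close> is exact on
  \<open>Gamma0 (l * d)\<close>.\<close>

lemma dilate_conj:
  assumes A: "A \<in> Gamma0 (l * d)" and d: "d > 0"
  shows "dilate_conj d A \<in> Gamma0_upper l d"
    and "aut_factor (dilate_conj d A) (of_nat d * z) = aut_factor A z"
    and "moebius (dilate_conj d A) (of_nat d * z) = of_nat d * moebius A z"
proof -
  obtain c where c: "A$2$1 = int (l * d) * c" using A by (auto simp: Gamma0_def)
  have c': "A$2$1 div int d = int l * c" using c d by simp
  have "A \<in> SL2Z" using A Gamma0_subset_SL2Z by blast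
  from SL2Z_det[OF this] show "dilate_conj d A \<in> Gamma0_upper l d"
    by (simp add: dilate_conj_def c' Gamma0_upper_def Gamma0_def SL2Z_def) (simp add: c algebra_simps)
  show aut: "aut_factor (dilate_conj d A) (of_nat d * z) = aut_factor A z"
    by (simp add: aut_factor_def dilate_conj_def c') (simp add: c)
  show "moebius (dilate_conj d A) (of_nat d * z) = of_nat d * moebius A z"
    unfolding moebius_def aut by (simp add: dilate_conj_def algebra_simps)
qed

lemma dilate_conj_surj:
  assumes B: "B \<in> Gamma0_upper l d" and d: "d > 0"
  obtains A where "A \<in> Gamma0 (l * d)" "B = dilate_conj d A"
proof -
  obtain b where b: "B$1$2 = int d * b" using B by (auto simp: Gamma0_upper_def)
  have SL: "B \<in> SL2Z" and c: "int l dvd B$2$1" using B by (auto simp: Gamma0_upper_def Gamma0_def)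
  show ?thesis
  proof (rule that[of "mat2 (B$1$1) b (int d * B$2$1) (B$2$2)"])
    show "mat2 (B$1$1) b (int d * B$2$1) (B$2$2) \<in> Gamma0 (l * d)"
      using SL2Z_det[OF SL] b c by (auto simp: Gamma0_def SL2Z_def mult.commute[of "int d"] mult.assoc intro: mult_dvd_mono)
    show "B = dilate_conj d (mat2 (B$1$1) b (int d * B$2$1) (B$2$2))"
      using d b by (simp add: dilate_conj_def mat2_eq_iff)
  qed
qed

lemma sets_dilate:
  assumes "d > 0" "X \<in> sets borel"
  shows "(\<lambda>z::complex. of_nat d * z) ` X \<in> sets borel"
proof -
  have "(\<lambda>z. of_nat d * z) ` X = (\<lambda>z::complex. z / of_nat d) -` X \<inter> space borel"
  proof (intro equalityI subsetI)
    fix z :: complex assume "z \<in> (\<lambda>z. z / of_nat d) -` X \<inter> space borel"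
    then show "z \<in> (\<lambda>z. of_nat d * z) ` X"
      using assms by (intro image_eqI[of _ _ "z / of_nat d"]) auto
  qed (use assms in auto)
  also have "\<dots> \<in> sets borel"
    by (rule measurable_sets[of _ borel borel]) (use assms(2) in measurable)
  finally show ?thesis .
qed

text \<open>Conjugation by the dilation carries over covering and overlaps, and a linear map keeps
  null sets null. The integral against a dilated form is unfolded from this dilated domain.\<close>

lemma is_fundamental_domain_dilate:
  assumes D: "is_fundamental_domain (Gamma0 (l * d)) D" and d: "d > 0"
  shows "is_fundamental_domain (Gamma0_upper l d) ((\<lambda>z. of_nat d * z) ` D)"
  unfolding is_fundamental_domain_def
proof (intro conjI ballI impI)
  note D' = is_fundamental_domainD[OF D]
  show "(\<lambda>z. of_nat d * z) ` D \<in> sets borel" by (rule sets_dilate[OF d D'(1)])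
  show "(\<lambda>z. of_nat d * z) ` D \<subseteq> \<H>"
    using D'(2) d by (auto simp: uhp_iff subset_iff)
  fix z :: complex assume z: "z \<in> \<H>"
  then have "z / of_nat d \<in> \<H>" using d by (simp add: uhp_iff)
  then obtain A where A: "A \<in> Gamma0 (l * d)" "moebius A (z / of_nat d) \<in> D" using D'(3) by blast
  have "moebius (dilate_conj d A) z = of_nat d * moebius A (z / of_nat d)"
    using dilate_conj(3)[OF A(1) d, of "z / of_nat d"] d by simp
  then show "\<exists>B\<in>Gamma0_upper l d. moebius B z \<in> (\<lambda>z. of_nat d * z) ` D"
    using dilate_conj(1)[OF A(1) d] A(2) by (intro bexI[of _ "dilate_conj d A"]) auto
next
  note D' = is_fundamental_domainD[OF D]
  fix B assume B: "B \<in> Gamma0_upper l d" "B \<noteq> mat 1 \<and> B \<noteq> - mat 1"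
  obtain A where A: "A \<in> Gamma0 (l * d)" "B = dilate_conj d A" using dilate_conj_surj[OF B(1) d] by blast
  have "dilate_conj d (mat 1) = mat 1" "dilate_conj d (- mat 1) = - mat 1"
    by (auto simp: dilate_conj_def mat2_eq_iff)
  then have "A \<noteq> mat 1" "A \<noteq> - mat 1" using A B by auto
  then have N: "D \<inter> moebius A ` D \<in> null_sets lborel" using D'(4)[OF A(1)] by blast
  have "moebius B ` (\<lambda>z. of_nat d * z) ` D = (\<lambda>z. of_nat d * z) ` moebius A ` D"
    unfolding image_image A(2) dilate_conj(3)[OF A(1) d] ..
  then have eq: "(\<lambda>z. of_nat d * z) ` D \<inter> moebius B ` (\<lambda>z. of_nat d * z) ` D =
      (\<lambda>z. of_nat d * z) ` (D \<inter> moebius A ` D)"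
    using d by (auto simp: image_Int[symmetric] inj_on_def)
  have "D \<inter> moebius A ` D \<in> sets borel" using N by (simp add: null_sets_def)
  then have sets: "(\<lambda>z. of_nat d * z) ` (D \<inter> moebius A ` D) \<in> sets borel" by (rule sets_dilate[OF d])
  have "negligible (D \<inter> moebius A ` D)"
    using N by (simp add: negligible_iff_null_sets null_sets_completionI)
  then have "negligible ((\<lambda>z. of_nat d * z) ` (D \<inter> moebius A ` D))"
    by (intro negligible_differentiable_image_negligible linear_imp_differentiable_on order_refl linearI)
       (simp_all add: algebra_simps)
  then show "(\<lambda>z. of_nat d * z) ` D \<inter> moebius B ` (\<lambda>z. of_nat d * z) ` D \<in> null_sets lborel"
    using sets unfolding eq by (simp add: negligible_iff_null_sets null_sets_completion_iff)
qed

lemma raise_level_cusp_form: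
  assumes f: "f \<in> cusp_forms k l" and d: "d > 0"
  shows "raise_level k d f \<in> cusp_forms k (l * d)"
proof -
  define g where "g = (\<lambda>z. f (of_nat d * z))"
  define M where "M = (mat2 (int d) 0 0 1 :: int^2^2)"
  have M: "det M > 0" "moebius M z = of_nat d * z" "aut_factor M z = 1" for z
    using d by (simp_all add: M_def moebius_def aut_factor_def)
  have g: "g = slash k M f" by (simp add: g_def fun_eq_iff slash_def M)
  have "g \<in> cusp_forms k (l * d)"
  proof (rule cusp_formsI)
    show "g holomorphic_on \<H>"
      unfolding g by (intro holomorphic_slash cusp_formsD(1)[OF f] M)
    fix A z assume A: "A \<in> Gamma0 (l * d)" and z: "z \<in> \<H>"
    have "of_nat d * z \<in> \<H>" using z d by (simp add: uhp_iff)
    moreover have "dilate_conj d A \<in> Gamma0 l"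
      using dilate_conj(1)[OF A d] by (simp add: Gamma0_upper_def)
    ultimately show "g (moebius A z) = aut_factor A z ^ k * g z"
      using cusp_formsD(2)[OF f, of "dilate_conj d A" "of_nat d * z"] dilate_conj(2,3)[OF A d] by (simp add: g_def)
  next
    fix A assume A: "A \<in> SL2Z"
    have "(slash k (M ** A) f \<longlongrightarrow> 0) (filtercomap Im at_top)"
      by (intro cusp_form_slash_tendsto[OF f]) (use M A in \<open>simp add: det_mul SL2Z_D\<close>)
    moreover have "eventually (\<lambda>z. slash k (M ** A) f z = slash k A g z) (filtercomap Im at_top)"
      using eventually_uhp by eventually_elim (use A in \<open>simp add: g slash_mult SL2Z_moebius\<close>)
    ultimately show "(slash k A g \<longlongrightarrow> 0) (filtercomap Im at_top)"
      by (simp add: tendsto_cong)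
  next
    show "g z = 0" if "z \<notin> \<H>" for z
      using that d by (auto simp: g_def uhp_iff zero_less_mult_iff intro: cusp_formsD(4)[OF f])
  qed
  then show ?thesis
    unfolding raise_level_def[abs_def] g_def by (rule cusp_forms_scale)
qed

lemma raise_level_mult:
  assumes "d > 0" "d' > 0"
  shows "raise_level k (d * d') f = raise_level k d (raise_level k d' f)"
  using assms by (auto simp: fun_eq_iff raise_level_def powr_mult mult_ac)

section \<open>Adjoints of inclusion and dilation\<close>

definition pet_integrand :: "nat \<Rightarrow> (complex \<Rightarrow> complex) \<Rightarrow> (complex \<Rightarrow> complex) \<Rightarrow> complex \<Rightarrow> complex" where
  "pet_integrand k f g z = f z * cnj (g z) * complex_of_real (Im z ^ k)"

lemma petersson_altdef:
  "petersson V k l f g = complex_of_real (V / measure hyperbolic_measure (fund_domain l)) *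
     (LINT z:fund_domain l|hyperbolic_measure. pet_integrand k f g z)"
  by (simp add: petersson_def pet_integrand_def)

lemma borel_measurable_cusp_form [measurable_dest]:
  assumes "f \<in> cusp_forms k l"
  shows "f \<in> borel_measurable borel"
proof -
  have "(\<lambda>z. indicator \<H> z *\<^sub>R f z) \<in> borel_measurable borel"
    using cusp_formsD(1)[OF assms] by (intro borel_measurable_continuous_on_indicator holomorphic_on_imp_continuous_on) auto
  moreover have "(\<lambda>z. indicator \<H> z *\<^sub>R f z) = f"
    using cusp_formsD(4)[OF assms] by (auto simp: indicator_def fun_eq_iff)
  ultimately show ?thesis by simp
qed

lemma borel_measurable_pet_integrand [measurable]:
  assumes [measurable]: "f \<in> borel_measurable borel" "g \<in> borel_measurable borel"
  shows "pet_integrand k f g \<in> borel_measurable borel"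
proof -
  have "cnj \<in> borel_measurable borel"
    by (intro borel_measurable_continuous_onI continuous_intros)
  then have [measurable]: "(\<lambda>z. cnj (g z)) \<in> borel_measurable borel"
    using assms(2) by (rule measurable_compose[rotated])
  show ?thesis unfolding pet_integrand_def[abs_def] by measurable
qed

lemma borel_measurable_slash [measurable]:
  assumes [measurable]: "f \<in> borel_measurable borel"
  shows "slash k A f \<in> borel_measurable borel"
  unfolding slash_def[abs_def] aut_factor_def[abs_def] by measurable

lemma pet_integrand_slash:
  assumes "z \<in> \<H>" "A \<in> SL2Z"
  shows "pet_integrand k (slash k A f) (slash k A g) z = pet_integrand k f g (moebius A z)"
proof -
  define j where "j = aut_factor A z"
  have j: "j \<noteq> 0" using SL2Z_moebius(2)[OF assms] by (simp add: j_def)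
  have "Im (moebius A z) = Im z / (cmod j)\<^sup>2"
    using assms by (simp add: Im_moebius SL2Z_D j_def)
  moreover have "(complex_of_real (cmod j))\<^sup>2 = j * cnj j"
    using complex_norm_square[of j] by simp
  ultimately have "complex_of_real (Im (moebius A z) ^ k) = complex_of_real (Im z ^ k) / (j ^ k * cnj j ^ k)"
    by (simp add: power_divide power_mult_distrib[symmetric])
  then show ?thesis
    by (simp add: pet_integrand_def slash_def j_def[symmetric])
qed

lemma pet_integrand_cong:
  assumes "f z = f' z" "g z = g' z"
  shows "pet_integrand k f g z = pet_integrand k f' g' z"
  using assms by (simp add: pet_integrand_def)

text \<open>Since \<open>g\<close> is already invariant under \<open>Gamma0 l\<close>, the
  translation by \<open>r\<close> in each unfolded term can be put entirely on \<open>h\<close>, and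
  the terms add up to the trace of \<open>h\<close>. This is the common core of both
  adjunctions.\<close>

lemma set_integral_pet_unfold:
  assumes K: "modular_subgroup K" and R: "right_transversal K (Gamma0 l) R"
    and DK: "is_fundamental_domain K DK"
    and h [measurable]: "h \<in> borel_measurable borel" and g: "g \<in> cusp_forms k l"
    and inv: "\<And>A z. A \<in> K \<Longrightarrow> z \<in> \<H> \<Longrightarrow> slash k A h z = h z"
    and int: "set_integrable hyperbolic_measure DK (pet_integrand k h g)"
  shows "(LINT z:DK|hyperbolic_measure. pet_integrand k h g z) =
    (LINT z:fund_domain l|hyperbolic_measure. pet_integrand k (slash_sum k R h) g z)"
proof -
  note R' = right_transversalD[OF R]
  note G = modular_subgroup_Gamma0[of l]
  note DG = is_fundamental_domain_fund_domain[of l]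
  note [measurable] = borel_measurable_cusp_form[OF g]
  have SL: "A \<in> SL2Z" if "A \<in> Gamma0 l" for A using that Gamma0_subset_SL2Z by blast
  have gA: "slash k A g z = g z" if "A \<in> Gamma0 l" "z \<in> \<H>" for A z
    using slash_cusp_form[OF g that] .
  have Finv: "pet_integrand k h g (moebius A z) = pet_integrand k h g z" if "A \<in> K" "z \<in> \<H>" for A z
  proof -
    have A: "A \<in> Gamma0 l" using that R'(3) by blast
    show ?thesis
      unfolding pet_integrand_slash[OF that(2) SL[OF A], symmetric]
      by (rule pet_integrand_cong) (simp_all add: inv that gA A)
  qed
  have Fr: "pet_integrand k h g (moebius r z) = pet_integrand k (slash k r h) g z"
    if "r \<in> R" "z \<in> \<H>" for r z
  proof -
    have r: "r \<in> Gamma0 l" using that R'(2) by blast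
    show ?thesis
      unfolding pet_integrand_slash[OF that(2) SL[OF r], symmetric]
      by (rule pet_integrand_cong) (simp_all add: gA r that)
  qed
  have "(LINT z:DK|hyperbolic_measure. pet_integrand k h g z) =
      (\<Sum>r\<in>R. LINT z:fund_domain l|hyperbolic_measure. pet_integrand k h g (moebius r z))"
    by (rule set_integral_fundamental_domain_unfold[OF K G R DK DG]) (use Finv int in auto)
  also have "\<dots> = (LINT z|hyperbolic_measure. (\<Sum>r\<in>R. indicator (fund_domain l) z *\<^sub>R pet_integrand k h g (moebius r z)))"
    unfolding set_lebesgue_integral_def
  proof (rule Bochner_Integration.integral_sum[symmetric])
    fix r assume "r \<in> R"
    show "integrable hyperbolic_measure (\<lambda>z. indicator (fund_domain l) z *\<^sub>R pet_integrand k h g (moebius r z))"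
      unfolding set_integrable_def[symmetric]
      by (rule set_integrable_fundamental_domain_unfold[OF K G R DK DG]) (use Finv int \<open>r \<in> R\<close> in auto)
  qed
  also have "\<dots> = (LINT z:fund_domain l|hyperbolic_measure. pet_integrand k (slash_sum k R h) g z)"
    unfolding set_lebesgue_integral_def
  proof (rule Bochner_Integration.integral_cong[OF refl])
    fix z
    show "(\<Sum>r\<in>R. indicator (fund_domain l) z *\<^sub>R pet_integrand k h g (moebius r z)) =
        indicator (fund_domain l) z *\<^sub>R pet_integrand k (slash_sum k R h) g z"
    proof (cases "z \<in> fund_domain l")
      case True
      then have z: "z \<in> \<H>" using is_fundamental_domainD(2)[OF DG] by blast
      have "(\<Sum>r\<in>R. pet_integrand k h g (moebius r z)) = (\<Sum>r\<in>R. pet_integrand k (slash k r h) g z)"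
        by (rule sum.cong[OF refl]) (rule Fr[OF _ z])
      also have "\<dots> = pet_integrand k (slash_sum k R h) g z"
        using z by (simp add: pet_integrand_def slash_sum_def sum_distrib_right)
      finally show ?thesis using True by simp
    qed simp
  qed
  finally show ?thesis .
qed

text \<open>Unfolding the constant 1 shows that the ratio of volumes is the number of cosets; this
  supplies the factors \<open>1 / e\<close> and \<open>1 / d\<close> of the traces.\<close>

lemma emeasure_fundamental_domain_unfold:
  assumes K: "modular_subgroup K" and R: "right_transversal K (Gamma0 l) R"
    and DK: "is_fundamental_domain K DK"
  shows "emeasure hyperbolic_measure DK = of_nat (card R) * emeasure hyperbolic_measure (fund_domain l)"
proof -
  note DG = is_fundamental_domain_fund_domain[of l]
  have "(\<integral>\<^sup>+z\<in>DK. 1 \<partial>hyperbolic_measure) = (\<Sum>r\<in>R. \<integral>\<^sup>+z\<in>fund_domain l. 1 \<partial>hyperbolic_measure)"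
    by (rule nn_integral_fundamental_domain_unfold[OF K modular_subgroup_Gamma0 R DK DG]) auto
  then show ?thesis
    using is_fundamental_domainD(1)[OF DG] is_fundamental_domainD(1)[OF DK] by simp
qed

lemma measure_fundamental_domain_unfold:
  assumes "modular_subgroup K" "right_transversal K (Gamma0 l) R" "is_fundamental_domain K DK"
  shows "measure hyperbolic_measure DK = real (card R) * measure hyperbolic_measure (fund_domain l)"
  unfolding measure_def emeasure_fundamental_domain_unfold[OF assms] by (simp add: enn2real_mult)

text \<open>Restricted to \<H>, the hyperbolic measure equals its own image under \<open>g\<close>,
  so the substitution rules for image measures carry invariance from nonnegative to complex
  integrands.\<close>

lemma set_integral_hyp_preserving:
  fixes F :: "complex \<Rightarrow> complex"
  assumes g: "hyp_preserving g" and D [measurable]: "D \<in> sets borel" and sub: "D \<subseteq> \<H>"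
    and F [measurable]: "F \<in> borel_measurable borel"
  shows "(LINT z:{z\<in>\<H>. g z \<in> D}|hyperbolic_measure. F (g z)) = (LINT z:D|hyperbolic_measure. F z)"
    and "set_integrable hyperbolic_measure {z\<in>\<H>. g z \<in> D} (\<lambda>z. F (g z)) \<longleftrightarrow>
      set_integrable hyperbolic_measure D F"
proof -
  have [measurable]: "g \<in> borel_measurable borel" using g by (simp add: hyp_preserving_def)
  define \<mu> where "\<mu> = density hyperbolic_measure (\<lambda>z. ennreal (indicator \<H> z))"
  have sets [measurable_cong]: "sets \<mu> = sets borel" by (simp add: \<mu>_def)
  have em: "emeasure \<mu> E = (\<integral>\<^sup>+z\<in>\<H>. indicator E z \<partial>hyperbolic_measure)" if "E \<in> sets borel" for E
    using that unfolding \<mu>_def by (subst emeasure_density) (simp_all add: ennreal_indicator mult.commute)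
  have distr: "distr \<mu> borel g = \<mu>"
  proof (rule measure_eqI)
    fix E assume "E \<in> sets (distr \<mu> borel g)"
    then have E [measurable]: "E \<in> sets borel" by simp
    have [measurable]: "g -` E \<in> sets borel"
      using measurable_sets[of g borel borel E] by simp
    have "emeasure (distr \<mu> borel g) E = emeasure \<mu> (g -` E)"
      using sets_eq_imp_space_eq[OF sets] by (subst emeasure_distr) simp_all
    also have "\<dots> = (\<integral>\<^sup>+z\<in>\<H>. indicator E (g z) \<partial>hyperbolic_measure)"
      by (subst em) (auto intro!: nn_integral_cong simp: indicator_def)
    also have "\<dots> = (\<integral>\<^sup>+z\<in>\<H>. indicator E z \<partial>hyperbolic_measure)"
      using g by (simp add: hyp_preserving_def)
    also have "\<dots> = emeasure \<mu> E" by (simp add: em)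
    finally show "emeasure (distr \<mu> borel g) E = emeasure \<mu> E" .
  qed (simp add: sets)
  define F' where "F' z = indicator D z *\<^sub>R F z" for z
  have [measurable]: "F' \<in> borel_measurable borel" unfolding F'_def[abs_def] by measurable
  have 1: "(\<lambda>z. indicator \<H> z *\<^sub>R F' (g z)) = (\<lambda>z. indicator {z\<in>\<H>. g z \<in> D} z *\<^sub>R F (g z))"
    by (auto simp: F'_def fun_eq_iff indicator_def)
  have 2: "(\<lambda>z. indicator \<H> z *\<^sub>R F' z) = (\<lambda>z. indicator D z *\<^sub>R F z)"
    using sub by (auto simp: F'_def fun_eq_iff indicator_def)
  have "(\<integral>z. F' (g z) \<partial>\<mu>) = (\<integral>z. F' z \<partial>distr \<mu> borel g)"
    by (rule integral_distr[symmetric]) simp_all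
  then have "(\<integral>z. F' (g z) \<partial>\<mu>) = (\<integral>z. F' z \<partial>\<mu>)" by (simp add: distr)
  then show "(LINT z:{z\<in>\<H>. g z \<in> D}|hyperbolic_measure. F (g z)) = (LINT z:D|hyperbolic_measure. F z)"
    unfolding \<mu>_def set_lebesgue_integral_def by (subst (asm) (1 2) integral_density) (simp_all add: 1 2)
  have "integrable \<mu> (\<lambda>z. F' (g z)) \<longleftrightarrow> integrable (distr \<mu> borel g) F'"
    by (rule integrable_distr_eq[symmetric]) simp_all
  then have "integrable \<mu> (\<lambda>z. F' (g z)) \<longleftrightarrow> integrable \<mu> F'" by (simp add: distr)
  then show "set_integrable hyperbolic_measure {z\<in>\<H>. g z \<in> D} (\<lambda>z. F (g z)) \<longleftrightarrow>
      set_integrable hyperbolic_measure D F"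
    unfolding \<mu>_def set_integrable_def by (subst (asm) (1 2) integrable_density) (simp_all add: 1 2)
qed

lemma emeasure_hyp_preserving:
  assumes g: "hyp_preserving g" and D [measurable]: "D \<in> sets borel" and sub: "D \<subseteq> \<H>"
  shows "emeasure hyperbolic_measure {z\<in>\<H>. g z \<in> D} = emeasure hyperbolic_measure D"
proof -
  have [measurable]: "g \<in> borel_measurable borel" using g by (simp add: hyp_preserving_def)
  have [measurable]: "g -` D \<in> sets borel"
    using measurable_sets[of g borel borel D] by simp
  have "{z\<in>\<H>. g z \<in> D} = \<H> \<inter> g -` D" by auto
  then have [measurable]: "{z\<in>\<H>. g z \<in> D} \<in> sets borel" by simp
  have "emeasure hyperbolic_measure {z\<in>\<H>. g z \<in> D} =
      (\<integral>\<^sup>+z\<in>\<H>. indicator D (g z) \<partial>hyperbolic_measure)"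
  proof -
    have "emeasure hyperbolic_measure {z\<in>\<H>. g z \<in> D} =
        (\<integral>\<^sup>+z. indicator {z\<in>\<H>. g z \<in> D} z \<partial>hyperbolic_measure)" by simp
    also have "\<dots> = (\<integral>\<^sup>+z\<in>\<H>. indicator D (g z) \<partial>hyperbolic_measure)"
      by (intro nn_integral_cong) (auto simp: indicator_def)
    finally show ?thesis .
  qed
  also have "\<dots> = (\<integral>\<^sup>+z\<in>\<H>. indicator D z \<partial>hyperbolic_measure)"
    using g by (simp add: hyp_preserving_def)
  also have "\<dots> = emeasure hyperbolic_measure D"
  proof -
    have "(\<integral>\<^sup>+z\<in>\<H>. indicator D z \<partial>hyperbolic_measure) = (\<integral>\<^sup>+z. indicator D z \<partial>hyperbolic_measure)"
      using sub by (intro nn_integral_cong) (auto simp: indicator_def)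
    then show ?thesis by simp
  qed
  finally show ?thesis .
qed

text \<open>The adjoint of the inclusion of level \<open>l\<close> into level \<open>l * e\<close>.
  The factor \<open>1 / e\<close> reflects the Petersson product being divided by the volume, which
  is \<open>e\<close> times larger at level \<open>l * e\<close>.\<close>

definition lower_trace :: "nat \<Rightarrow> nat \<Rightarrow> nat \<Rightarrow> (complex \<Rightarrow> complex) \<Rightarrow> complex \<Rightarrow> complex" where
  "lower_trace k l e f z = 1 / of_nat e * slash_sum k (lower_reps l e) f z"

text \<open>The adjoint of \<open>raise_level k d\<close>: the power of \<open>d\<close> comes from
  the dilation, the \<open>1 / d\<close> from the ratio of volumes, and
  \<open>mat2 1 0 0 (int d)\<close> undoes the dilation before the sum over cosets.\<close>

definition upper_trace :: "nat \<Rightarrow> nat \<Rightarrow> (complex \<Rightarrow> complex) \<Rightarrow> complex \<Rightarrow> complex" where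
  "upper_trace k d f z = complex_of_real (real d powr (real k / 2)) / of_nat d *
     slash_sum k (upper_reps d) (slash k (mat2 1 0 0 (int d)) f) z"

lemma lower_trace_cusp_form:
  assumes "e dvd l" "l > 0" "e > 0" and f: "f \<in> cusp_forms k (l * e)"
  shows "lower_trace k l e f \<in> cusp_forms k l"
proof -
  have "slash_sum k (lower_reps l e) (slash k (mat 1) f) \<in> cusp_forms k l"
    by (rule slash_sum_cusp_form[OF modular_subgroup_Gamma0 right_transversal_lower[OF assms(1-3)] _ f])
       (auto simp: slash_cusp_form[OF f])
  then show ?thesis
    unfolding lower_trace_def[abs_def] by (intro cusp_forms_scale) simp
qed

lemma slash_dilate_invariant:
  assumes f: "f \<in> cusp_forms k (l * d)" and d: "d > 0" and A: "A \<in> Gamma0_upper l d"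
    and z: "z \<in> \<H>"
  shows "slash k A (slash k (mat2 1 0 0 (int d)) f) z = slash k (mat2 1 0 0 (int d)) f z"
proof -
  define w where "w = z / of_nat d"
  have w: "w \<in> \<H>" "z = of_nat d * w" using z d by (auto simp: w_def uhp_iff)
  have h: "slash k (mat2 1 0 0 (int d)) f (of_nat d * x) = f x / of_nat d ^ k" for x
    using d by (simp add: slash_def moebius_def aut_factor_def)
  obtain A' where A': "A' \<in> Gamma0 (l * d)" "A = dilate_conj d A'" using dilate_conj_surj[OF A d] by blast
  have "slash k A (slash k (mat2 1 0 0 (int d)) f) z = slash k A' f w / of_nat d ^ k"
    unfolding A'(2) w(2) slash_def[of k "dilate_conj d A'"] dilate_conj(2,3)[OF A'(1) d] h
    by (simp add: slash_def)
  also have "\<dots> = slash k (mat2 1 0 0 (int d)) f z"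
    unfolding w(2) h using slash_cusp_form[OF f A'(1) w(1)] by simp
  finally show ?thesis .
qed

lemma upper_trace_cusp_form:
  assumes "d dvd l" "d > 0" and f: "f \<in> cusp_forms k (l * d)"
  shows "upper_trace k d f \<in> cusp_forms k l"
  unfolding upper_trace_def[abs_def]
  by (intro cusp_forms_scale slash_sum_cusp_form[OF modular_subgroup_Gamma0_upper right_transversal_upper[OF assms(1,2)] _ f])
     (use slash_dilate_invariant[OF f] assms(2) in auto)

section \<open>Integrability and adjunctions for the Petersson product\<close>

locale orthonormal_bases =
  fixes V :: real and k :: nat and B :: "nat \<Rightarrow> (complex \<Rightarrow> complex) set"
  assumes onb: "l > 0 \<Longrightarrow> is_orthonormal_basis V k l (cusp_forms k l) (B l)"
begin

lemma basis_expansion: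
  assumes "finite C" "f \<in> cfun_span C"
  obtains c where "f = (\<lambda>z. \<Sum>g\<in>C. c g * g z)"
proof -
  have "f \<in> range (\<lambda>u. \<Sum>g\<in>C. (\<lambda>z. u g * g z))"
    using assms(2) unfolding cfun.span_finite[OF assms(1)] .
  then obtain u where "f = (\<Sum>g\<in>C. (\<lambda>z. u g * g z))" by blast
  also have "\<dots> = (\<lambda>z. \<Sum>g\<in>C. u g * g z)"
    by (induction C rule: infinite_finite_induct) (auto simp: fun_eq_iff)
  finally show ?thesis by (rule that)
qed

lemma set_integrable_pet_integrand:
  assumes l: "l > 0" and f: "f \<in> cusp_forms k l" and g: "g \<in> cusp_forms k l"
  shows "set_integrable hyperbolic_measure (fund_domain l) (pet_integrand k f g)"
proof -
  define D where "D = fund_domain l"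
  have D [measurable]: "D \<in> sets borel"
    unfolding D_def by (rule is_fundamental_domainD(1)[OF is_fundamental_domain_fund_domain])
  have DH: "z \<in> D \<Longrightarrow> Im z > 0" for z
    unfolding D_def uhp_iff[symmetric] using is_fundamental_domainD(2)[OF is_fundamental_domain_fund_domain] by blast
  have B: "finite (B l)" "cfun_span (B l) = cusp_forms k l"
    "\<And>\<psi>. \<psi> \<in> B l \<Longrightarrow> petersson V k l \<psi> \<psi> = 1"
    using onb[OF l] by (auto simp: is_orthonormal_basis_def)
  have BA: "\<psi> \<in> cusp_forms k l" if "\<psi> \<in> B l" for \<psi>
    using that B(2) cfun.span_base by blast
  have diag: "set_integrable hyperbolic_measure D (pet_integrand k \<psi> \<psi>)" if "\<psi> \<in> B l" for \<psi>
  proof (rule ccontr)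
    assume "\<not> set_integrable hyperbolic_measure D (pet_integrand k \<psi> \<psi>)"
    then have "(LINT z:D|hyperbolic_measure. pet_integrand k \<psi> \<psi> z) = 0"
      unfolding set_integrable_def set_lebesgue_integral_def by (rule not_integrable_integral_eq)
    then show False using B(3)[OF that] by (simp add: petersson_altdef D_def)
  qed
  \<comment> \<open>Pointwise, the product of two absolute values is at most the sum of their
    squares, so the diagonal integrands dominate.\<close>
  have offdiag: "set_integrable hyperbolic_measure D (pet_integrand k \<psi> \<phi>)" if "\<psi> \<in> B l" "\<phi> \<in> B l" for \<psi> \<phi>
    unfolding set_integrable_def
  proof (rule Bochner_Integration.integrable_bound)
    note [measurable] = borel_measurable_cusp_form[OF BA[OF that(1)]] borel_measurable_cusp_form[OF BA[OF that(2)]]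
    show "integrable hyperbolic_measure (\<lambda>z. indicator D z *\<^sub>R pet_integrand k \<psi> \<psi> z + indicator D z *\<^sub>R pet_integrand k \<phi> \<phi> z)"
      using diag[OF that(1)] diag[OF that(2)] unfolding set_integrable_def by (rule Bochner_Integration.integrable_add)
    show "(\<lambda>z. indicator D z *\<^sub>R pet_integrand k \<psi> \<phi> z) \<in> borel_measurable hyperbolic_measure"
      by measurable
    show "AE z in hyperbolic_measure. norm (indicator D z *\<^sub>R pet_integrand k \<psi> \<phi> z) \<le>
        norm (indicator D z *\<^sub>R pet_integrand k \<psi> \<psi> z + indicator D z *\<^sub>R pet_integrand k \<phi> \<phi> z)"
    proof (rule AE_I2)
      fix z
      show "norm (indicator D z *\<^sub>R pet_integrand k \<psi> \<phi> z) \<le>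
        norm (indicator D z *\<^sub>R pet_integrand k \<psi> \<psi> z + indicator D z *\<^sub>R pet_integrand k \<phi> \<phi> z)"
      proof (cases "z \<in> D")
        case True
        define a b y where "a = cmod (\<psi> z)" and "b = cmod (\<phi> z)" and "y = Im z ^ k"
        have "y \<ge> 0" using DH[OF True] by (simp add: y_def)
        have "pet_integrand k \<psi> \<psi> z + pet_integrand k \<phi> \<phi> z = of_real ((a\<^sup>2 + b\<^sup>2) * y)"
          using complex_norm_square[of "\<psi> z"] complex_norm_square[of "\<phi> z"]
          by (simp add: pet_integrand_def a_def b_def y_def algebra_simps)
        then have "norm (pet_integrand k \<psi> \<psi> z + pet_integrand k \<phi> \<phi> z) = \<bar>(a\<^sup>2 + b\<^sup>2) * y\<bar>"
          by (simp only: norm_of_real)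
        also have "\<dots> = (a\<^sup>2 + b\<^sup>2) * y"
          using \<open>y \<ge> 0\<close> by (intro abs_of_nonneg mult_nonneg_nonneg) auto
        finally have 1: "norm (pet_integrand k \<psi> \<psi> z + pet_integrand k \<phi> \<phi> z) = (a\<^sup>2 + b\<^sup>2) * y" .
        have 2: "norm (pet_integrand k \<psi> \<phi> z) = a * b * y"
          using \<open>y \<ge> 0\<close> DH[OF True] by (simp add: pet_integrand_def a_def b_def y_def norm_mult norm_power)
        have "0 \<le> a * b" by (simp add: a_def b_def)
        then have "a * b \<le> a\<^sup>2 + b\<^sup>2" using sum_squares_bound[of a b] by linarith
        then have "a * b * y \<le> (a\<^sup>2 + b\<^sup>2) * y" using \<open>y \<ge> 0\<close> by (rule mult_right_mono)
        then show ?thesis using True 1 2 by (simp only: indicator_simps scaleR_one)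
      qed simp
    qed
  qed
  obtain c where c: "f = (\<lambda>z. \<Sum>\<psi>\<in>B l. c \<psi> * \<psi> z)" using basis_expansion[OF B(1)] f B(2) by blast
  obtain c' where c': "g = (\<lambda>z. \<Sum>\<psi>\<in>B l. c' \<psi> * \<psi> z)" using basis_expansion[OF B(1)] g B(2) by blast
  have eq: "pet_integrand k f g z = (\<Sum>\<psi>\<in>B l. \<Sum>\<phi>\<in>B l. c \<psi> * cnj (c' \<phi>) * pet_integrand k \<psi> \<phi> z)" for z
  proof -
    have "pet_integrand k f g z = (\<Sum>\<psi>\<in>B l. c \<psi> * \<psi> z) * (\<Sum>\<phi>\<in>B l. cnj (c' \<phi>) * cnj (\<phi> z)) * of_real (Im z ^ k)"
      by (simp add: c c' pet_integrand_def)
    also have "\<dots> = (\<Sum>\<psi>\<in>B l. \<Sum>\<phi>\<in>B l. c \<psi> * \<psi> z * (cnj (c' \<phi>) * cnj (\<phi> z)) * of_real (Im z ^ k))"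
      by (simp only: sum_product, simp only: sum_distrib_right)
    also have "\<dots> = (\<Sum>\<psi>\<in>B l. \<Sum>\<phi>\<in>B l. c \<psi> * cnj (c' \<phi>) * pet_integrand k \<psi> \<phi> z)"
      by (intro sum.cong refl) (simp add: pet_integrand_def)
    finally show ?thesis .
  qed
  have "set_integrable hyperbolic_measure D (\<lambda>z. \<Sum>\<psi>\<in>B l. \<Sum>\<phi>\<in>B l. c \<psi> * cnj (c' \<phi>) * pet_integrand k \<psi> \<phi> z)"
    unfolding set_integrable_def scaleR_sum_right
    by (intro Bochner_Integration.integrable_sum set_integrable_mult_right[unfolded set_integrable_def]
          offdiag[unfolded set_integrable_def])
  then show ?thesis by (simp add: eq[abs_def] D_def)
qed

lemma petersson_sum_left:
  assumes l: "l > 0" and g: "g \<in> cusp_forms k l" and I: "\<And>i. i \<in> I \<Longrightarrow> f i \<in> cusp_forms k l"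
  shows "petersson V k l (\<lambda>z. \<Sum>i\<in>I. c i * f i z) g = (\<Sum>i\<in>I. c i * petersson V k l (f i) g)"
proof -
  have "(LINT z:fund_domain l|hyperbolic_measure. pet_integrand k (\<lambda>z. \<Sum>i\<in>I. c i * f i z) g z) =
      (LINT z|hyperbolic_measure. (\<Sum>i\<in>I. c i * (indicator (fund_domain l) z *\<^sub>R pet_integrand k (f i) g z)))"
    unfolding set_lebesgue_integral_def
    by (intro Bochner_Integration.integral_cong refl) (simp add: pet_integrand_def sum_distrib_right sum_distrib_left scaleR_conv_of_real mult_ac)
  also have "\<dots> = (\<Sum>i\<in>I. LINT z|hyperbolic_measure. c i * (indicator (fund_domain l) z *\<^sub>R pet_integrand k (f i) g z))"
    by (rule Bochner_Integration.integral_sum)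
       (intro Bochner_Integration.integrable_mult_right set_integrable_pet_integrand[OF l I g, unfolded set_integrable_def])
  also have "\<dots> = (\<Sum>i\<in>I. c i * (LINT z:fund_domain l|hyperbolic_measure. pet_integrand k (f i) g z))"
    unfolding set_lebesgue_integral_def by (intro sum.cong refl integral_mult_right_zero)
  finally show ?thesis
    by (simp add: petersson_altdef sum_distrib_left mult_ac)
qed

lemma petersson_lower_trace:
  assumes "e dvd l" "l > 0" "e > 0" and f: "f \<in> cusp_forms k (l * e)" and g: "g \<in> cusp_forms k l"
  shows "petersson V k (l * e) f g = petersson V k l (lower_trace k l e f) g"
proof -
  note R = right_transversal_lower[OF assms(1-3)]
  note DK = is_fundamental_domain_fund_domain[of "l * e"]
  have g': "g \<in> cusp_forms k (l * e)" using g cusp_forms_mono[of l "l * e" k] by auto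
  have "(LINT z:fund_domain (l * e)|hyperbolic_measure. pet_integrand k f g z) =
    (LINT z:fund_domain l|hyperbolic_measure. pet_integrand k (slash_sum k (lower_reps l e) f) g z)"
    by (rule set_integral_pet_unfold[OF modular_subgroup_Gamma0 R DK borel_measurable_cusp_form[OF f] g])
       (use slash_cusp_form[OF f] set_integrable_pet_integrand[OF _ f g'] assms in auto)
  moreover have "measure hyperbolic_measure (fund_domain (l * e)) = real e * measure hyperbolic_measure (fund_domain l)"
    using measure_fundamental_domain_unfold[OF modular_subgroup_Gamma0 R DK] card_lower_reps[of l e] assms(2) by simp
  moreover have "pet_integrand k (lower_trace k l e f) g z =
      1 / of_nat e * pet_integrand k (slash_sum k (lower_reps l e) f) g z" for z
    by (simp add: pet_integrand_def lower_trace_def)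
  ultimately show ?thesis
    by (simp add: petersson_altdef set_lebesgue_integral_def)
qed

text \<open>The substitution of \<open>d z\<close> preserves the hyperbolic measure and carries the
  domain of level \<open>l * d\<close> to a fundamental domain of \<open>Gamma0_upper l d\<close>,
  on which \<open>g\<close> appears undilated. Unfolding from there to level \<open>l\<close> gives
  the trace.\<close>

lemma petersson_upper_trace:
  assumes "d dvd l" "l > 0" "d > 0" and f: "f \<in> cusp_forms k (l * d)" and g: "g \<in> cusp_forms k l"
  shows "petersson V k (l * d) f (raise_level k d g) = petersson V k l (upper_trace k d f) g"
proof -
  define c where "c = complex_of_real (real d powr (real k / 2))"
  define h where "h = slash k (mat2 1 0 0 (int d)) f"
  define \<delta> where "\<delta> = (\<lambda>z::complex. of_nat d * z)"
  define D where "D = fund_domain (l * d)"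
  note R = right_transversal_upper[OF assms(1,3)]
  have DF: "is_fundamental_domain (Gamma0 (l * d)) D"
    unfolding D_def by (rule is_fundamental_domain_fund_domain)
  have DK: "is_fundamental_domain (Gamma0_upper l d) (\<delta> ` D)"
    unfolding \<delta>_def by (rule is_fundamental_domain_dilate[OF DF assms(3)])
  note [measurable] = borel_measurable_cusp_form[OF f] borel_measurable_cusp_form[OF g]
  have h [measurable]: "h \<in> borel_measurable borel" unfolding h_def by measurable
  have \<delta>: "hyp_preserving \<delta>"
    using hyp_preserving_affine[of "real d" 0] assms(3) by (simp add: \<delta>_def)
  have D_eq: "{z \<in> \<H>. \<delta> z \<in> \<delta> ` D} = D"
    using is_fundamental_domainD(2)[OF DF] assms(3) by (auto simp: \<delta>_def)
  \<comment> \<open>The powers of \<open>d\<close> cancel: \<open>f z\<close> is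
    \<open>d ^ k * h (d z)\<close>, and \<open>Im z ^ k\<close> is
    \<open>Im (d z) ^ k / d ^ k\<close>. Only the constant of \<open>raise_level\<close>
    remains.\<close>
  have eq: "pet_integrand k f (raise_level k d g) z = c * pet_integrand k h g (\<delta> z)" for z
    using assms(3) by (simp add: pet_integrand_def h_def \<delta>_def c_def slash_def moebius_def aut_factor_def raise_level_def power_mult_distrib)
  have rg: "raise_level k d g \<in> cusp_forms k (l * d)" by (rule raise_level_cusp_form[OF g assms(3)])
  have cnz: "c \<noteq> 0" using assms(3) by (simp add: c_def)
  have "set_integrable hyperbolic_measure D (\<lambda>z. c * pet_integrand k h g (\<delta> z))"
    using set_integrable_pet_integrand[OF _ f rg] assms by (simp add: D_def eq[abs_def])
  then have "set_integrable hyperbolic_measure D (\<lambda>z. pet_integrand k h g (\<delta> z))"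
    using cnz by simp
  then have int: "set_integrable hyperbolic_measure (\<delta> ` D) (pet_integrand k h g)"
    using set_integral_hyp_preserving(2)[OF \<delta> is_fundamental_domainD(1,2)[OF DK], of "pet_integrand k h g"]
    by (simp add: D_eq)
  have "(LINT z:D|hyperbolic_measure. pet_integrand k f (raise_level k d g) z) =
      c * (LINT z:D|hyperbolic_measure. pet_integrand k h g (\<delta> z))"
    by (simp add: eq[abs_def] set_lebesgue_integral_def)
  also have "(LINT z:D|hyperbolic_measure. pet_integrand k h g (\<delta> z)) =
      (LINT z:\<delta> ` D|hyperbolic_measure. pet_integrand k h g z)"
    using set_integral_hyp_preserving(1)[OF \<delta> is_fundamental_domainD(1,2)[OF DK], of "pet_integrand k h g"]
    by (simp add: D_eq)
  also have "\<dots> = (LINT z:fund_domain l|hyperbolic_measure. pet_integrand k (slash_sum k (upper_reps d) h) g z)"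
    by (rule set_integral_pet_unfold[OF modular_subgroup_Gamma0_upper R DK h g _ int])
       (use slash_dilate_invariant[OF f assms(3)] in \<open>simp add: h_def\<close>)
  finally have 1: "(LINT z:D|hyperbolic_measure. pet_integrand k f (raise_level k d g) z) = c * \<dots>" .
  have "measure hyperbolic_measure D = measure hyperbolic_measure (\<delta> ` D)"
    using emeasure_hyp_preserving[OF \<delta> is_fundamental_domainD(1,2)[OF DK]] by (simp add: D_eq measure_def)
  also have "\<dots> = real d * measure hyperbolic_measure (fund_domain l)"
    using measure_fundamental_domain_unfold[OF modular_subgroup_Gamma0_upper R DK] by (simp add: card_upper_reps)
  finally have 2: "measure hyperbolic_measure D = \<dots>" .
  have "pet_integrand k (upper_trace k d f) g z = c / of_nat d * pet_integrand k (slash_sum k (upper_reps d) h) g z" for z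
    by (simp add: pet_integrand_def upper_trace_def h_def c_def)
  then show ?thesis
    using 1 2 by (simp add: petersson_altdef D_def set_lebesgue_integral_def)
qed

end

lemma petersson_commute: "petersson V k l g f = cnj (petersson V k l f g)"
proof -
  have "(LINT z:fund_domain l|hyperbolic_measure. pet_integrand k g f z) =
      (LINT z|hyperbolic_measure. cnj (indicator (fund_domain l) z *\<^sub>R pet_integrand k f g z))"
    unfolding set_lebesgue_integral_def
    by (intro Bochner_Integration.integral_cong refl) (simp add: pet_integrand_def mult_ac)
  also have "\<dots> = cnj (LINT z:fund_domain l|hyperbolic_measure. pet_integrand k f g z)"
    unfolding set_lebesgue_integral_def by (rule Bochner_Integration.integral_cnj)
  finally show ?thesis by (simp add: petersson_altdef)
qed

section \<open>Fourier coefficients\<close>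

lemma fourier_exp: "exp (2 * complex_of_real pi * \<i> * of_nat n * z) = exp (2 * complex_of_real pi * \<i> * z) ^ n"
  by (simp add: exp_of_nat_mult[symmetric] mult_ac)

text \<open>A right inverse of the local parameter at the cusp infinity, by the principal branch;
  its jump along the negative axis is an integer and invisible to forms of period 1.\<close>

definition cusp_log :: "complex \<Rightarrow> complex" where
  "cusp_log w = Ln w / (2 * complex_of_real pi * \<i>)"

lemma exp_cusp_log: "w \<noteq> 0 \<Longrightarrow> exp (2 * complex_of_real pi * \<i> * cusp_log w) = w"
  by (simp add: cusp_log_def)

lemma Im_cusp_log: "w \<noteq> 0 \<Longrightarrow> Im (cusp_log w) = - ln (cmod w) / (2 * pi)"
  by (simp add: cusp_log_def Im_divide power2_eq_square)

lemma cusp_log_uhp: "w \<noteq> 0 \<Longrightarrow> cmod w < 1 \<Longrightarrow> cusp_log w \<in> \<H>"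
  by (simp add: uhp_iff Im_cusp_log divide_neg_pos)

lemma norm_exp_uhp: "z \<in> \<H> \<Longrightarrow> cmod (exp (2 * complex_of_real pi * \<i> * z)) < 1"
  by (simp add: norm_exp_eq_Re uhp_iff)

text \<open>In the variable \<open>w = exp (2 pi i z)\<close> the difference of the two expansions
  is a power series vanishing on the unit disc, whereas one with a nonzero coefficient has no zeros
  in a small punctured disc.\<close>

lemma fourier_series_unique:
  fixes a b :: "nat \<Rightarrow> complex"
  assumes a: "\<And>z. z \<in> \<H> \<Longrightarrow>
      ((\<lambda>n. a n * exp (2 * complex_of_real pi * \<i> * of_nat n * z)) has_sum f z) {1..}"
    and b: "\<And>z. z \<in> \<H> \<Longrightarrow>
      ((\<lambda>n. b n * exp (2 * complex_of_real pi * \<i> * of_nat n * z)) has_sum f z) {1..}"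
    and "n \<ge> 1"
  shows "a n = b n"
proof (rule ccontr)
  assume "a n \<noteq> b n"
  \<comment> \<open>The sums start at 1; setting the constant term to 0 makes the series vanish at
    \<open>w = 0\<close> as well.\<close>
  define c where "c m = (if m = 0 then 0 else a m - b m)" for m
  have sums: "(\<lambda>m. c m * w ^ m) sums 0" if "cmod w < 1" for w
  proof (cases "w = 0")
    case True
    then have "(\<lambda>m. c m * w ^ m) = (\<lambda>m. 0)" by (auto simp: c_def fun_eq_iff)
    then show ?thesis by simp
  next
    case False
    have "((\<lambda>m. a m * w ^ m + - 1 * (b m * w ^ m)) has_sum (f (cusp_log w) + - 1 * f (cusp_log w))) {1..}"
      using a[OF cusp_log_uhp[OF False that]] b[OF cusp_log_uhp[OF False that]]
      unfolding fourier_exp exp_cusp_log[OF False] by (intro has_sum_add has_sum_cmult_right)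
    also have "?this \<longleftrightarrow> ((\<lambda>m. c m * w ^ m) has_sum (f (cusp_log w) + - 1 * f (cusp_log w))) {1..}"
      by (rule has_sum_cong) (simp add: c_def algebra_simps)
    finally have "((\<lambda>m. c m * w ^ m) has_sum 0) {1..}"
      by simp
    also have "?this \<longleftrightarrow> ((\<lambda>m. c m * w ^ m) has_sum 0) UNIV"
      by (rule has_sum_cong_neutral) (auto simp: c_def)
    finally show ?thesis by (rule has_sum_imp_sums)
  qed
  obtain s where s: "0 < s" "\<And>z::complex. z \<in> cball 0 s - {0} \<Longrightarrow> (\<lambda>_. 0::complex) z \<noteq> 0"
    by (rule powser_0_nonzero[of 1 0 c "\<lambda>_. 0" n]) (use sums \<open>a n \<noteq> b n\<close> \<open>n \<ge> 1\<close> in \<open>auto simp: c_def\<close>)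
  have "complex_of_real s \<in> cball 0 s - {0}" using s(1) by simp
  then show False using s(2) by blast
qed

lemma cusp_form_periodic:
  assumes f: "f \<in> cusp_forms k l" and z: "z \<in> \<H>"
  shows "f (z + of_int n) = f z"
proof -
  have "mat2 1 n 0 1 \<in> Gamma0 l" by (simp add: Gamma0_def SL2Z_def)
  from cusp_formsD(2)[OF f this z] show ?thesis by (simp add: moebius_def aut_factor_def)
qed

lemma cusp_form_eq_if_exp_eq:
  assumes f: "f \<in> cusp_forms k l" and z: "z \<in> \<H>"
    and "exp (2 * complex_of_real pi * \<i> * w) = exp (2 * complex_of_real pi * \<i> * z)"
  shows "f w = f z"
proof -
  obtain n :: int where "2 * complex_of_real pi * \<i> * w = 2 * complex_of_real pi * \<i> * z + (of_int (2 * n) * pi) * \<i>"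
    using assms(3) by (auto simp: exp_eq)
  also have "\<dots> = 2 * complex_of_real pi * \<i> * (z + of_int n)" by (simp add: algebra_simps)
  finally have "w = z + of_int n" by simp
  then show ?thesis using cusp_form_periodic[OF f z] by simp
qed

text \<open>By periodicity the form descends to the punctured unit disc. Vanishing at the cusp
  infinity gives the limit 0 at the centre, so the singularity is removable and the Taylor series
  has no constant term.\<close>

lemma cusp_form_power_series:
  assumes f: "f \<in> cusp_forms k l"
  obtains c where "\<And>z. z \<in> \<H> \<Longrightarrow>
      ((\<lambda>n. c n * exp (2 * complex_of_real pi * \<i> * of_nat n * z)) has_sum f z) {1..}"
proof -
  define g where "g = (\<lambda>w. f (cusp_log w))"
  have "g field_differentiable (at w\<^sub>0)" if w0: "w\<^sub>0 \<in> ball 0 1 - {0}" for w\<^sub>0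
  proof -
    \<comment> \<open>A branch of the logarithm that is holomorphic near \<open>w\<^sub>0\<close>,
      including points on the cut of \<open>Ln\<close>: there \<open>w / w\<^sub>0\<close> is close
      to 1. By periodicity \<open>f\<close> does not distinguish it from
      \<open>cusp_log\<close>.\<close>
    define L where "L = (\<lambda>w. (Ln (w / w\<^sub>0) + Ln w\<^sub>0) / (2 * complex_of_real pi * \<i>))"
    have exp_L: "exp (2 * complex_of_real pi * \<i> * L w) = w" if "w \<noteq> 0" for w
      using that w0 by (simp add: L_def exp_add)
    define S where "S = (ball 0 1 - {0}) \<inter> ball w\<^sub>0 (cmod w\<^sub>0)"
    have S: "open S" "w\<^sub>0 \<in> S" using w0 by (auto simp: S_def open_Diff)
    have eq: "f (L w) = g w" if "w \<in> S" for w
      unfolding g_def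
      by (rule cusp_form_eq_if_exp_eq[OF f])
         (use that in \<open>auto simp: S_def exp_L exp_cusp_log intro: cusp_log_uhp\<close>)
    have "L w\<^sub>0 = cusp_log w\<^sub>0" using w0 by (simp add: L_def cusp_log_def)
    then have uhp: "L w\<^sub>0 \<in> \<H>" using w0 cusp_log_uhp by auto
    have "L field_differentiable (at w\<^sub>0)"
      unfolding L_def using w0
      by (intro field_differentiable_divide field_differentiable_add field_differentiable_const
            field_differentiable_compose[of "\<lambda>w. w / w\<^sub>0" _ Ln, unfolded o_def]
            field_differentiable_ident field_differentiable_at_Ln) auto
    moreover have "f field_differentiable (at (L w\<^sub>0))"
      using cusp_formsD(1)[OF f] uhp open_uhp holomorphic_on_imp_differentiable_at by blast
    ultimately have "(f \<circ> L) field_differentiable (at w\<^sub>0)"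
      by (rule field_differentiable_compose)
    then obtain D where "((f \<circ> L) has_field_derivative D) (at w\<^sub>0)"
      unfolding field_differentiable_def by blast
    then have "(g has_field_derivative D) (at w\<^sub>0)"
      by (rule has_field_derivative_transform_within_open[OF _ S]) (simp add: eq)
    then show ?thesis unfolding field_differentiable_def by blast
  qed
  then have holo: "g holomorphic_on ball 0 1 - {0}"
    unfolding holomorphic_on_def using field_differentiable_at_within by blast
  have "(f \<longlongrightarrow> 0) (filtercomap Im at_top)"
    using cusp_formsD(3)[OF f, of "mat 1"] by (simp add: SL2Z_def)
  moreover have "filterlim cusp_log (filtercomap Im at_top) (at 0)"
  proof -
    have "filterlim (\<lambda>w. - ln (cmod w)) at_top (at (0::complex))"
    proof (rule filterlim_compose[of "\<lambda>x. - ln x" _ "at_right 0"])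
      show "filterlim (\<lambda>x::real. - ln x) at_top (at_right 0)"
        using ln_at_0 by (simp add: filterlim_uminus_at_top)
      have "filterlim cmod (nhds 0) (at 0)"
        using tendsto_norm[OF tendsto_ident_at[of "0::complex" UNIV]] by simp
      then show "filterlim cmod (at_right 0) (at (0::complex))"
        by (auto simp: filterlim_at eventually_at_filter)
    qed
    then have "filterlim (\<lambda>w. 1 / (2 * pi) * - ln (cmod w)) at_top (at (0::complex))"
      by (intro filterlim_tendsto_pos_mult_at_top[OF tendsto_const]) auto
    moreover have "eventually (\<lambda>w. Im (cusp_log w) = 1 / (2 * pi) * - ln (cmod w)) (at 0)"
      unfolding eventually_at_filter by (rule always_eventually) (simp add: Im_cusp_log)
    ultimately have "filterlim (\<lambda>w. Im (cusp_log w)) at_top (at 0)"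
      by (subst filterlim_cong[OF refl refl]) auto
    then show ?thesis by (simp add: filterlim_filtercomap_iff o_def)
  qed
  ultimately have lim: "g \<midarrow>0\<rightarrow> 0"
    unfolding g_def by (rule filterlim_compose)
  define h where "h = (\<lambda>w. if w = 0 then 0 else g w)"
  have h: "h holomorphic_on ball 0 1"
    unfolding h_def by (rule removable_singularity[OF holo _ lim]) simp
  define c where "c n = (deriv ^^ n) h 0 / fact n" for n
  have sums: "(\<lambda>n. c n * w ^ n) sums h w" if "cmod w < 1" for w
    using holomorphic_power_series[OF h, of w] that by (simp add: c_def)
  have "c 0 = 0" by (simp add: c_def h_def)
  show ?thesis
  proof (rule that[of c])
    fix z assume z: "z \<in> \<H>"
    define w where "w = exp (2 * complex_of_real pi * \<i> * z)"
    have w: "cmod w < 1" "w \<noteq> 0" using norm_exp_uhp[OF z] by (simp_all add: w_def)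
    have "h w = f z"
      unfolding h_def g_def using w(2) by (simp, intro cusp_form_eq_if_exp_eq[OF f z]) (simp add: exp_cusp_log, simp add: w_def)
    \<comment> \<open>A point strictly between \<open>w\<close> and the unit circle: convergence
      there makes the series at \<open>w\<close> absolutely summable, as \<open>has_sum\<close>
      demands.\<close>
    define v where "v = complex_of_real ((1 + cmod w) / 2)"
    have v: "cmod v < 1" "cmod w < cmod v"
      using w(1) unfolding v_def by (simp_all only: norm_of_real) (simp_all add: abs_of_nonneg add_nonneg_nonneg)
    have "summable (\<lambda>n. c n * v ^ n)" using sums[OF v(1)] by (rule sums_summable)
    then have "summable (\<lambda>n. norm (c n * w ^ n))" using v(2) by (rule powser_insidea)
    then have "((\<lambda>n. c n * w ^ n) has_sum f z) UNIV"
      using sums[OF w(1)] \<open>h w = f z\<close> by (intro norm_summable_imp_has_sum) simp_all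
    also have "?this \<longleftrightarrow> ((\<lambda>n. c n * w ^ n) has_sum f z) {1..}"
      by (rule has_sum_cong_neutral) (auto simp: \<open>c 0 = 0\<close> not_less_eq_eq Suc_le_eq)
    finally show "((\<lambda>n. c n * exp (2 * complex_of_real pi * \<i> * of_nat n * z)) has_sum f z) {1..}"
      unfolding fourier_exp w_def .
  qed
qed

lemma fourier_coeff_has_sum:
  assumes f: "f \<in> cusp_forms k l" and "z \<in> \<H>"
  shows "((\<lambda>n. complex_of_real (real n powr (real k / 2)) * fourier_coeff k f n *
      exp (2 * complex_of_real pi * \<i> * of_nat n * z)) has_sum f z) {1..}"
proof -
  obtain c where c: "\<And>z. z \<in> \<H> \<Longrightarrow>
      ((\<lambda>n. c n * exp (2 * complex_of_real pi * \<i> * of_nat n * z)) has_sum f z) {1..}"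
    using cusp_form_power_series[OF f] by blast
  define r where "r n = c n / complex_of_real (real n powr (real k / 2))" for n
  have "\<forall>z\<in>\<H>. ((\<lambda>n. complex_of_real (real n powr (real k / 2)) * r n *
      exp (2 * complex_of_real pi * \<i> * of_nat n * z)) has_sum f z) {1..}"
  proof
    fix z assume z: "z \<in> \<H>"
    have "((\<lambda>n. complex_of_real (real n powr (real k / 2)) * r n *
      exp (2 * complex_of_real pi * \<i> * of_nat n * z)) has_sum f z) {1..} \<longleftrightarrow>
      ((\<lambda>n. c n * exp (2 * complex_of_real pi * \<i> * of_nat n * z)) has_sum f z) {1..}"
      by (rule has_sum_cong) (simp add: r_def)
    then show "((\<lambda>n. complex_of_real (real n powr (real k / 2)) * r n *
      exp (2 * complex_of_real pi * \<i> * of_nat n * z)) has_sum f z) {1..}"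
      using c[OF z] by simp
  qed
  from someI[of "\<lambda>r. \<forall>z\<in>\<H>. ((\<lambda>n. complex_of_real (real n powr (real k / 2)) * r n *
      exp (2 * complex_of_real pi * \<i> * of_nat n * z)) has_sum f z) {1..}", OF this]
  show ?thesis unfolding fourier_coeff_def[symmetric] using assms(2) by blast
qed

lemma fourier_coeff_unique:
  assumes f: "f \<in> cusp_forms k l" and n: "n > 0"
    and r: "\<And>z. z \<in> \<H> \<Longrightarrow> ((\<lambda>n. complex_of_real (real n powr (real k / 2)) * r n *
      exp (2 * complex_of_real pi * \<i> * of_nat n * z)) has_sum f z) {1..}"
  shows "fourier_coeff k f n = r n"
proof -
  have "complex_of_real (real n powr (real k / 2)) * fourier_coeff k f n = complex_of_real (real n powr (real k / 2)) * r n"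
    by (rule fourier_series_unique[OF fourier_coeff_has_sum[OF f] r]) (use n in auto)
  then show ?thesis using n by simp
qed

lemma has_sum_finite_family:
  fixes g :: "'i \<Rightarrow> 'a \<Rightarrow> complex"
  assumes "\<And>i. i \<in> I \<Longrightarrow> (g i has_sum s i) A"
  shows "((\<lambda>x. \<Sum>i\<in>I. g i x) has_sum (\<Sum>i\<in>I. s i)) A"
  using assms by (induction I rule: infinite_finite_induct) (auto intro!: has_sum_add)

lemma fourier_coeff_sum:
  assumes "finite I" and f: "\<And>i. i \<in> I \<Longrightarrow> f i \<in> cusp_forms k l" and n: "n > 0"
  shows "fourier_coeff k (\<lambda>z. \<Sum>i\<in>I. c i * f i z) n = (\<Sum>i\<in>I. c i * fourier_coeff k (f i) n)"
proof (rule fourier_coeff_unique[OF _ n])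
  show "(\<lambda>z. \<Sum>i\<in>I. c i * f i z) \<in> cusp_forms k l"
    by (intro cusp_forms_sum cusp_forms_scale f)
  fix z assume z: "z \<in> \<H>"
  have "((\<lambda>n. \<Sum>i\<in>I. c i * (complex_of_real (real n powr (real k / 2)) * fourier_coeff k (f i) n *
      exp (2 * complex_of_real pi * \<i> * of_nat n * z))) has_sum (\<Sum>i\<in>I. c i * f i z)) {1..}"
    by (intro has_sum_finite_family has_sum_cmult_right fourier_coeff_has_sum[OF f z])
  then show "((\<lambda>n. complex_of_real (real n powr (real k / 2)) * (\<Sum>i\<in>I. c i * fourier_coeff k (f i) n) *
      exp (2 * complex_of_real pi * \<i> * of_nat n * z)) has_sum (\<Sum>i\<in>I. c i * f i z)) {1..}"
    by (simp add: sum_distrib_left sum_distrib_right mult_ac)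
qed

text \<open>The factor \<open>d powr (k / 2)\<close> of the dilation turns the normalising power of
  \<open>n\<close> into that of \<open>n * d\<close>. This is why no power of \<open>d\<close>
  appears in the final formula.\<close>

lemma fourier_coeff_raise_level:
  assumes f: "f \<in> cusp_forms k l" and d: "d > 0" and n: "n > 0"
  shows "fourier_coeff k (raise_level k d f) n = (if d dvd n then fourier_coeff k f (n div d) else 0)"
proof (rule fourier_coeff_unique[OF raise_level_cusp_form[OF f d] n])
  fix z assume z: "z \<in> \<H>"
  define r where "r n = (if d dvd n then fourier_coeff k f (n div d) else 0)" for n
  define F where "F n = complex_of_real (real n powr (real k / 2)) * r n *
    exp (2 * complex_of_real pi * \<i> * of_nat n * z)" for n
  have "of_nat d * z \<in> \<H>" using z d by (simp add: uhp_iff)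
  from has_sum_cmult_right[OF fourier_coeff_has_sum[OF f this], of "complex_of_real (real d powr (real k / 2))"]
  have "((\<lambda>n. F (n * d)) has_sum raise_level k d f z) {1..}"
    using d by (simp add: raise_level_def F_def r_def powr_mult mult_ac)
  then have "(F has_sum raise_level k d f z) ((\<lambda>n. n * d) ` {1..})"
    using d by (subst has_sum_reindex) (auto simp: inj_on_def o_def)
  also have "?this \<longleftrightarrow> (F has_sum raise_level k d f z) {1..}"
  proof (rule has_sum_cong_neutral)
    fix n assume "n \<in> {1..} - (\<lambda>n. n * d) ` {1..}"
    then have "\<not> d dvd n" by (force elim: dvdE simp: mult.commute)
    then show "F n = 0" by (simp add: F_def r_def)
  next
    fix n assume "n \<in> (\<lambda>n. n * d) ` {1..} - {1..}"
    then show "F n = 0" using d by (auto simp: Suc_le_eq)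
  qed simp
  finally show "((\<lambda>n. complex_of_real (real n powr (real k / 2)) * (if d dvd n then fourier_coeff k f (n div d) else 0) *
      exp (2 * complex_of_real pi * \<i> * of_nat n * z)) has_sum raise_level k d f z) {1..}"
    unfolding F_def r_def .
qed

section \<open>Averaging operators\<close>

lemma sum_residues_shift:
  fixes h :: "real \<Rightarrow> complex"
  assumes per: "\<And>x. h (x + 1) = h x" and e: "e > 0"
  shows "(\<Sum>j<e. h (y + (real j + real m) / real e)) = (\<Sum>j<e. h (y + real j / real e))"
proof (induction m)
  case (Suc m)
  define g where "g j = h (y + (real j + real m) / real e)" for j
  have "y + (real e + real m) / real e = (y + (real 0 + real m) / real e) + 1"
    using e by (simp add: field_simps)
  then have "g e = g 0" using per by (simp only: g_def)
  have "g 0 + (\<Sum>j<e. g (Suc j)) = (\<Sum>j<e. g j) + g e"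
    by (simp only: sum.lessThan_Suc_shift[symmetric] sum.lessThan_Suc)
  then have "(\<Sum>j<e. g (Suc j)) = (\<Sum>j<e. g j)"
    unfolding \<open>g e = g 0\<close> by simp
  then show ?case using Suc by (simp add: g_def add_ac)
qed simp

lemma bij_betw_mult_mod:
  fixes p e :: nat
  assumes "coprime p e" "p > 0"
  shows "bij_betw (\<lambda>i. (i * e) mod p) {..<p} {..<p}"
proof -
  have "inj_on (\<lambda>i. (i * e) mod p) {..<p}"
  proof (rule inj_onI)
    fix i j assume ij: "i \<in> {..<p}" "j \<in> {..<p}" "(i * e) mod p = (j * e) mod p"
    have "int (i * e) mod int p = int (j * e) mod int p"
      using ij(3) by (metis zmod_int)
    then have "int p dvd (int i - int j) * int e"
      by (simp add: mod_eq_dvd_iff left_diff_distrib)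
    then have "int p dvd int i - int j"
      using assms(1) by (simp add: coprime_dvd_mult_left_iff)
    then have "int i mod int p = int j mod int p" by (simp add: mod_eq_dvd_iff)
    then show "i = j" using ij(1,2) by simp
  qed
  moreover have "(\<lambda>i. (i * e) mod p) ` {..<p} \<subseteq> {..<p}" using assms(2) by auto
  ultimately show ?thesis by (simp add: bij_betw_def endo_inj_surj)
qed

text \<open>Chinese remaindering modulo 1: for coprime \<open>p\<close> and \<open>e\<close> the
  sums \<open>i / p + j / e\<close> run through all fractions with denominator \<open>p e\<close>
  exactly once.\<close>

lemma sum_residues_coprime:
  fixes h :: "real \<Rightarrow> complex"
  assumes per: "\<And>x. h (x + 1) = h x" and e: "e > 0" and p: "p > 0" and cop: "coprime p e"
  shows "(\<Sum>i<p. \<Sum>j<e. h (real i / real p + real j / real e)) = (\<Sum>l<e * p. h (real l / real (p * e)))"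
proof -
  \<comment> \<open>Raising \<open>t\<close> by \<open>p\<close> shifts the argument by
    \<open>1 / e\<close>, which only permutes the residues \<open>j / e\<close>. So \<open>H\<close>
    has period \<open>p\<close>, and \<open>i * e\<close> may be replaced by \<open>i\<close> in a
    sum over all residues modulo \<open>p\<close>.\<close>
  define H where "H t = (\<Sum>j<e. h (real t / real (p * e) + real j / real e))" for t :: nat
  have H1: "H (t + p * n) = H t" for t n
  proof -
    have "real (t + p * n) / real (p * e) + real j / real e = real t / real (p * e) + (real j + real n) / real e" for j
      using e p by (simp add: field_simps)
    then show ?thesis using sum_residues_shift[of h e "real t / real (p * e)" n, OF per e] by (simp add: H_def)
  qed
  have H2: "H (t mod p) = H t" for t
    using H1[of "t mod p" "t div p"] by simp
  have "(\<Sum>i<p. \<Sum>j<e. h (real i / real p + real j / real e)) = (\<Sum>i<p. H ((i * e) mod p))"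
  proof (rule sum.cong[OF refl])
    fix i
    have "H ((i * e) mod p) = H (i * e)" by (rule H2)
    also have "\<dots> = (\<Sum>j<e. h (real i / real p + real j / real e))"
      unfolding H_def using e by (intro sum.cong refl) simp
    finally show "(\<Sum>j<e. h (real i / real p + real j / real e)) = H ((i * e) mod p)" ..
  qed
  also have "\<dots> = (\<Sum>i<p. H i)"
    by (rule sum.reindex_bij_betw[OF bij_betw_mult_mod[OF cop p]])
  also have "\<dots> = (\<Sum>j<e. \<Sum>i<p. h (real (j * p + i) / real (p * e)))"
    unfolding H_def using e p by (subst sum.swap) (intro sum.cong refl arg_cong[of _ _ h], simp add: field_simps)
  also have "\<dots> = (\<Sum>j<e. sum (\<lambda>l. h (real l / real (p * e))) {j * p..<j * p + p})"
  proof (rule sum.cong[OF refl])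
    fix j
    show "(\<Sum>i<p. h (real (j * p + i) / real (p * e))) = sum (\<lambda>l. h (real l / real (p * e))) {j * p..<j * p + p}"
      using sum.shift_bounds_nat_ivl[of "\<lambda>l. h (real l / real (p * e))" 0 "j * p" p]
      by (simp add: lessThan_atLeast0 add.commute)
  qed
  also have "\<dots> = (\<Sum>l<e * p. h (real l / real (p * e)))"
    by (rule sum.nat_group)
  finally show ?thesis .
qed

text \<open>The groups generated by \<open>1 / p\<close> and by \<open>1 / e\<close> modulo 1
  together generate the one of \<open>1 / lcm p e\<close>, and averaging over two finite subgroups
  in turn averages over their sum. Upper and lower averages are both instances.\<close>

lemma average_residues_lcm:
  fixes h :: "real \<Rightarrow> complex"
  assumes per: "\<And>x. h (x + 1) = h x" and e: "e > 0" and p: "prime p"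
  shows "1 / of_nat p * (\<Sum>i<p. 1 / of_nat e * (\<Sum>j<e. h (real i / real p + real j / real e))) =
    1 / of_nat (lcm p e) * (\<Sum>l<lcm p e. h (real l / real (lcm p e)))"
proof (cases "p dvd e")
  case True
  then obtain t where t: "e = p * t" by blast
  have p0: "p > 0" using p by (simp add: prime_gt_0_nat)
  have "(\<Sum>j<e. h (real i / real p + real j / real e)) = (\<Sum>j<e. h (real j / real e))" for i
  proof -
    have "real i / real p + real j / real e = 0 + (real j + real (i * t)) / real e" for j
      using e p0 unfolding t by (simp add: field_simps)
    then show ?thesis using sum_residues_shift[of h e 0 "i * t", OF per e] by simp
  qed
  moreover have "lcm p e = e" using True by (simp add: lcm_proj2_if_dvd)
  ultimately show ?thesis using p0 by simp
next
  case False
  then have cop: "coprime p e" using p by (simp add: prime_imp_coprime)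
  then have "lcm p e = e * p" by (simp add: lcm_coprime mult.commute)
  then show ?thesis
    using sum_residues_coprime[of h e p, OF per e prime_gt_0_nat[OF p] cop]
    by (simp add: sum_divide_distrib[symmetric] mult_ac)
qed

text \<open>The operators \<open>upper_avg d\<close> and \<open>lower_avg k q e\<close> are the orthogonal projections of level \<open>q\<close> onto the
  forms coming from level \<open>q / d\<close> by dilation and from level \<open>q / e\<close> by inclusion.\<close>

definition upper_avg :: "nat \<Rightarrow> (complex \<Rightarrow> complex) \<Rightarrow> complex \<Rightarrow> complex" where
  "upper_avg d f z = 1 / of_nat d * (\<Sum>b<d. f (z + of_real (real b / real d)))"

text \<open>The slash by the lower unitriangular matrix with real entry \<open>c\<close>. With
  \<open>c = x * q\<close> and \<open>x\<close> rational, averages over such shifts become averages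
  over \<open>x\<close> modulo 1, parallel to those over translations.\<close>

definition lower_shift :: "nat \<Rightarrow> real \<Rightarrow> (complex \<Rightarrow> complex) \<Rightarrow> complex \<Rightarrow> complex" where
  "lower_shift k c f z = f (z / (of_real c * z + 1)) / (of_real c * z + 1) ^ k"

definition lower_avg :: "nat \<Rightarrow> nat \<Rightarrow> nat \<Rightarrow> (complex \<Rightarrow> complex) \<Rightarrow> complex \<Rightarrow> complex" where
  "lower_avg k q e f z = 1 / of_nat e * (\<Sum>j<e. lower_shift k (real j / real e * real q) f z)"

lemma lower_shift_nonzero:
  assumes "z \<in> \<H>"
  shows "of_real c * z + 1 \<noteq> 0"
proof
  assume *: "of_real c * z + 1 = 0"
  then have "c * Im z = 0" by (simp add: complex_eq_iff)
  then have "c = 0" using assms by (simp add: uhp_iff)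
  then show False using * by simp
qed

lemma Im_lower_shift: "Im (z / (of_real c * z + 1)) = Im z / (cmod (of_real c * z + 1))\<^sup>2"
  by (simp add: Im_divide cmod_power2 algebra_simps)

lemma lower_shift_uhp:
  assumes "z \<in> \<H>"
  shows "z / (of_real c * z + 1) \<in> \<H>"
  using assms lower_shift_nonzero[OF assms, of c] by (simp add: uhp_iff Im_lower_shift)

lemma lower_shift_outside:
  assumes "\<And>z. z \<notin> \<H> \<Longrightarrow> f z = 0" "z \<notin> \<H>"
  shows "lower_shift k c f z = 0"
proof -
  have "z / (of_real c * z + 1) \<notin> \<H>"
    using assms(2) by (simp only: uhp_iff Im_lower_shift) (simp add: zero_less_divide_iff)
  then show ?thesis using assms(1) by (simp add: lower_shift_def)
qed

lemma lower_shift_add: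
  assumes z: "z \<in> \<H>"
  shows "lower_shift k c (lower_shift k c' f) z = lower_shift k (c + c') f z"
proof -
  define u where "u = of_real c * z + 1"
  define w where "w = z / u"
  have u: "u \<noteq> 0" unfolding u_def by (rule lower_shift_nonzero[OF z])
  have "(of_real c' * w + 1) * u = of_real c' * z + u" using u by (simp add: w_def field_simps)
  also have "\<dots> = of_real (c + c') * z + 1" by (simp add: u_def algebra_simps)
  finally have v: "(of_real c' * w + 1) * u = of_real (c + c') * z + 1" .
  have "lower_shift k c (lower_shift k c' f) z = f (w / (of_real c' * w + 1)) / ((of_real c' * w + 1) * u) ^ k"
    by (simp add: lower_shift_def u_def[symmetric] w_def[symmetric] power_mult_distrib)
  also have "w / (of_real c' * w + 1) = z / ((of_real c' * w + 1) * u)" by (simp add: w_def)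
  finally show ?thesis unfolding v by (simp add: lower_shift_def)
qed

lemma lower_shift_slash: "lower_shift k (of_int c) f z = slash k (mat2 1 0 c 1) f z"
  by (simp add: lower_shift_def slash_def moebius_def aut_factor_def)

lemma lower_trace_eq_lower_avg:
  assumes f: "\<And>z. z \<notin> \<H> \<Longrightarrow> f z = 0" and "l > 0" "e > 0"
  shows "lower_trace k l e f = lower_avg k (l * e) e f"
proof
  fix z
  have sl: "lower_shift k (real j / real e * real (l * e)) f z = slash k (mat2 1 0 (int j * int l) 1) f z" for j
    unfolding lower_shift_slash[symmetric] using assms(3) by simp
  have eq: "lower_avg k (l * e) e f z = 1 / of_nat e * (\<Sum>j<e. slash k (mat2 1 0 (int j * int l) 1) f z)"
    unfolding lower_avg_def sl ..
  show "lower_trace k l e f z = lower_avg k (l * e) e f z"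
  proof (cases "z \<in> \<H>")
    case True
    then show ?thesis unfolding eq by (simp add: lower_trace_def slash_sum_def sum_lower_reps[OF assms(2)])
  next
    case False
    then show ?thesis by (simp add: lower_trace_def slash_sum_def lower_avg_def lower_shift_outside[OF f])
  qed
qed

text \<open>The dilation and its adjoint each contribute \<open>d powr (k / 2)\<close>; their
  product cancels the \<open>d ^ k\<close> in the slash by \<open>mat2 1 0 0 (int d)\<close>,
  leaving a plain average of translates.\<close>

lemma raise_upper_trace_eq_upper_avg:
  assumes f: "\<And>z. z \<notin> \<H> \<Longrightarrow> f z = 0" and d: "d > 0"
  shows "raise_level k d (upper_trace k d f) = upper_avg d f"
proof
  fix z
  define s where "s = complex_of_real (real d powr (real k / 2))"
  have "s * s = of_real (real d powr (real k / 2) * real d powr (real k / 2))" by (simp add: s_def)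
  also have "real d powr (real k / 2) * real d powr (real k / 2) = real d ^ k"
    using d by (simp add: powr_add[symmetric] powr_realpow)
  finally have s: "s * s = of_nat d ^ k" by simp
  show "raise_level k d (upper_trace k d f) z = upper_avg d f z"
  proof (cases "z \<in> \<H>")
    case True
    then have dz: "of_nat d * z \<in> \<H>" using d by (simp add: uhp_iff)
    have "slash k (mat2 1 (int b) 0 1) (slash k (mat2 1 0 0 (int d)) f) (of_nat d * z) = f (z + of_real (real b / real d)) / of_nat d ^ k" for b
      using d by (simp add: slash_def moebius_def aut_factor_def field_simps)
    then have "raise_level k d (upper_trace k d f) z =
        s * (s / of_nat d * ((\<Sum>b<d. f (z + of_real (real b / real d))) / of_nat d ^ k))"
      using dz by (simp add: raise_level_def upper_trace_def slash_sum_def sum_upper_reps s_def sum_divide_distrib)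
    also have "\<dots> = (s * s) / of_nat d ^ k * upper_avg d f z"
      by (simp add: upper_avg_def mult_ac)
    also have "\<dots> = upper_avg d f z" using d unfolding s by simp
    finally show ?thesis .
  next
    case False
    moreover have "of_nat d * z \<notin> \<H>" using False d by (simp add: uhp_iff zero_less_mult_iff)
    moreover have "f (z + of_real x) = 0" for x using False f by (simp add: uhp_iff)
    then have "upper_avg d f z = 0" unfolding upper_avg_def by (simp only: sum.neutral_const mult_zero_right)
    ultimately show ?thesis by (simp add: raise_level_def upper_trace_def slash_sum_def)
  qed
qed

lemma upper_avg_upper_avg:
  assumes f: "f \<in> cusp_forms k l" and "e > 0" "prime p"
  shows "upper_avg p (upper_avg e f) = upper_avg (lcm p e) f"
proof
  fix z
  have per: "f (z + of_real (x + 1)) = f (z + of_real x)" for x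
  proof (cases "z \<in> \<H>")
    case True
    then have "z + of_real x \<in> \<H>" by (simp add: uhp_iff)
    from cusp_form_periodic[OF f this, of 1] show ?thesis by (simp add: add_ac)
  next
    case False
    then have "z + of_real x \<notin> \<H>" for x by (simp add: uhp_iff)
    then show ?thesis using cusp_formsD(4)[OF f] by metis
  qed
  have "upper_avg p (upper_avg e f) z = 1 / of_nat p * (\<Sum>i<p. 1 / of_nat e * (\<Sum>j<e. f (z + of_real (real i / real p + real j / real e))))"
    by (simp add: upper_avg_def add_ac)
  also have "\<dots> = upper_avg (lcm p e) f z"
    unfolding upper_avg_def by (rule average_residues_lcm[of "\<lambda>x. f (z + of_real x)", OF per assms(2,3)])
  finally show "upper_avg p (upper_avg e f) z = upper_avg (lcm p e) f z" .
qed

lemma lower_shift_sum: "lower_shift k c (\<lambda>w. a * (\<Sum>i\<in>I. f i w)) z = a * (\<Sum>i\<in>I. lower_shift k c (f i) z)"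
  by (simp add: lower_shift_def sum_divide_distrib sum_distrib_left)

text \<open>The shift by \<open>x * q\<close> has period 1 in \<open>x\<close>, because the shift by
  \<open>q\<close> itself comes from \<open>Gamma0 q\<close> and fixes \<open>f\<close>; shifts add,
  so the averages combine as averages over residues.\<close>

lemma lower_avg_lower_avg:
  assumes f: "f \<in> cusp_forms k q" and "e > 0" "prime p" and z: "z \<in> \<H>"
  shows "lower_avg k q p (lower_avg k q e f) z = lower_avg k q (lcm p e) f z"
proof -
  have q: "mat2 1 0 (int q) 1 \<in> Gamma0 q" by (simp add: Gamma0_def SL2Z_def)
  have per: "lower_shift k ((x + 1) * real q) f z = lower_shift k (x * real q) f z" for x
  proof -
    have "lower_shift k ((x + 1) * real q) f z = lower_shift k (x * real q) (lower_shift k (of_int (int q)) f) z"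
      by (subst lower_shift_add[OF z]) (simp add: algebra_simps)
    also have "\<dots> = lower_shift k (x * real q) f z"
      unfolding lower_shift_def[of k "x * real q"] lower_shift_slash
      by (simp only: slash_cusp_form[OF f q lower_shift_uhp[OF z]])
    finally show ?thesis .
  qed
  have "lower_avg k q p (lower_avg k q e f) z =
      1 / of_nat p * (\<Sum>i<p. 1 / of_nat e * (\<Sum>j<e. lower_shift k (real i / real p * real q) (lower_shift k (real j / real e * real q) f) z))"
    unfolding lower_avg_def[of k q p] unfolding lower_avg_def[abs_def] lower_shift_sum ..
  also have "\<dots> = 1 / of_nat p * (\<Sum>i<p. 1 / of_nat e * (\<Sum>j<e. lower_shift k ((real i / real p + real j / real e) * real q) f z))"
    unfolding lower_shift_add[OF z] by (simp add: distrib_right)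
  also have "\<dots> = lower_avg k q (lcm p e) f z"
    unfolding lower_avg_def by (rule average_residues_lcm[of "\<lambda>x. lower_shift k (x * real q) f z", OF per assms(2,3)])
  finally show ?thesis .
qed

text \<open>Writing \<open>n\<^sub>x\<close> and \<open>L\<^sub>c\<close> for the upper and lower unitriangular matrices with entries \<open>x = b / d\<close> and
  \<open>c = j q / p\<close>, the commutator of the two lies in \<open>Gamma0 q\<close> as soon as \<open>c x\<close> and \<open>c x\<^sup>2\<close> are integers
  and \<open>c\<^sup>2 x\<close> is divisible by \<open>q\<close>. This is where divisibility of \<open>q\<close> by cubes of primes enters.\<close>

lemma lower_shift_translate:
  assumes f: "f \<in> cusp_forms k q" and z: "z \<in> \<H>"
    and A: "c * x = of_int A" and B: "c * x\<^sup>2 = of_int B" and C: "c\<^sup>2 * x = of_int (int q * C)"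
  shows "lower_shift k c (\<lambda>w. f (w + of_real x)) z = lower_shift k c f (z + of_real x)"
proof -
  \<comment> \<open>The commutator multiplied out: its entries are
    \<open>1 + c x + (c x)\<^sup>2\<close>, \<open>- c x\<^sup>2\<close>, \<open>c\<^sup>2 x\<close>
    and \<open>1 - c x\<close>. It sends the image of \<open>z + x\<close> under
    \<open>L\<^sub>c\<close> to \<open>x\<close> plus the image of \<open>z\<close>.\<close>
  define M where "M = mat2 (1 + A + A\<^sup>2) (- B) (int q * C) (1 - A)"
  define X c' where "X = complex_of_real x" and "c' = complex_of_real c"
  define D where "D = c' * (z + X) + 1"
  define u where "u = c' * z + 1"
  define w where "w = (z + X) / D"
  have A': "of_int A = c' * X" and B': "of_int B = c' * X\<^sup>2" and C': "of_int (int q * C) = c'\<^sup>2 * X"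
    using arg_cong[OF A, of complex_of_real] arg_cong[OF B, of complex_of_real] arg_cong[OF C, of complex_of_real]
    by (simp_all add: X_def c'_def)
  \<comment> \<open>Both sides are \<open>(c x)\<^sup>3\<close>. Since
    \<open>(1 + A + A\<^sup>2) * (1 - A)\<close> is \<open>1 - A\<^sup>3\<close>, this gives
    determinant 1.\<close>
  have "real_of_int (A ^ 3) = (c * x) ^ 3" using A by simp
  also have "\<dots> = (c * x\<^sup>2) * (c\<^sup>2 * x)" by (simp add: power2_eq_square power3_eq_cube)
  also have "\<dots> = real_of_int (B * (int q * C))" using B C by simp
  finally have "A ^ 3 = B * (int q * C)" by (simp only: of_int_eq_iff)
  then have "(1 + A + A\<^sup>2) * (1 - A) + B * (int q * C) = 1"
    by (simp add: power2_eq_square power3_eq_cube algebra_simps)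
  then have M: "M \<in> Gamma0 q" by (simp add: M_def Gamma0_def SL2Z_def)
  have zX: "z + X \<in> \<H>" using z by (simp add: X_def uhp_iff)
  have D: "D \<noteq> 0" and u: "u \<noteq> 0"
    using lower_shift_nonzero[OF zX, of c] lower_shift_nonzero[OF z, of c] by (simp_all add: D_def u_def c'_def)
  have w: "w \<in> \<H>" using lower_shift_uhp[OF zX, of c] by (simp add: w_def D_def c'_def)
  have wD: "w * D = z + X" using D by (simp add: w_def)
  have "aut_factor M w * D = c'\<^sup>2 * X * (w * D) + (1 - c' * X) * D"
    by (simp only: aut_factor_def M_def mat2_nth C' of_int_diff of_int_1 A') (simp add: algebra_simps)
  also have "\<dots> = u" unfolding wD by (simp add: D_def u_def power2_eq_square algebra_simps)
  finally have aut: "aut_factor M w = u / D" using D by (simp add: field_simps)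
  have "(of_int (M$1$1) * w + of_int (M$1$2)) * D = (1 + c' * X + (c' * X)\<^sup>2) * (w * D) - c' * X\<^sup>2 * D"
    by (simp add: M_def A' B' algebra_simps)
  also have "\<dots> = z + X * u" unfolding wD by (simp add: D_def u_def power2_eq_square algebra_simps)
  finally have num: "of_int (M$1$1) * w + of_int (M$1$2) = (z + X * u) / D" using D by (simp add: field_simps)
  have "moebius M w = z / u + X"
    unfolding moebius_def num aut using D u by (simp add: field_simps)
  then have "f (z / u + X) = (u / D) ^ k * f w"
    using cusp_formsD(2)[OF f M w] by (simp add: aut)
  then have "f (z / u + X) / u ^ k = f w / D ^ k" using u by (simp add: power_divide)
  then show ?thesis by (simp add: lower_shift_def w_def D_def u_def X_def c'_def)
qed

text \<open>With \<open>c = j q / p\<close> and \<open>x = b / d\<close>, the numbers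
  \<open>c x\<^sup>2\<close> and \<open>c\<^sup>2 x / q\<close> have denominators
  \<open>p d\<^sup>2\<close> and \<open>p\<^sup>2 d\<close> against a numerator divisible by
  \<open>q\<close>; the two divisibility hypotheses are exactly those. Each shift then commutes with
  each translation.\<close>

lemma upper_avg_lower_avg_commute:
  assumes f: "f \<in> cusp_forms k q" and z: "z \<in> \<H>" and pos: "p > 0" "d > 0"
    and dvd: "p * d\<^sup>2 dvd q" "p\<^sup>2 * d dvd q"
  shows "lower_avg k q p (upper_avg d f) z = upper_avg d (lower_avg k q p f) z"
proof -
  have *: "lower_shift k (real j / real p * real q) (\<lambda>w. f (w + of_real (real b / real d))) z =
      lower_shift k (real j / real p * real q) f (z + of_real (real b / real d))" for j b
  proof -
    obtain r where r: "q = p * d\<^sup>2 * r" using dvd(1) by blast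
    obtain s where s: "q = p\<^sup>2 * d * s" using dvd(2) by blast
    show ?thesis
    proof (rule lower_shift_translate[OF f z])
      have q: "real q = real p * (real d)\<^sup>2 * real r" "real q = (real p)\<^sup>2 * real d * real s"
        using arg_cong[OF r, of real] arg_cong[OF s, of real] by simp_all
      show "real j / real p * real q * (real b / real d) = of_int (int (j * b * d * r))"
        unfolding q(1) using pos by (simp add: field_simps power2_eq_square)
      show "real j / real p * real q * (real b / real d)\<^sup>2 = of_int (int (j * b\<^sup>2 * r))"
        unfolding q(1) using pos by (simp add: field_simps power2_eq_square)
      have "(real j / real p * real q)\<^sup>2 * (real b / real d) = real q * ((real j)\<^sup>2 * real b * (real q / ((real p)\<^sup>2 * real d)))"
        using pos by (simp add: field_simps power2_eq_square)
      also have "real q / ((real p)\<^sup>2 * real d) = real s" unfolding q(2) using pos by simp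
      finally show "(real j / real p * real q)\<^sup>2 * (real b / real d) = of_int (int q * int (j\<^sup>2 * b * s))" by simp
    qed
  qed
  have "lower_avg k q p (upper_avg d f) z = 1 / of_nat p * (\<Sum>j<p. 1 / of_nat d * (\<Sum>b<d.
      lower_shift k (real j / real p * real q) (\<lambda>w. f (w + of_real (real b / real d))) z))"
    unfolding lower_avg_def upper_avg_def[abs_def] lower_shift_sum ..
  also have "\<dots> = 1 / of_nat d * (\<Sum>b<d. 1 / of_nat p * (\<Sum>j<p.
      lower_shift k (real j / real p * real q) f (z + of_real (real b / real d))))"
    unfolding * by (simp add: sum_distrib_left mult_ac) (rule sum.swap)
  also have "\<dots> = upper_avg d (lower_avg k q p f) z"
    by (simp add: lower_avg_def upper_avg_def)
  finally show ?thesis .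
qed

section \<open>Squarefree divisors and Moebius sums\<close>

lemma squarefree_product_dvd_cubefull:
  fixes a b c q :: nat
  assumes q: "q > 0" and cube: "\<And>p. prime p \<Longrightarrow> p dvd q \<Longrightarrow> p ^ 3 dvd q"
    and "squarefree a" "squarefree b" "squarefree c" "a dvd q" "b dvd q" "c dvd q"
  shows "a * b * c dvd q"
proof (rule multiplicity_le_imp_dvd)
  have nz: "a \<noteq> 0" "b \<noteq> 0" "c \<noteq> 0" using assms(3-5) by (metis not_squarefree_0)+
  then show "a * b * c \<noteq> 0" by simp
  fix p :: nat assume p: "prime p"
  have mult: "multiplicity p (a * b * c) = multiplicity p a + multiplicity p b + multiplicity p c"
    using p nz by (simp add: prime_elem_multiplicity_mult_distrib)
  show "multiplicity p (a * b * c) \<le> multiplicity p q"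
  proof (cases "p dvd q")
    case True
    \<comment> \<open>Three squarefree factors carry at most three copies of \<open>p\<close> in
      all, and \<open>q\<close> has that many.\<close>
    then have "3 \<le> multiplicity p q" using cube[OF p True] q p
      by (intro multiplicity_geI) (auto simp: prime_gt_0_nat)
    moreover have "multiplicity p a \<le> 1" "multiplicity p b \<le> 1" "multiplicity p c \<le> 1"
      using assms(3-5) nz p by (simp_all add: squarefree_factorial_semiring'')
    ultimately show ?thesis unfolding mult by simp
  next
    case False
    then have "\<not> p dvd a" "\<not> p dvd b" "\<not> p dvd c" using assms(6-8) dvd_trans by blast+
    then show ?thesis unfolding mult by (simp add: not_dvd_imp_multiplicity_0)
  qed
qed

lemma moebius_mu_prime_mult:
  assumes p: "prime p" and e: "squarefree e" "\<not> p dvd e"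
  shows "squarefree (p * e)" "moebius_mu (p * e) = - moebius_mu e"
proof -
  have cop: "coprime p e" using p e(2) by (simp add: prime_imp_coprime)
  show sq: "squarefree (p * e)" by (rule squarefree_mult_coprime[OF cop squarefree_prime[OF p] e(1)])
  have "e \<noteq> 0" using e(1) by (metis not_squarefree_0)
  then have "prime_factors (p * e) = insert p (prime_factors e)"
    using p prime_gt_0_nat[OF p] by (subst prime_factors_product) (auto simp: prime_factorization_prime)
  moreover have "p \<notin> prime_factors e" using e(2) by auto
  ultimately show "moebius_mu (p * e) = - moebius_mu e"
    using sq e(1) by (simp add: moebius_mu_def)
qed

definition squarefree_divisors :: "nat \<Rightarrow> nat set" where
  "squarefree_divisors q = {d. d dvd q \<and> squarefree d}"

lemma finite_squarefree_divisors: "q > 0 \<Longrightarrow> finite (squarefree_divisors q)"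
  by (simp add: squarefree_divisors_def)

text \<open>For \<open>e\<close> prime to \<open>p\<close>, the divisors \<open>e\<close> and
  \<open>p * e\<close> have the same \<open>lcm\<close> with \<open>p\<close> and opposite Moebius
  values. Applied to averages, this says that the factor \<open>1 - P\<^sub>p\<close> kills what
  \<open>P\<^sub>p\<close> produces.\<close>

lemma sum_moebius_mu_lcm:
  fixes g :: "nat \<Rightarrow> complex"
  assumes q: "q > 0" and p: "prime p" "p dvd q"
  shows "(\<Sum>e\<in>squarefree_divisors q. of_int (moebius_mu e) * g (lcm p e)) = 0"
proof -
  define S where "S = {e \<in> squarefree_divisors q. \<not> p dvd e}"
  have fin: "finite S" using finite_squarefree_divisors[OF q] by (simp add: S_def)
  have p0: "p > 0" using p by (simp add: prime_gt_0_nat)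
  have split: "squarefree_divisors q = S \<union> (\<lambda>e. p * e) ` S"
  proof (intro equalityI subsetI)
    fix e assume e: "e \<in> squarefree_divisors q"
    show "e \<in> S \<union> (\<lambda>e. p * e) ` S"
    proof (cases "p dvd e")
      case True
      then obtain t where t: "e = p * t" by blast
      have sq: "squarefree (p * t)" "p * t dvd q" using e by (auto simp: squarefree_divisors_def t)
      have "\<not> p dvd t"
      proof
        assume "p dvd t"
        then have "p ^ 2 dvd p * t" by (simp add: power2_eq_square)
        then show False using squarefreeD[OF sq(1)] p(1) not_prime_unit by blast
      qed
      moreover have "t \<in> squarefree_divisors q"
        using sq squarefree_multD(2)[OF sq(1)] dvd_mult_right by (auto simp: squarefree_divisors_def)
      ultimately show ?thesis using t by (auto simp: S_def)
    qed (use e in \<open>auto simp: S_def\<close>)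
  next
    fix e assume "e \<in> S \<union> (\<lambda>e. p * e) ` S"
    then show "e \<in> squarefree_divisors q"
    proof
      assume "e \<in> (\<lambda>e. p * e) ` S"
      then obtain t where t: "t \<in> S" "e = p * t" by blast
      then have "coprime p t" using p by (simp add: S_def prime_imp_coprime)
      then have "p * t dvd q" using t p by (intro divides_mult) (auto simp: S_def squarefree_divisors_def)
      then show ?thesis using t moebius_mu_prime_mult(1)[OF p(1), of t] by (auto simp: S_def squarefree_divisors_def)
    qed (simp add: S_def)
  qed
  have disj: "S \<inter> (\<lambda>e. p * e) ` S = {}" by (auto simp: S_def)
  have "(\<Sum>e\<in>squarefree_divisors q. of_int (moebius_mu e) * g (lcm p e)) =
      (\<Sum>e\<in>S. of_int (moebius_mu e) * g (lcm p e)) + (\<Sum>e\<in>(\<lambda>e. p * e) ` S. of_int (moebius_mu e) * g (lcm p e))"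
    unfolding split using fin disj by (intro sum.union_disjoint) auto
  also have "(\<Sum>e\<in>(\<lambda>e. p * e) ` S. of_int (moebius_mu e) * g (lcm p e)) =
      (\<Sum>e\<in>S. of_int (moebius_mu (p * e)) * g (lcm p (p * e)))"
    using p0 by (subst sum.reindex) (auto simp: inj_on_def)
  also have "\<dots> = (\<Sum>e\<in>S. - (of_int (moebius_mu e) * g (lcm p e)))"
  proof (rule sum.cong[OF refl])
    fix e assume e: "e \<in> S"
    then have "coprime p e" using p by (simp add: S_def prime_imp_coprime)
    then have "lcm p e = p * e" by (simp add: lcm_coprime)
    moreover have "lcm p (p * e) = p * e" by (simp add: lcm_proj2_if_dvd)
    moreover have "moebius_mu (p * e) = - moebius_mu e"
      using e p by (intro moebius_mu_prime_mult) (auto simp: S_def squarefree_divisors_def)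
    ultimately show "of_int (moebius_mu (p * e)) * g (lcm p (p * e)) = - (of_int (moebius_mu e) * g (lcm p e))" by simp
  qed
  finally show ?thesis by (simp add: sum_negf)
qed

section \<open>The projection onto the newspace\<close>

lemma lower_avg_sum: "lower_avg k q p (\<lambda>z. \<Sum>x\<in>X. c x * F x z) z = (\<Sum>x\<in>X. c x * lower_avg k q p (F x) z)"
proof -
  have "lower_shift k r (\<lambda>z. \<Sum>x\<in>X. c x * F x z) z = (\<Sum>x\<in>X. c x * lower_shift k r (F x) z)" for r
    by (simp add: lower_shift_def sum_divide_distrib)
  then have "lower_avg k q p (\<lambda>z. \<Sum>x\<in>X. c x * F x z) z =
      1 / of_nat p * (\<Sum>x\<in>X. \<Sum>j<p. c x * lower_shift k (real j / real p * real q) (F x) z)"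
    unfolding lower_avg_def by (simp only: sum.swap[of _ _ X])
  also have "\<dots> = (\<Sum>x\<in>X. c x * lower_avg k q p (F x) z)"
    unfolding lower_avg_def sum_distrib_left by (simp add: mult_ac)
  finally show ?thesis .
qed

lemma upper_avg_sum: "upper_avg p (\<lambda>z. \<Sum>x\<in>X. c x * F x z) z = (\<Sum>x\<in>X. c x * upper_avg p (F x) z)"
proof -
  have "upper_avg p (\<lambda>z. \<Sum>x\<in>X. c x * F x z) z =
      1 / of_nat p * (\<Sum>x\<in>X. \<Sum>j<p. c x * F x (z + of_real (real j / real p)))"
    unfolding upper_avg_def by (simp only: sum.swap[of _ _ X])
  also have "\<dots> = (\<Sum>x\<in>X. c x * upper_avg p (F x) z)"
    unfolding upper_avg_def sum_distrib_left by (simp add: mult_ac)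
  finally show ?thesis .
qed

lemma upper_avg_1 [simp]: "upper_avg (Suc 0) f = f"
  by (simp add: upper_avg_def fun_eq_iff)

lemma lower_avg_1 [simp]: "lower_avg k q (Suc 0) f = f"
  by (simp add: lower_avg_def lower_shift_def fun_eq_iff)

lemma upper_avg_cong_uhp:
  assumes "\<And>z. z \<in> \<H> \<Longrightarrow> f z = g z" "z \<in> \<H>"
  shows "upper_avg d f z = upper_avg d g z"
proof -
  have *: "f (z + of_real x) = g (z + of_real x)" for x
    using assms by (simp add: uhp_iff)
  show ?thesis unfolding upper_avg_def * ..
qed

lemma raise_level_eq_0:
  assumes "raise_level k d f = (\<lambda>z. 0)" "d > 0"
  shows "f = (\<lambda>z. 0)"
proof
  fix z
  have "raise_level k d f (z / of_nat d) = 0" using assms(1) by simp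
  then show "f z = 0" using assms(2) by (simp add: raise_level_def)
qed

lemma petersson_zero_left [simp]: "petersson V k l (\<lambda>z. 0) g = 0"
  by (simp add: petersson_def)

definition new_projection :: "nat \<Rightarrow> nat \<Rightarrow> (complex \<Rightarrow> complex) \<Rightarrow> complex \<Rightarrow> complex" where
  "new_projection k q f z = (\<Sum>x\<in>squarefree_divisors q \<times> squarefree_divisors q.
     of_int (moebius_mu (fst x) * moebius_mu (snd x)) * upper_avg (fst x) (lower_avg k q (snd x) f) z)"

section \<open>Orthonormal expansions and transfer of coefficient sums\<close>

context orthonormal_bases
begin

lemma orthonormal_expansion:
  assumes l: "l > 0" and C: "is_orthonormal_basis V k l S C" and S: "S \<subseteq> cusp_forms k l" and f: "f \<in> S"
  shows "f = (\<lambda>z. \<Sum>\<phi>\<in>C. petersson V k l f \<phi> * \<phi> z)"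
proof -
  have C': "finite C" "cfun_span C = S" "\<And>\<phi> \<psi>. \<phi> \<in> C \<Longrightarrow> \<psi> \<in> C \<Longrightarrow> petersson V k l \<phi> \<psi> = (if \<phi> = \<psi> then 1 else 0)"
    using C by (auto simp: is_orthonormal_basis_def)
  have CA: "\<phi> \<in> cusp_forms k l" if "\<phi> \<in> C" for \<phi>
    using that C'(2) S cfun.span_base by blast
  obtain c where c: "f = (\<lambda>z. \<Sum>\<phi>\<in>C. c \<phi> * \<phi> z)"
    using basis_expansion[OF C'(1)] f C'(2) by blast
  have "petersson V k l f \<phi> = c \<phi>" if "\<phi> \<in> C" for \<phi>
  proof -
    have "petersson V k l f \<phi> = (\<Sum>\<psi>\<in>C. c \<psi> * petersson V k l \<psi> \<phi>)"
      unfolding c by (rule petersson_sum_left[OF l CA[OF that] CA])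
    also have "\<dots> = (\<Sum>\<psi>\<in>C. if \<psi> = \<phi> then c \<phi> else 0)"
      using that by (intro sum.cong refl) (auto simp: C'(3))
    also have "\<dots> = c \<phi>" using that C'(1) by simp
    finally show ?thesis .
  qed
  then show ?thesis by (subst c) (simp cong: sum.cong)
qed

lemma basis_in_cusp_forms:
  assumes "is_orthonormal_basis V k l S C" "S \<subseteq> cusp_forms k l" "\<phi> \<in> C"
  shows "\<phi> \<in> cusp_forms k l" "\<phi> \<in> S"
  using assms cfun.span_base by (auto simp: is_orthonormal_basis_def)

text \<open>Expanding \<open>U \<psi>\<close> in the basis \<open>C\<close> and the \<open>W \<phi>\<close> in the basis \<open>B l\<close>, both sides become the same double sum.\<close>

lemma coefficient_sum_transfer:
  assumes l: "l > 0" and l': "l' > 0" and C: "is_orthonormal_basis V k l' S C" and S: "S \<subseteq> cusp_forms k l'"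
    and W: "\<And>\<phi>. \<phi> \<in> C \<Longrightarrow> W \<phi> \<in> cusp_forms k l"
    and U: "\<And>\<psi>. \<psi> \<in> B l \<Longrightarrow> U \<psi> \<in> S"
    and adj: "\<And>\<psi> \<phi>. \<psi> \<in> B l \<Longrightarrow> \<phi> \<in> C \<Longrightarrow> petersson V k l \<psi> (W \<phi>) = petersson V k l' (U \<psi>) \<phi>"
    and lin: "\<And>c. W (\<lambda>z. \<Sum>\<phi>\<in>C. c \<phi> * \<phi> z) = (\<lambda>z. \<Sum>\<phi>\<in>C. c \<phi> * W \<phi> z)"
    and m: "m > 0" and n: "n > 0"
  shows "(\<Sum>\<phi>\<in>C. fourier_coeff k (W \<phi>) m * cnj (fourier_coeff k (W \<phi>) n)) =
    (\<Sum>\<psi>\<in>B l. fourier_coeff k (W (U \<psi>)) m * cnj (fourier_coeff k \<psi> n))"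
proof -
  have finC: "finite C" using C by (simp add: is_orthonormal_basis_def)
  have finB: "finite (B l)" using onb[OF l] by (simp add: is_orthonormal_basis_def)
  have BA: "\<psi> \<in> cusp_forms k l" if "\<psi> \<in> B l" for \<psi>
    using basis_in_cusp_forms(1)[OF onb[OF l] _ that] by simp
  have 1: "fourier_coeff k (W (U \<psi>)) m = (\<Sum>\<phi>\<in>C. petersson V k l \<psi> (W \<phi>) * fourier_coeff k (W \<phi>) m)"
    if "\<psi> \<in> B l" for \<psi>
  proof -
    have "W (U \<psi>) = W (\<lambda>z. \<Sum>\<phi>\<in>C. petersson V k l' (U \<psi>) \<phi> * \<phi> z)"
      using orthonormal_expansion[OF l' C S U[OF that]] by simp
    also have "\<dots> = (\<lambda>z. \<Sum>\<phi>\<in>C. petersson V k l' (U \<psi>) \<phi> * W \<phi> z)" by (rule lin)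
    finally have "fourier_coeff k (W (U \<psi>)) m = (\<Sum>\<phi>\<in>C. petersson V k l' (U \<psi>) \<phi> * fourier_coeff k (W \<phi>) m)"
      using fourier_coeff_sum[OF finC W m] by simp
    then show ?thesis using adj[OF that] by simp
  qed
  have 2: "fourier_coeff k (W \<phi>) n = (\<Sum>\<psi>\<in>B l. petersson V k l (W \<phi>) \<psi> * fourier_coeff k \<psi> n)"
    if "\<phi> \<in> C" for \<phi>
  proof -
    have "fourier_coeff k (W \<phi>) n = fourier_coeff k (\<lambda>z. \<Sum>\<psi>\<in>B l. petersson V k l (W \<phi>) \<psi> * \<psi> z) n"
      using orthonormal_expansion[OF l onb[OF l] order_refl W[OF that]] by simp
    also have "\<dots> = (\<Sum>\<psi>\<in>B l. petersson V k l (W \<phi>) \<psi> * fourier_coeff k \<psi> n)"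
      by (rule fourier_coeff_sum[OF finB BA n])
    finally show ?thesis .
  qed
  have "(\<Sum>\<phi>\<in>C. fourier_coeff k (W \<phi>) m * cnj (fourier_coeff k (W \<phi>) n)) =
      (\<Sum>\<phi>\<in>C. \<Sum>\<psi>\<in>B l. fourier_coeff k (W \<phi>) m * (petersson V k l \<psi> (W \<phi>) * cnj (fourier_coeff k \<psi> n)))"
  proof (rule sum.cong[OF refl])
    fix \<phi> assume "\<phi> \<in> C"
    have "cnj (fourier_coeff k (W \<phi>) n) = (\<Sum>\<psi>\<in>B l. petersson V k l \<psi> (W \<phi>) * cnj (fourier_coeff k \<psi> n))"
      unfolding 2[OF \<open>\<phi> \<in> C\<close>] cnj_sum complex_cnj_mult
      by (intro sum.cong refl) (simp add: petersson_commute[of V k l "W \<phi>"])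
    then show "fourier_coeff k (W \<phi>) m * cnj (fourier_coeff k (W \<phi>) n) =
        (\<Sum>\<psi>\<in>B l. fourier_coeff k (W \<phi>) m * (petersson V k l \<psi> (W \<phi>) * cnj (fourier_coeff k \<psi> n)))"
      by (simp add: sum_distrib_left)
  qed
  also have "\<dots> = (\<Sum>\<psi>\<in>B l. \<Sum>\<phi>\<in>C. fourier_coeff k (W \<phi>) m * (petersson V k l \<psi> (W \<phi>) * cnj (fourier_coeff k \<psi> n)))"
    by (rule sum.swap)
  also have "\<dots> = (\<Sum>\<psi>\<in>B l. fourier_coeff k (W (U \<psi>)) m * cnj (fourier_coeff k \<psi> n))"
    by (intro sum.cong refl) (simp only: 1 sum_distrib_right, simp only: mult_ac)
  finally show ?thesis .
qed

end

section \<open>Levels divisible by the cubes of their primes\<close>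

locale cubefull_level = orthonormal_bases +
  fixes q :: nat
  assumes q_pos: "q > 0" and cubefull: "prime p \<Longrightarrow> p dvd q \<Longrightarrow> p ^ 3 dvd q"
begin

text \<open>Supplies the divisibilities under which the two traces have unitriangular
  representatives: \<open>d dvd l\<close> for the step from \<open>l * d\<close> to
  \<open>l\<close>, and \<open>e dvd l * d\<close> for the step from \<open>q\<close> to
  \<open>l * d\<close>.\<close>

lemma squarefree_divisor_level:
  assumes "d \<in> squarefree_divisors q" "e \<in> squarefree_divisors q"
  obtains l where "l > 0" "q = l * d * e" "q div (d * e) = l" "d dvd l" "e dvd l * d" "d > 0" "e > 0"
proof -
  have de: "squarefree d" "squarefree e" "d dvd q" "e dvd q" using assms by (auto simp: squarefree_divisors_def)
  obtain s where s: "q = d * d * e * s"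
    using squarefree_product_dvd_cubefull[OF q_pos cubefull de(1,1,2,3,3,4)] by blast
  obtain t where t: "q = e * e * d * t"
    using squarefree_product_dvd_cubefull[OF q_pos cubefull de(2,2,1,4,4,3)] by blast
  have pos: "d > 0" "e > 0" "s > 0" using q_pos s by (auto intro: Nat.gr0I)
  \<comment> \<open>The two factorizations of \<open>q\<close> show that \<open>q / (d e)\<close> is
    both \<open>d * s\<close> and \<open>e * t\<close>, hence divisible by \<open>d\<close> and by
    \<open>e\<close>.\<close>
  have "(d * e) * (d * s) = q" unfolding s by (simp only: mult_ac)
  also have "q = (d * e) * (e * t)" unfolding t by (simp only: mult_ac)
  finally have "(d * e) * (d * s) = (d * e) * (e * t)" .
  then have "d * s = e * t \<or> d * e = 0" by (simp only: mult_cancel1)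
  then have eq: "d * s = e * t" using pos by auto
  show ?thesis
  proof (rule that[of "d * s"])
    show "q = d * s * d * e" using s by (simp add: mult_ac)
    then show "q div (d * e) = d * s" using pos by (simp add: mult.assoc)
    show "e dvd d * s * d" unfolding eq by simp
  qed (use pos in auto)
qed

text \<open>The dilation goes from level \<open>l\<close> to \<open>l * d\<close>, and inclusion
  goes on to \<open>q\<close>. The adjoint takes the steps back in reverse order: first the trace
  along the inclusion, then the trace along the dilation.\<close>

lemma projection_factorization:
  assumes d: "d \<in> squarefree_divisors q" and e: "e \<in> squarefree_divisors q" and f: "f \<in> cusp_forms k q"
  defines "l \<equiv> q div (d * e)"
  defines "g \<equiv> upper_trace k d (lower_trace k (l * d) e f)"
  shows "g \<in> cusp_forms k l" "raise_level k d g = upper_avg d (lower_avg k q e f)"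
    "\<phi> \<in> cusp_forms k l \<Longrightarrow> petersson V k q f (raise_level k d \<phi>) = petersson V k l g \<phi>"
proof -
  obtain l' where l': "l' > 0" "q = l' * d * e" "q div (d * e) = l'" "d dvd l'" "e dvd l' * d" "d > 0" "e > 0"
    using squarefree_divisor_level[OF d e] .
  have l: "l > 0" "q = l * d * e" "d dvd l" "e dvd l * d" "l * d > 0" using l' by (simp_all add: l_def)
  have f': "f \<in> cusp_forms k (l * d * e)" using f l(2) by simp
  have h: "lower_trace k (l * d) e f \<in> cusp_forms k (l * d)"
    by (rule lower_trace_cusp_form[OF l(4,5) l'(7) f'])
  show "g \<in> cusp_forms k l" unfolding g_def by (rule upper_trace_cusp_form[OF l(3) l'(6) h])
  have "lower_trace k (l * d) e f = lower_avg k q e f"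
    using lower_trace_eq_lower_avg[OF cusp_formsD(4)[OF f] l(5) l'(7)] l(2) by simp
  then show "raise_level k d g = upper_avg d (lower_avg k q e f)"
    using raise_upper_trace_eq_upper_avg[OF cusp_formsD(4)[OF h] l'(6)] by (simp add: g_def)
  assume \<phi>: "\<phi> \<in> cusp_forms k l"
  have "petersson V k (l * d * e) f (raise_level k d \<phi>) = petersson V k (l * d) (lower_trace k (l * d) e f) (raise_level k d \<phi>)"
    by (rule petersson_lower_trace[OF l(4,5) l'(7) f' raise_level_cusp_form[OF \<phi> l'(6)]])
  also have "\<dots> = petersson V k l g \<phi>"
    unfolding g_def by (rule petersson_upper_trace[OF l(3,1) l'(6) h \<phi>])
  finally show "petersson V k q f (raise_level k d \<phi>) = petersson V k l g \<phi>" using l(2) by simp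
qed

lemma one_in_squarefree_divisors: "Suc 0 \<in> squarefree_divisors q"
  by (simp add: squarefree_divisors_def)

lemma projection_cusp_form:
  assumes d: "d \<in> squarefree_divisors q" and e: "e \<in> squarefree_divisors q" and f: "f \<in> cusp_forms k q"
  shows "upper_avg d (lower_avg k q e f) \<in> cusp_forms k q"
proof -
  obtain l where l: "l > 0" "q = l * d * e" "q div (d * e) = l" "d dvd l" "e dvd l * d" "d > 0" "e > 0"
    using squarefree_divisor_level[OF d e] .
  have "upper_avg d (lower_avg k q e f) \<in> cusp_forms k (l * d)"
    using raise_level_cusp_form[OF projection_factorization(1)[OF d e f] l(6)]
    unfolding projection_factorization(2)[OF d e f] unfolding l(3) .
  then show ?thesis using cusp_forms_mono[of "l * d" q k] l(2) by auto
qed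

lemma projection_oldspace:
  assumes d: "d \<in> squarefree_divisors q" and e: "e \<in> squarefree_divisors q" and f: "f \<in> cusp_forms k q"
    and "d \<noteq> 1 \<or> e \<noteq> 1"
  shows "upper_avg d (lower_avg k q e f) \<in> oldspace k q"
proof -
  obtain l where l: "l > 0" "q = l * d * e" "q div (d * e) = l" "d dvd l" "e dvd l * d" "d > 0" "e > 0"
    using squarefree_divisor_level[OF d e] .
  have "q div l = d * e" using l by (simp add: mult.assoc)
  moreover have "l \<noteq> q" using l(1,2) assms(4) by (auto simp: mult.assoc)
  moreover have "l dvd q" unfolding l(2) by (simp add: mult.assoc)
  ultimately have "raise_level k d (upper_trace k d (lower_trace k (q div (d * e) * d) e f)) \<in> oldspace k q"
    using projection_factorization(1)[OF d e f] unfolding l(3) oldspace_def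
    by (intro cfun.span_base CollectI exI[of _ l] exI[of _ d] exI conjI) auto
  then show ?thesis unfolding projection_factorization(2)[OF d e f] .
qed

lemma lower_avg_cusp_form:
  "e \<in> squarefree_divisors q \<Longrightarrow> f \<in> cusp_forms k q \<Longrightarrow> lower_avg k q e f \<in> cusp_forms k q"
  using projection_cusp_form[OF one_in_squarefree_divisors, of e f] by simp

lemma new_projection_cusp_form:
  assumes "f \<in> cusp_forms k q"
  shows "new_projection k q f \<in> cusp_forms k q"
  unfolding new_projection_def[abs_def]
  by (intro cusp_forms_sum cusp_forms_scale projection_cusp_form assms) auto

text \<open>In each term \<open>P\<^sub>p\<close> is moved past \<open>R\<^sub>d\<close> and
  absorbed into \<open>P\<^sub>e\<close>, which becomes the projection at \<open>lcm p e\<close>;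
  for fixed \<open>d\<close> the sum over \<open>e\<close> then vanishes.\<close>

lemma lower_avg_new_projection:
  assumes f: "f \<in> cusp_forms k q" and p: "prime p" "p dvd q"
  shows "lower_avg k q p (new_projection k q f) = (\<lambda>z. 0)"
proof
  fix z
  let ?D = "squarefree_divisors q"
  show "lower_avg k q p (new_projection k q f) z = 0"
  proof (cases "z \<in> \<H>")
    case True
    have pD: "p \<in> ?D" using p by (simp add: squarefree_divisors_def squarefree_prime)
    have *: "lower_avg k q p (upper_avg d (lower_avg k q e f)) z = upper_avg d (lower_avg k q (lcm p e) f) z"
      if d: "d \<in> ?D" and e: "e \<in> ?D" for d e
    proof -
      have sq: "squarefree p" "squarefree d" "p dvd q" "d dvd q"
        using pD d by (auto simp: squarefree_divisors_def)
      have pos: "p > 0" "d > 0" "e > 0"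
        using squarefree_divisor_level[OF pD d] squarefree_divisor_level[OF d e] by metis+
      \<comment> \<open>If \<open>p\<close> divides \<open>d\<close>, both products contain
        \<open>p\<close> to the third power, so the cube in the hypothesis on \<open>q\<close> is
        used in full.\<close>
      have dvd: "p * d\<^sup>2 dvd q" "p\<^sup>2 * d dvd q"
        using squarefree_product_dvd_cubefull[OF q_pos cubefull, of p d d]
          squarefree_product_dvd_cubefull[OF q_pos cubefull, of p p d] sq
        by (simp_all add: power2_eq_square mult.assoc)
      have "lower_avg k q p (upper_avg d (lower_avg k q e f)) z = upper_avg d (lower_avg k q p (lower_avg k q e f)) z"
        by (rule upper_avg_lower_avg_commute[OF lower_avg_cusp_form[OF e f] True pos(1,2) dvd])
      also have "\<dots> = upper_avg d (lower_avg k q (lcm p e) f) z"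
        by (rule upper_avg_cong_uhp[OF lower_avg_lower_avg[OF f pos(3) p(1)] True])
      finally show ?thesis .
    qed
    have "lower_avg k q p (new_projection k q f) z =
        (\<Sum>x\<in>?D \<times> ?D. of_int (moebius_mu (fst x) * moebius_mu (snd x)) * lower_avg k q p (upper_avg (fst x) (lower_avg k q (snd x) f)) z)"
      unfolding new_projection_def[abs_def] by (rule lower_avg_sum)
    also have "\<dots> = (\<Sum>d\<in>?D. \<Sum>e\<in>?D. of_int (moebius_mu d * moebius_mu e) * lower_avg k q p (upper_avg d (lower_avg k q e f)) z)"
      by (simp add: sum.cartesian_product split_beta')
    also have "\<dots> = (\<Sum>d\<in>?D. of_int (moebius_mu d) * (\<Sum>e\<in>?D. of_int (moebius_mu e) * upper_avg d (lower_avg k q (lcm p e) f) z))"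
      unfolding sum_distrib_left by (intro sum.cong refl) (simp add: * mult_ac)
    also have "\<dots> = 0"
      using sum_moebius_mu_lcm[OF q_pos p, of "\<lambda>e. upper_avg _ (lower_avg k q e f) z"] by simp
    finally show ?thesis .
  next
    case False
    then have "lower_shift k c (new_projection k q f) z = 0" for c
      using cusp_formsD(4)[OF new_projection_cusp_form[OF f]] by (intro lower_shift_outside)
    then show ?thesis by (simp add: lower_avg_def)
  qed
qed

text \<open>Here \<open>R\<^sub>p\<close> already stands next to \<open>R\<^sub>d\<close> and is
  absorbed directly; for fixed \<open>e\<close> the sum over \<open>d\<close> vanishes.\<close>

lemma upper_avg_new_projection:
  assumes f: "f \<in> cusp_forms k q" and p: "prime p" "p dvd q"
  shows "upper_avg p (new_projection k q f) = (\<lambda>z. 0)"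
proof
  fix z
  let ?D = "squarefree_divisors q"
  have *: "upper_avg p (upper_avg d (lower_avg k q e f)) z = upper_avg (lcm p d) (lower_avg k q e f) z"
    if d: "d \<in> ?D" and e: "e \<in> ?D" for d e
  proof -
    have "d > 0" using squarefree_divisor_level[OF d e] by metis
    then show ?thesis using upper_avg_upper_avg[OF lower_avg_cusp_form[OF e f] _ p(1)] by metis
  qed
  have "upper_avg p (new_projection k q f) z =
      (\<Sum>x\<in>?D \<times> ?D. of_int (moebius_mu (fst x) * moebius_mu (snd x)) * upper_avg p (upper_avg (fst x) (lower_avg k q (snd x) f)) z)"
    unfolding new_projection_def[abs_def] by (rule upper_avg_sum)
  also have "\<dots> = (\<Sum>d\<in>?D. \<Sum>e\<in>?D. of_int (moebius_mu d * moebius_mu e) * upper_avg p (upper_avg d (lower_avg k q e f)) z)"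
    by (simp add: sum.cartesian_product split_beta')
  also have "\<dots> = (\<Sum>e\<in>?D. of_int (moebius_mu e) * (\<Sum>d\<in>?D. of_int (moebius_mu d) * upper_avg (lcm p d) (lower_avg k q e f) z))"
    unfolding sum_distrib_left by (subst sum.swap, intro sum.cong refl) (simp add: * mult_ac)
  also have "\<dots> = 0"
    using sum_moebius_mu_lcm[OF q_pos p, of "\<lambda>d. upper_avg d (lower_avg k q _ f) z"] by simp
  finally show "upper_avg p (new_projection k q f) z = 0" .
qed

text \<open>The averages that vanish on the projected form are its traces to level
  \<open>q / p\<close>, seen back at level \<open>q\<close>. Dilation being injective, both traces
  vanish, and the adjunctions turn this into orthogonality.\<close>

lemma petersson_new_projection_level:
  assumes f: "f \<in> cusp_forms k q" and p: "prime p" "q = l * p" and g: "g \<in> cusp_forms k l"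
  shows "petersson V k q (new_projection k q f) g = 0"
    and "petersson V k q (new_projection k q f) (raise_level k p g) = 0"
proof -
  have p0: "p > 0" "p dvd q" using p by (auto simp: prime_gt_0_nat)
  have l: "l > 0" using q_pos p by (auto intro: Nat.gr0I)
  obtain t where "q = p ^ 3 * t" using cubefull[OF p(1) p0(2)] by blast
  then have "l * p = (p * (p * t)) * p" using p(2) by (simp add: power3_eq_cube mult_ac)
  then have pl: "p dvd l" using p0 by simp
  note N = new_projection_cusp_form[OF f]
  have N': "new_projection k q f \<in> cusp_forms k (l * p)" using N p(2) by simp
  have "lower_trace k l p (new_projection k q f) = (\<lambda>z. 0)"
    using lower_trace_eq_lower_avg[OF cusp_formsD(4)[OF N] l p0(1)] lower_avg_new_projection[OF f p(1) p0(2)] p(2) by simp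
  then show "petersson V k q (new_projection k q f) g = 0"
    using petersson_lower_trace[OF pl l p0(1) N' g] p(2) by simp
  have "raise_level k p (upper_trace k p (new_projection k q f)) = (\<lambda>z. 0)"
    using raise_upper_trace_eq_upper_avg[OF cusp_formsD(4)[OF N] p0(1)] upper_avg_new_projection[OF f p(1) p0(2)] by simp
  then have "upper_trace k p (new_projection k q f) = (\<lambda>z. 0)"
    using p0(1) by (rule raise_level_eq_0)
  then show "petersson V k q (new_projection k q f) (raise_level k p g) = 0"
    using petersson_upper_trace[OF pl l p0(1) N' g] p(2) by simp
qed

text \<open>Write \<open>q = l * d * s\<close>. If \<open>s\<close> has a prime factor
  \<open>p\<close>, the dilate already has level \<open>q / p\<close>. Otherwise
  \<open>s = 1\<close>, so \<open>d\<close> is not 1, and for a prime \<open>p\<close> dividing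
  \<open>d\<close> the form is the dilate by \<open>p\<close> of one of level
  \<open>q / p\<close>.\<close>

lemma petersson_new_projection_raise:
  assumes f: "f \<in> cusp_forms k q" and l: "l dvd q" "l \<noteq> q" and d: "d dvd q div l" and g: "g \<in> cusp_forms k l"
  shows "raise_level k d g \<in> cusp_forms k q" "petersson V k q (new_projection k q f) (raise_level k d g) = 0"
proof -
  obtain t where t: "q = l * t" using l by blast
  have pos: "l > 0" "t > 0" using q_pos t by (auto intro: Nat.gr0I)
  then obtain s where s: "t = d * s" using d t by auto
  have pos': "d > 0" "s > 0" using pos s by (auto intro: Nat.gr0I)
  have lift: "raise_level k c h \<in> cusp_forms k b" if "h \<in> cusp_forms k a" "c > 0" "a * c dvd b" for a b c h
    using raise_level_cusp_form[OF that(1,2)] cusp_forms_mono[OF that(3)] by blast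
  show "raise_level k d g \<in> cusp_forms k q"
    using pos' by (intro lift[OF g]) (simp_all add: t s)
  show "petersson V k q (new_projection k q f) (raise_level k d g) = 0"
  proof (cases "s = 1")
    case False
    then obtain p r where p: "prime p" "s = p * r" using prime_factor_nat[of s] by (auto elim: dvdE)
    have "q = l * d * r * p" using t s p by (simp add: mult_ac)
    then show ?thesis
      using pos' by (intro petersson_new_projection_level(1)[OF f p(1)] lift[OF g]) (auto simp: mult.assoc)
  next
    case True
    then have "d \<noteq> 1" using l(2) t s by auto
    then obtain p r where p: "prime p" "d = p * r" using prime_factor_nat[of d] by (auto elim: dvdE)
    have r: "r > 0" "p > 0" using pos' p by (auto intro: Nat.gr0I)
    have "raise_level k d g = raise_level k p (raise_level k r g)" unfolding p(2) using r by (intro raise_level_mult)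
    moreover have "q = l * r * p" using t s p True by (simp add: mult_ac)
    ultimately show ?thesis
      using petersson_new_projection_level(2)[OF f p(1) _ lift[OF g r(1)], of "l * r"] by simp
  qed
qed

lemma petersson_sum_right:
  assumes f: "f \<in> cusp_forms k q" and g: "g \<in> cusp_forms k q" "h \<in> cusp_forms k q"
  shows "petersson V k q f (\<lambda>z. g z + h z) = petersson V k q f g + petersson V k q f h"
    and "petersson V k q f (\<lambda>z. c * g z) = cnj c * petersson V k q f g"
proof -
  have "petersson V k q (\<lambda>z. \<Sum>i\<in>{True, False}. 1 * (if i then g else h) z) f =
      (\<Sum>i\<in>{True, False}. 1 * petersson V k q (if i then g else h) f)"
    by (rule petersson_sum_left[OF q_pos f]) (use g in auto)
  then have "petersson V k q (\<lambda>z. g z + h z) f = petersson V k q g f + petersson V k q h f" by simp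
  then show "petersson V k q f (\<lambda>z. g z + h z) = petersson V k q f g + petersson V k q f h"
    by (metis petersson_commute complex_cnj_add)
  have "petersson V k q (\<lambda>z. \<Sum>i\<in>{True}. c * g z) f = (\<Sum>i\<in>{True}. c * petersson V k q g f)"
    by (rule petersson_sum_left[OF q_pos f]) (use g in auto)
  then have "petersson V k q (\<lambda>z. c * g z) f = c * petersson V k q g f" by simp
  then show "petersson V k q f (\<lambda>z. c * g z) = cnj c * petersson V k q f g"
    by (metis petersson_commute complex_cnj_mult)
qed

lemma new_projection_newspace:
  assumes f: "f \<in> cusp_forms k q"
  shows "new_projection k q f \<in> newspace V k q"
proof -
  define N where "N = new_projection k q f"
  have N: "N \<in> cusp_forms k q" unfolding N_def by (rule new_projection_cusp_form[OF f])
  define Z where "Z = {g \<in> cusp_forms k q. petersson V k q N g = 0}"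
  have "cfun.subspace Z"
    unfolding cfun.subspace_def
  proof (intro conjI ballI allI)
    have "petersson V k q N (\<lambda>z. 0) = 0" by (simp add: petersson_def)
    then show "0 \<in> Z" using cusp_forms_zero by (simp add: Z_def zero_fun_def)
    fix g assume g: "g \<in> Z"
    then show "(\<lambda>z. c * g z) \<in> Z" for c
      using petersson_sum_right(2)[OF N _ N, of g c] by (simp add: Z_def cusp_forms_scale)
    fix h assume "h \<in> Z"
    then show "g + h \<in> Z"
      using g petersson_sum_right(1)[OF N, of g h] by (simp add: Z_def cusp_forms_add plus_fun_def)
  qed
  moreover have "{raise_level k d f | l' d f. l' dvd q \<and> l' \<noteq> q \<and> d dvd q div l' \<and> f \<in> cusp_forms k l'} \<subseteq> Z"
    using petersson_new_projection_raise[OF f] by (auto simp: Z_def N_def)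
  ultimately have "oldspace k q \<subseteq> Z"
    unfolding oldspace_def by (intro cfun.span_minimal)
  then show ?thesis using N by (auto simp: newspace_def Z_def N_def)
qed

text \<open>Every term with \<open>d\<close> or \<open>e\<close> different from 1 is an oldform and
  orthogonal to \<open>\<phi>\<close>, so only the identity term survives. This is the adjunction
  that \<open>coefficient_sum_transfer\<close> takes for the inclusion of the newspace.\<close>

lemma petersson_new_projection:
  assumes f: "f \<in> cusp_forms k q" and \<phi>: "\<phi> \<in> newspace V k q"
  shows "petersson V k q f \<phi> = petersson V k q (new_projection k q f) \<phi>"
proof -
  let ?D = "squarefree_divisors q"
  have \<phi>': "\<phi> \<in> cusp_forms k q" "\<And>g. g \<in> oldspace k q \<Longrightarrow> petersson V k q g \<phi> = 0"
    using \<phi> petersson_commute[of V k q _ \<phi>] by (auto simp: newspace_def)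
  have "petersson V k q (new_projection k q f) \<phi> =
      (\<Sum>x\<in>?D \<times> ?D. of_int (moebius_mu (fst x) * moebius_mu (snd x)) * petersson V k q (upper_avg (fst x) (lower_avg k q (snd x) f)) \<phi>)"
    unfolding new_projection_def[abs_def]
    by (rule petersson_sum_left[OF q_pos \<phi>'(1)]) (use projection_cusp_form f in auto)
  also have "\<dots> = (\<Sum>x\<in>?D \<times> ?D. if x = (Suc 0, Suc 0) then petersson V k q f \<phi> else 0)"
  proof (rule sum.cong[OF refl])
    fix x assume x: "x \<in> ?D \<times> ?D"
    show "of_int (moebius_mu (fst x) * moebius_mu (snd x)) * petersson V k q (upper_avg (fst x) (lower_avg k q (snd x) f)) \<phi> =
        (if x = (Suc 0, Suc 0) then petersson V k q f \<phi> else 0)"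
    proof (cases "x = (Suc 0, Suc 0)")
      case True
      then show ?thesis by (simp add: moebius_mu_def)
    next
      case False
      then have "upper_avg (fst x) (lower_avg k q (snd x) f) \<in> oldspace k q"
        using x by (intro projection_oldspace f) (auto simp: prod_eq_iff)
      then show ?thesis using False \<phi>'(2) by simp
    qed
  qed
  also have "\<dots> = petersson V k q f \<phi>"
    using finite_squarefree_divisors[OF q_pos] one_in_squarefree_divisors by simp
  finally show ?thesis ..
qed

text \<open>The transfer with the dilation as \<open>W\<close> and the composite of the two traces
  as \<open>U\<close>. The transferred sum contains the coefficients of \<open>W \<phi>\<close> at
  both \<open>m\<close> and \<open>n\<close>, which is why \<open>d\<close> must divide
  both.\<close>

lemma projection_coefficients:
  assumes d: "d \<in> squarefree_divisors q" and e: "e \<in> squarefree_divisors q" and m: "m > 0" and n: "n > 0"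
  shows "(\<Sum>\<psi>\<in>B q. fourier_coeff k (upper_avg d (lower_avg k q e \<psi>)) m * cnj (fourier_coeff k \<psi> n)) =
    (if d dvd m \<and> d dvd n then Delta k (B (q div (d * e))) (m div d) (n div d) else 0)"
proof -
  obtain l where l: "l > 0" "q = l * d * e" "q div (d * e) = l" "d dvd l" "e dvd l * d" "d > 0" "e > 0"
    using squarefree_divisor_level[OF d e] .
  have BA: "\<phi> \<in> cusp_forms k l'" if "\<phi> \<in> B l'" "l' > 0" for \<phi> l'
    using basis_in_cusp_forms(1)[OF onb[OF that(2)] order_refl that(1)] .
  note pf = projection_factorization[OF d e, unfolded l(3)]
  have "(\<Sum>\<phi>\<in>B l. fourier_coeff k (raise_level k d \<phi>) m * cnj (fourier_coeff k (raise_level k d \<phi>) n)) =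
    (\<Sum>\<psi>\<in>B q. fourier_coeff k (raise_level k d (upper_trace k d (lower_trace k (l * d) e \<psi>))) m * cnj (fourier_coeff k \<psi> n))"
  proof (rule coefficient_sum_transfer[OF q_pos l(1) onb[OF l(1)] order_refl _ _ _ _ m n])
    fix \<phi> assume "\<phi> \<in> B l"
    then show "raise_level k d \<phi> \<in> cusp_forms k q"
      using raise_level_cusp_form[OF BA[OF _ l(1)] l(6)] cusp_forms_mono[of "l * d" q k] l(2) by auto
  next
    fix \<psi> assume "\<psi> \<in> B q"
    then show "upper_trace k d (lower_trace k (l * d) e \<psi>) \<in> cusp_forms k l"
      by (rule pf(1)[OF BA[OF _ q_pos]])
  next
    fix \<psi> \<phi> assume "\<psi> \<in> B q" "\<phi> \<in> B l"
    then show "petersson V k q \<psi> (raise_level k d \<phi>) = petersson V k l (upper_trace k d (lower_trace k (l * d) e \<psi>)) \<phi>"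
      using pf(3) BA q_pos l(1) by blast
  qed (simp add: raise_level_def fun_eq_iff sum_distrib_left mult_ac)
  also have "\<dots> = (\<Sum>\<psi>\<in>B q. fourier_coeff k (upper_avg d (lower_avg k q e \<psi>)) m * cnj (fourier_coeff k \<psi> n))"
    by (intro sum.cong refl) (simp add: pf(2) BA q_pos)
  finally have "(\<Sum>\<psi>\<in>B q. fourier_coeff k (upper_avg d (lower_avg k q e \<psi>)) m * cnj (fourier_coeff k \<psi> n)) =
      (\<Sum>\<phi>\<in>B l. fourier_coeff k (raise_level k d \<phi>) m * cnj (fourier_coeff k (raise_level k d \<phi>) n))" ..
  also have "\<dots> = (\<Sum>\<phi>\<in>B l. if d dvd m \<and> d dvd n then fourier_coeff k \<phi> (m div d) * cnj (fourier_coeff k \<phi> (n div d)) else 0)"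
    by (intro sum.cong refl) (simp add: fourier_coeff_raise_level[OF BA[OF _ l(1)] l(6)] m n)
  also have "\<dots> = (if d dvd m \<and> d dvd n then Delta k (B (q div (d * e))) (m div d) (n div d) else 0)"
    by (cases "d dvd m \<and> d dvd n") (auto simp: Delta_def l(3))
  finally show ?thesis .
qed

text \<open>The transfer once more, now with the inclusion of the newspace as \<open>W\<close> and
  \<open>new_projection\<close> as \<open>U\<close>; linearity of the coefficient at
  \<open>m\<close> then separates the terms of the Moebius sum.\<close>

lemma Delta_newspace:
  assumes C: "is_orthonormal_basis V k q (newspace V k q) C" and m: "m > 0" and n: "n > 0"
  shows "Delta k C m n = (\<Sum>d\<in>squarefree_divisors q. \<Sum>e\<in>squarefree_divisors q.
    of_int (moebius_mu d * moebius_mu e) *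
      (if d dvd m \<and> d dvd n then Delta k (B (q div (d * e))) (m div d) (n div d) else 0))"
proof -
  let ?D = "squarefree_divisors q"
  have new: "newspace V k q \<subseteq> cusp_forms k q" by (auto simp: newspace_def)
  have BA: "\<psi> \<in> cusp_forms k q" if "\<psi> \<in> B q" for \<psi>
    using basis_in_cusp_forms(1)[OF onb[OF q_pos] order_refl that] .
  have finD: "finite (?D \<times> ?D)" using finite_squarefree_divisors[OF q_pos] by simp
  have "Delta k C m n = (\<Sum>\<phi>\<in>C. fourier_coeff k \<phi> m * cnj (fourier_coeff k \<phi> n))" by (simp add: Delta_def)
  also have "\<dots> = (\<Sum>\<psi>\<in>B q. fourier_coeff k (new_projection k q \<psi>) m * cnj (fourier_coeff k \<psi> n))"
    by (rule coefficient_sum_transfer[OF q_pos q_pos C new, where W = "\<lambda>f. f"])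
       (use basis_in_cusp_forms[OF C new] new_projection_newspace petersson_new_projection BA m n in auto)
  also have "\<dots> = (\<Sum>\<psi>\<in>B q. \<Sum>x\<in>?D \<times> ?D. of_int (moebius_mu (fst x) * moebius_mu (snd x)) *
      (fourier_coeff k (upper_avg (fst x) (lower_avg k q (snd x) \<psi>)) m * cnj (fourier_coeff k \<psi> n)))"
  proof (rule sum.cong[OF refl])
    fix \<psi> assume "\<psi> \<in> B q"
    then have "fourier_coeff k (new_projection k q \<psi>) m = (\<Sum>x\<in>?D \<times> ?D. of_int (moebius_mu (fst x) * moebius_mu (snd x)) *
        fourier_coeff k (upper_avg (fst x) (lower_avg k q (snd x) \<psi>)) m)"
      unfolding new_projection_def[abs_def]
      by (intro fourier_coeff_sum[OF finD _ m, where l = q] projection_cusp_form BA) auto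
    then show "fourier_coeff k (new_projection k q \<psi>) m * cnj (fourier_coeff k \<psi> n) =
      (\<Sum>x\<in>?D \<times> ?D. of_int (moebius_mu (fst x) * moebius_mu (snd x)) *
        (fourier_coeff k (upper_avg (fst x) (lower_avg k q (snd x) \<psi>)) m * cnj (fourier_coeff k \<psi> n)))"
      by (simp only: sum_distrib_right, simp only: mult_ac)
  qed
  also have "\<dots> = (\<Sum>x\<in>?D \<times> ?D. of_int (moebius_mu (fst x) * moebius_mu (snd x)) *
      (\<Sum>\<psi>\<in>B q. fourier_coeff k (upper_avg (fst x) (lower_avg k q (snd x) \<psi>)) m * cnj (fourier_coeff k \<psi> n)))"
    by (subst sum.swap) (simp only: sum_distrib_left)
  also have "\<dots> = (\<Sum>x\<in>?D \<times> ?D. of_int (moebius_mu (fst x) * moebius_mu (snd x)) *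
      (if fst x dvd m \<and> fst x dvd n then Delta k (B (q div (fst x * snd x))) (m div fst x) (n div fst x) else 0))"
    by (rule sum.cong[OF refl], subst projection_coefficients[OF _ _ m n]) auto
  finally show ?thesis
    unfolding sum.cartesian_product by (simp add: split_beta')
qed

end

theorem mainTheorem4:
  fixes k q m n :: nat
    and V :: real
    and B Bnew :: "nat \<Rightarrow> (complex \<Rightarrow> complex) set"
  assumes "k > 0" and "V > 0"
    and "\<And>l. l > 0 \<Longrightarrow> is_orthonormal_basis V k l (cusp_forms k l) (B l)"
    and "\<And>l. l > 0 \<Longrightarrow> is_orthonormal_basis V k l (newspace V k l) (Bnew l)"
    and "q > 0" and "\<And>p. prime p \<Longrightarrow> p dvd q \<Longrightarrow> p ^ 3 dvd q"
    and "m > 0" and "n > 0"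
  shows "Delta k (Bnew q) m n =
    (\<Sum>d | d dvd gcd (gcd m n) q. \<Sum>e | e dvd q.
       of_int (moebius_mu d * moebius_mu e) * Delta k (B (q div (d * e))) (m div d) (n div d))"
proof -
  interpret cubefull_level V k B q
    using assms by unfold_locales auto
  let ?D = "squarefree_divisors q"
  let ?F = "\<lambda>d e. of_int (moebius_mu d * moebius_mu e) * Delta k (B (q div (d * e))) (m div d) (n div d)"
  have mu: "moebius_mu d = 0" if "\<not> squarefree d" for d using that by (simp add: moebius_mu_def)
  have "(\<Sum>d | d dvd gcd (gcd m n) q. \<Sum>e | e dvd q. ?F d e) = (\<Sum>d | d dvd gcd (gcd m n) q. \<Sum>e\<in>?D. ?F d e)"
    using q_pos by (intro sum.cong refl sum.mono_neutral_right) (auto simp: squarefree_divisors_def mu)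
  \<comment> \<open>On the left the values of \<open>d\<close> that are not squarefree drop out; on
    the right those that do not divide both \<open>m\<close> and \<open>n\<close> contribute 0. The
    remaining ranges of \<open>d\<close> coincide.\<close>
  also have "\<dots> = (\<Sum>d\<in>?D. \<Sum>e\<in>?D. of_int (moebius_mu d * moebius_mu e) *
      (if d dvd m \<and> d dvd n then Delta k (B (q div (d * e))) (m div d) (n div d) else 0))"
    using q_pos finite_squarefree_divisors[OF q_pos]
    by (intro sum.mono_neutral_cong) (auto simp: squarefree_divisors_def mu)
  finally show ?thesis
    using Delta_newspace[OF assms(4)[OF q_pos] assms(7,8)] by simp
qed

end
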